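(* Let $\nabla$ be a linear connection on a representation $V\to M$ of a Lie algebroid $A\Rightarrow M$. The exterior covariant derivative $d^\nabla\colon W^{p,q}(A;V)\to W^{p,q+1}(A;V)$ commutes with the simplicial differential, $\delta d^\nabla=d^\nabla\delta$ (for all $p,q\ge0$), if and only if $\nabla$ is $A$-invariant, that is, $$\nabla^A_\alpha=\nabla_{\rho(\alpha)}\quad\text{and}\quad\iota_{\rho(\alpha)}R^\nabla=0\qquad\text{for all }\alpha\in A.$$ In particular, if $\nabla$ is $A$-invariant, the operator $d^\nabla$ maps infinitesimal multiplicative (IM) forms to IM forms.
   Context: $A\Rightarrow M$ is a Lie algebroid with anchor $\rho$. A representation on $V\to M$ is a flat $A$-connection $\nabla^A$ on $V$. $R^\nabla\in\Omega^2(M;\operatorname{End}V)$ is the curvature of $\nabla$. No compatibility between $\nabla$ and $\nabla^A$ is assumed a priori. Weil cochains: $W^{p,q}(A;V)$ is the set of sequences $c=(c_0,\dots,c_p)$ of alternating $\mathbb R$-multilinear maps $c_k\colon\Gamma(A)^{p-k}\to\Omega^{q-k}(M;S^k(A^* )\otimes V)$ (zero if $k>q$), written $c_k(\alpha_1,\dots,\alpha_{p-k}|\beta_1,\dots,\beta_k)\in\Omega^{q-k}(M;V)$ ($C^\infty(M)$-multilinear and symmetric in the $\beta$'s), satisfying for $f\in C^\infty(M)$ the Leibniz identity $$c_k(f\alpha_1,\alpha_2,\dots,\alpha_{p-k}|\cdot)=f c_k(\alpha_1,\dots,\alpha_{p-k}|\cdot)+df\wedge c_{k+1}(\alpha_2,\dots,\alpha_{p-k}|\alpha_1,\cdot).$$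 For $\gamma\in\Omega^m(M;S^n(A^* )\otimes V)$ set $(\mathcal L^A_\alpha\gamma)(\beta_1,\dots,\beta_n)(X_1,\dots,X_m)=\nabla^A_\alpha\big(\gamma(\underline\beta)(\underline X)\big)-\sum_i\gamma(\dots,[\alpha,\beta_i],\dots)(\underline X)-\sum_j\gamma(\underline\beta)(\dots,[\rho(\alpha),X_j],\dots)$. The simplicial differential $\delta\colon W^{p,q}(A;V)\to W^{p+1,q}(A;V)$ is $$\begin{aligned}(-1)^k(\delta c)_k(\alpha_0,\dots,\alpha_{p-k}|\beta_1,\dots,\beta_k)&=\sum_{i=0}^{p-k}(-1)^i\mathcal L^A_{\alpha_i}\big(c_k(\alpha_0,\dots,\widehat{\alpha_i},\dots,\alpha_{p-k}|\cdot)\big)(\underline\beta)\\&+\sum_{i<j}(-1)^{i+j}c_k([\alpha_i,\alpha_j],\alpha_0,\dots,\widehat{\alpha_i},\dots,\widehat{\alpha_j},\dots,\alpha_{p-k}|\underline\beta)\\&-\sum_{j=1}^k\iota_{\rho(\beta_j)}c_{k-1}(\alpha_0,\dots,\alpha_{p-k}|\beta_1,\dots,\widehat{\beta_j},\dots,\beta_k).\end{aligned}$$ IM forms are the elements of $\ker\big(\delta\colon W^{1,q}(A;V)\to W^{2,q}(A;V)\big)$. The exterior covariant derivative of Weil cochains is $$(-1)^k(d^\nabla c)_k(\underline\alpha|\underline\beta)=d^\nabla\big(c_k(\underline\alpha|\underline\beta)\big)-\sum_{i=1}^kc_{k-1}(\beta_i,\underline\alpha|\beta_1,\dots,\widehat{\beta_i},\dots,\beta_k),$$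 where $d^\nabla$ on the right is the exterior covariant derivative of $V$-valued forms on $M$. *)

theory Defs
  imports "HOL-Analysis.Analysis" "HOL-Library.Function_Algebras" "HOL-Library.Multiset"
begin

section \<open>Smooth functions on open subsets of Euclidean space\<close>

text \<open>
  Points of n-dimensional Euclidean space are functions on the natural numbers that vanish from
  index n on, topologised as in \<open>Euclidean_space n\<close>; thus n = 0 is allowed.
\<close>

definition partial_deriv :: "nat \<Rightarrow> ((nat \<Rightarrow> real) \<Rightarrow> real) \<Rightarrow> (nat \<Rightarrow> real) \<Rightarrow> real" where
  "partial_deriv i F y = deriv (\<lambda>t. F (y(i := t))) (y i)"

primrec Ck_on :: "nat \<Rightarrow> nat \<Rightarrow> (nat \<Rightarrow> real) set \<Rightarrow> ((nat \<Rightarrow> real) \<Rightarrow> real) \<Rightarrow> bool" where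
  "Ck_on n 0 S F \<longleftrightarrow> continuous_map (subtopology (Euclidean_space n) S) euclideanreal F"
| "Ck_on n (Suc r) S F \<longleftrightarrow>
     continuous_map (subtopology (Euclidean_space n) S) euclideanreal F \<and>
     (\<forall>i<n. (\<forall>y\<in>S. (\<lambda>t. F (y(i := t))) differentiable at (y i)) \<and>
            Ck_on n r S (partial_deriv i F))"

definition Cinf_on :: "nat \<Rightarrow> (nat \<Rightarrow> real) set \<Rightarrow> ((nat \<Rightarrow> real) \<Rightarrow> real) \<Rightarrow> bool" where
  "Cinf_on n S F \<longleftrightarrow> (\<forall>r. Ck_on n r S F)"


section \<open>Smooth manifolds\<close>

record 'm smooth_atlas =
  mdim :: nat
  charts :: "('m set \<times> ('m \<Rightarrow> nat \<Rightarrow> real)) set"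

definition smooth_on :: "'m smooth_atlas \<Rightarrow> 'm set \<Rightarrow> ('m \<Rightarrow> real) \<Rightarrow> bool" where
  "smooth_on M S f \<longleftrightarrow>
     (\<forall>(U, \<phi>) \<in> charts M. Cinf_on (mdim M) (\<phi> ` (S \<inter> U)) (f \<circ> inv_into U \<phi>))"

text \<open>
  The underlying space of the manifold is the whole type. The last condition says that all
  transition functions are smooth, coordinate by coordinate.
\<close>

definition smooth_manifold ::
    "('m::{t2_space, second_countable_topology}) smooth_atlas \<Rightarrow> bool" where
  "smooth_manifold M \<longleftrightarrow>
     (\<Union>(U, \<phi>) \<in> charts M. U) = UNIV \<and>
     (\<forall>(U, \<phi>) \<in> charts M.
        open U \<and>
        openin (Euclidean_space (mdim M)) (\<phi> ` U) \<and>
        homeomorphic_map (top_of_set U) (subtopology (Euclidean_space (mdim M)) (\<phi> ` U)) \<phi> \<and>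
        (\<forall>i < mdim M. smooth_on M U (\<lambda>x. \<phi> x i)))"

abbreviation smooth_functions :: "'m smooth_atlas \<Rightarrow> ('m \<Rightarrow> real) set" where
  "smooth_functions M \<equiv> {f. smooth_on M UNIV f}"


section \<open>Vector bundles and their sections\<close>

text \<open>
  The fibres are subspaces of one ambient real vector space, which carries no topology and no
  relation between different fibres. This is no restriction: the fibres of any vector bundle embed
  into their direct sum. The smooth structure is given by the local frames, equivalently by the
  local trivialisations they induce; the last condition of \<open>vector_bundle\<close> says that the transition
  matrices between frames are smooth.
\<close>

record ('m, 'e) vbundle =
  fibre :: "'m \<Rightarrow> 'e set"
  vrank :: nat
  frames :: "('m set \<times> (nat \<Rightarrow> 'm \<Rightarrow> 'e)) set"

definition smooth_section_on ::
    "'m smooth_atlas \<Rightarrow> ('m, 'e::real_vector, 'z) vbundle_scheme \<Rightarrow> 'm set \<Rightarrow> ('m \<Rightarrow> 'e) \<Rightarrow> bool" where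
  "smooth_section_on M E S s \<longleftrightarrow>
     (\<forall>x\<in>S. s x \<in> fibre E x) \<and>
     (\<forall>(U, e) \<in> frames E. \<exists>a. (\<forall>i < vrank E. smooth_on M (S \<inter> U) (a i)) \<and>
                              (\<forall>x \<in> S \<inter> U. s x = (\<Sum>i < vrank E. a i x *\<^sub>R e i x)))"

definition vector_bundle ::
    "('m::{t2_space, second_countable_topology}) smooth_atlas \<Rightarrow>
     ('m, 'e::real_vector, 'z) vbundle_scheme \<Rightarrow> bool" where
  "vector_bundle M E \<longleftrightarrow>
     (\<forall>x. subspace (fibre E x)) \<and>
     (\<Union>(U, e) \<in> frames E. U) = UNIV \<and>
     (\<forall>(U, e) \<in> frames E.
        open U \<and>
        (\<forall>x\<in>U. inj_on (\<lambda>i. e i x) {..<vrank E} \<and>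
                independent ((\<lambda>i. e i x) ` {..<vrank E}) \<and>
                span ((\<lambda>i. e i x) ` {..<vrank E}) = fibre E x) \<and>
        (\<forall>i < vrank E. smooth_section_on M E U (e i)))"

definition sections ::
    "'m smooth_atlas \<Rightarrow> ('m, 'e::real_vector, 'z) vbundle_scheme \<Rightarrow> ('m \<Rightarrow> 'e) set" where
  "sections M E = {s. smooth_section_on M E UNIV s}"

definition sec_scale :: "('m \<Rightarrow> real) \<Rightarrow> ('m \<Rightarrow> 'e::real_vector) \<Rightarrow> 'm \<Rightarrow> 'e" (infixr \<open>\<cdot>\<^sub>s\<close> 75) where
  "f \<cdot>\<^sub>s s = (\<lambda>x. f x *\<^sub>R s x)"


section \<open>Tangent vectors and vector fields\<close>

text \<open>
  Tangent vectors at x are the derivations at x of the algebra of smooth functions. Their value on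
  functions that are not smooth is fixed to be 0, so that equal tangent vectors are equal as
  HOL functions.
\<close>

type_synonym 'm tvector = "('m \<Rightarrow> real) \<Rightarrow> real"
type_synonym 'm vfield = "'m \<Rightarrow> 'm tvector"

definition tangent_space :: "'m smooth_atlas \<Rightarrow> 'm \<Rightarrow> 'm tvector set" where
  "tangent_space M x = {v.
     (\<forall>f \<in> smooth_functions M. \<forall>g \<in> smooth_functions M.
        v (f + g) = v f + v g \<and> v (f * g) = f x * v g + g x * v f) \<and>
     (\<forall>f \<in> smooth_functions M. \<forall>r. v (\<lambda>y. r * f y) = r * v f) \<and>
     (\<forall>f. f \<notin> smooth_functions M \<longrightarrow> v f = 0)}"

definition vapply :: "'m vfield \<Rightarrow> ('m \<Rightarrow> real) \<Rightarrow> 'm \<Rightarrow> real" where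
  "vapply X f = (\<lambda>x. X x f)"

definition vector_fields :: "'m smooth_atlas \<Rightarrow> 'm vfield set" where
  "vector_fields M = {X. (\<forall>x. X x \<in> tangent_space M x) \<and>
     (\<forall>f \<in> smooth_functions M. vapply X f \<in> smooth_functions M)}"

definition vf_scale :: "('m \<Rightarrow> real) \<Rightarrow> 'm vfield \<Rightarrow> 'm vfield" (infixr \<open>\<cdot>\<^sub>v\<close> 75) where
  "f \<cdot>\<^sub>v X = (\<lambda>x g. f x * X x g)"

definition vf_bracket :: "'m vfield \<Rightarrow> 'm vfield \<Rightarrow> 'm vfield" where
  "vf_bracket X Y = (\<lambda>x f. X x (vapply Y f) - Y x (vapply X f))"


section \<open>Lie algebroids, connections and representations\<close>

record ('m, 'a) algebroid = "('m, 'a) vbundle" +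
  anchor :: "'m \<Rightarrow> 'a \<Rightarrow> 'm tvector"
  bracket :: "('m \<Rightarrow> 'a) \<Rightarrow> ('m \<Rightarrow> 'a) \<Rightarrow> 'm \<Rightarrow> 'a"

definition anchor_sec :: "('m, 'a) algebroid \<Rightarrow> ('m \<Rightarrow> 'a) \<Rightarrow> 'm vfield" where
  "anchor_sec A \<alpha> = (\<lambda>x. anchor A x (\<alpha> x))"

definition lie_algebroid ::
    "('m::{t2_space, second_countable_topology}) smooth_atlas \<Rightarrow>
     ('m, 'a::real_vector) algebroid \<Rightarrow> bool" where
  "lie_algebroid M A \<longleftrightarrow>
     vector_bundle M A \<and>
     \<comment> \<open>the anchor is a smooth bundle map to the tangent bundle\<close>
     (\<forall>x. \<forall>a \<in> fibre A x. anchor A x a \<in> tangent_space M x \<and>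
        (\<forall>r. \<forall>f. anchor A x (r *\<^sub>R a) f = r * anchor A x a f) \<and>
        (\<forall>b \<in> fibre A x. anchor A x (a + b) = anchor A x a + anchor A x b)) \<and>
     (\<forall>\<alpha> \<in> sections M A. anchor_sec A \<alpha> \<in> vector_fields M) \<and>
     \<comment> \<open>the bracket is a Lie bracket on sections\<close>
     (\<forall>\<alpha> \<in> sections M A. \<forall>\<beta> \<in> sections M A.
        bracket A \<alpha> \<beta> \<in> sections M A \<and>
        bracket A \<beta> \<alpha> = - bracket A \<alpha> \<beta> \<and>
        (\<forall>r. bracket A \<alpha> ((\<lambda>_. r) \<cdot>\<^sub>s \<beta>) = (\<lambda>_. r) \<cdot>\<^sub>s bracket A \<alpha> \<beta>) \<and>
        (\<forall>\<gamma> \<in> sections M A.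
           bracket A \<alpha> (\<beta> + \<gamma>) = bracket A \<alpha> \<beta> + bracket A \<alpha> \<gamma> \<and>
           bracket A \<alpha> (bracket A \<beta> \<gamma>) + bracket A \<beta> (bracket A \<gamma> \<alpha>)
             + bracket A \<gamma> (bracket A \<alpha> \<beta>) = 0)) \<and>
     \<comment> \<open>Leibniz rule\<close>
     (\<forall>\<alpha> \<in> sections M A. \<forall>\<beta> \<in> sections M A. \<forall>f \<in> smooth_functions M.
        bracket A \<alpha> (f \<cdot>\<^sub>s \<beta>) = f \<cdot>\<^sub>s bracket A \<alpha> \<beta> + vapply (anchor_sec A \<alpha>) f \<cdot>\<^sub>s \<beta>)"

definition linear_connection ::
    "'m smooth_atlas \<Rightarrow> ('m, 'v::real_vector) vbundle \<Rightarrow>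
     ('m vfield \<Rightarrow> ('m \<Rightarrow> 'v) \<Rightarrow> 'm \<Rightarrow> 'v) \<Rightarrow> bool" where
  "linear_connection M V D \<longleftrightarrow>
     (\<forall>X \<in> vector_fields M. \<forall>s \<in> sections M V.
        D X s \<in> sections M V \<and>
        (\<forall>Y \<in> vector_fields M. D (X + Y) s = D X s + D Y s) \<and>
        (\<forall>t \<in> sections M V. D X (s + t) = D X s + D X t) \<and>
        (\<forall>f \<in> smooth_functions M.
           D (f \<cdot>\<^sub>v X) s = f \<cdot>\<^sub>s D X s \<and>
           D X (f \<cdot>\<^sub>s s) = f \<cdot>\<^sub>s D X s + vapply X f \<cdot>\<^sub>s s))"

definition curvature ::
    "('m vfield \<Rightarrow> ('m \<Rightarrow> 'v::real_vector) \<Rightarrow> 'm \<Rightarrow> 'v) \<Rightarrow>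
     'm vfield \<Rightarrow> 'm vfield \<Rightarrow> ('m \<Rightarrow> 'v) \<Rightarrow> 'm \<Rightarrow> 'v" where
  "curvature D X Y s = D X (D Y s) - D Y (D X s) - D (vf_bracket X Y) s"

definition A_connection ::
    "'m smooth_atlas \<Rightarrow> ('m, 'a::real_vector) algebroid \<Rightarrow> ('m, 'v::real_vector) vbundle \<Rightarrow>
     (('m \<Rightarrow> 'a) \<Rightarrow> ('m \<Rightarrow> 'v) \<Rightarrow> 'm \<Rightarrow> 'v) \<Rightarrow> bool" where
  "A_connection M A V DA \<longleftrightarrow>
     (\<forall>\<alpha> \<in> sections M A. \<forall>s \<in> sections M V.
        DA \<alpha> s \<in> sections M V \<and>
        (\<forall>\<beta> \<in> sections M A. DA (\<alpha> + \<beta>) s = DA \<alpha> s + DA \<beta> s) \<and>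
        (\<forall>t \<in> sections M V. DA \<alpha> (s + t) = DA \<alpha> s + DA \<alpha> t) \<and>
        (\<forall>f \<in> smooth_functions M.
           DA (f \<cdot>\<^sub>s \<alpha>) s = f \<cdot>\<^sub>s DA \<alpha> s \<and>
           DA \<alpha> (f \<cdot>\<^sub>s s) = f \<cdot>\<^sub>s DA \<alpha> s + vapply (anchor_sec A \<alpha>) f \<cdot>\<^sub>s s))"

definition algebroid_rep ::
    "('m::{t2_space, second_countable_topology}) smooth_atlas \<Rightarrow>
     ('m, 'a::real_vector) algebroid \<Rightarrow> ('m, 'v::real_vector) vbundle \<Rightarrow>
     (('m \<Rightarrow> 'a) \<Rightarrow> ('m \<Rightarrow> 'v) \<Rightarrow> 'm \<Rightarrow> 'v) \<Rightarrow> bool" where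
  "algebroid_rep M A V DA \<longleftrightarrow>
     vector_bundle M V \<and> A_connection M A V DA \<and>
     (\<forall>\<alpha> \<in> sections M A. \<forall>\<beta> \<in> sections M A. \<forall>s \<in> sections M V.
        DA (bracket A \<alpha> \<beta>) s = DA \<alpha> (DA \<beta> s) - DA \<beta> (DA \<alpha> s))"

text \<open>
  Both conditions are tensorial in the section of A, so asking for them on global sections is the
  same as asking for them at every element of A.
\<close>

definition A_invariant ::
    "'m smooth_atlas \<Rightarrow> ('m, 'a::real_vector) algebroid \<Rightarrow> ('m, 'v::real_vector) vbundle \<Rightarrow>
     (('m \<Rightarrow> 'a) \<Rightarrow> ('m \<Rightarrow> 'v) \<Rightarrow> 'm \<Rightarrow> 'v) \<Rightarrow>
     ('m vfield \<Rightarrow> ('m \<Rightarrow> 'v) \<Rightarrow> 'm \<Rightarrow> 'v) \<Rightarrow> bool" where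
  "A_invariant M A V DA D \<longleftrightarrow>
     (\<forall>\<alpha> \<in> sections M A. \<forall>s \<in> sections M V.
        DA \<alpha> s = D (anchor_sec A \<alpha>) s \<and>
        (\<forall>X \<in> vector_fields M. curvature D (anchor_sec A \<alpha>) X s = 0))"


section \<open>Bundle-valued differential forms\<close>

definition tuples :: "'x set \<Rightarrow> nat \<Rightarrow> 'x list set" where
  "tuples C n = {xs. set xs \<subseteq> C \<and> length xs = n}"

definition omit :: "nat \<Rightarrow> 'x list \<Rightarrow> 'x list" where
  "omit i xs = take i xs @ drop (Suc i) xs"

definition msign :: "nat \<Rightarrow> 'b::group_add \<Rightarrow> 'b" where
  "msign i s = (if even i then s else - s)"

text \<open>
  Multilinearity of a map of n arguments in C with values in sections, over the ring K of
  functions, where \<open>act\<close> is the action of K on C.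
\<close>

definition multilinear_on ::
    "('m \<Rightarrow> real) set \<Rightarrow> (('m \<Rightarrow> real) \<Rightarrow> 'x \<Rightarrow> 'x) \<Rightarrow> 'x::plus set \<Rightarrow> nat \<Rightarrow>
     ('x list \<Rightarrow> 'm \<Rightarrow> 'v::real_vector) \<Rightarrow> bool" where
  "multilinear_on K act C n F \<longleftrightarrow>
     (\<forall>us vs. \<forall>x\<in>C. \<forall>y\<in>C. set us \<subseteq> C \<and> set vs \<subseteq> C \<and> length us + 1 + length vs = n \<longrightarrow>
        F (us @ (x + y) # vs) = F (us @ x # vs) + F (us @ y # vs) \<and>
        (\<forall>f\<in>K. F (us @ act f x # vs) = f \<cdot>\<^sub>s F (us @ x # vs)))"

definition alternating_on :: "'x set \<Rightarrow> nat \<Rightarrow> ('x list \<Rightarrow> 'b::zero) \<Rightarrow> bool" where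
  "alternating_on C n F \<longleftrightarrow> (\<forall>xs \<in> tuples C n. \<not> distinct xs \<longrightarrow> F xs = 0)"

definition symmetric_on :: "'x set \<Rightarrow> nat \<Rightarrow> ('x list \<Rightarrow> 'b) \<Rightarrow> bool" where
  "symmetric_on C n F \<longleftrightarrow>
     (\<forall>xs \<in> tuples C n. \<forall>ys \<in> tuples C n. mset xs = mset ys \<longrightarrow> F xs = F ys)"

text \<open>
  V-valued m-forms, as alternating maps on m vector fields that are multilinear over the smooth
  functions; they are extended by 0 to all other lists.
\<close>

type_synonym ('m, 'v) vform = "'m vfield list \<Rightarrow> 'm \<Rightarrow> 'v"

definition forms ::
    "'m smooth_atlas \<Rightarrow> ('m, 'v::real_vector) vbundle \<Rightarrow> nat \<Rightarrow> ('m, 'v) vform set" where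
  "forms M V m = {\<omega>.
     (\<forall>Xs \<in> tuples (vector_fields M) m. \<omega> Xs \<in> sections M V) \<and>
     (\<forall>Xs. Xs \<notin> tuples (vector_fields M) m \<longrightarrow> \<omega> Xs = 0) \<and>
     multilinear_on (smooth_functions M) (\<cdot>\<^sub>v) (vector_fields M) m \<omega> \<and>
     alternating_on (vector_fields M) m \<omega>}"

text \<open>
  The operators below take the degree of their argument from the length of the list of vector
  fields; all formulas are meant for lists of vector fields (and sections).
\<close>

definition ext_cov_deriv ::
    "('m vfield \<Rightarrow> ('m \<Rightarrow> 'v::real_vector) \<Rightarrow> 'm \<Rightarrow> 'v) \<Rightarrow> ('m, 'v) vform \<Rightarrow> ('m, 'v) vform" where
  "ext_cov_deriv D \<omega> Xs =
     (\<Sum>i < length Xs. msign i (D (Xs ! i) (\<omega> (omit i Xs)))) +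
     (\<Sum>j < length Xs. \<Sum>i < j.
        msign (i + j) (\<omega> (vf_bracket (Xs ! i) (Xs ! j) # omit i (omit j Xs))))"

definition contract :: "'m vfield \<Rightarrow> ('m, 'v) vform \<Rightarrow> ('m, 'v) vform" where
  "contract X \<omega> Xs = \<omega> (X # Xs)"

definition d_wedge :: "('m \<Rightarrow> real) \<Rightarrow> ('m, 'v::real_vector) vform \<Rightarrow> ('m, 'v) vform" where
  "d_wedge f \<omega> Xs = (\<Sum>i < length Xs. msign i (vapply (Xs ! i) f \<cdot>\<^sub>s \<omega> (omit i Xs)))"

definition lie_deriv ::
    "('m, 'a) algebroid \<Rightarrow> (('m \<Rightarrow> 'a) \<Rightarrow> ('m \<Rightarrow> 'v::real_vector) \<Rightarrow> 'm \<Rightarrow> 'v) \<Rightarrow> ('m \<Rightarrow> 'a) \<Rightarrow>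
     (('m \<Rightarrow> 'a) list \<Rightarrow> ('m, 'v) vform) \<Rightarrow> ('m \<Rightarrow> 'a) list \<Rightarrow> ('m, 'v) vform" where
  "lie_deriv A DA \<alpha> \<gamma> \<beta>s Xs =
     DA \<alpha> (\<gamma> \<beta>s Xs)
     - (\<Sum>i < length \<beta>s. \<gamma> (\<beta>s[i := bracket A \<alpha> (\<beta>s ! i)]) Xs)
     - (\<Sum>j < length Xs. \<gamma> \<beta>s (Xs[j := vf_bracket (anchor_sec A \<alpha>) (Xs ! j)]))"


section \<open>Weil cochains\<close>

type_synonym ('m, 'a, 'v) cochain =
  "nat \<Rightarrow> ('m \<Rightarrow> 'a) list \<Rightarrow> ('m \<Rightarrow> 'a) list \<Rightarrow> ('m, 'v) vform"

text \<open>
  A cochain is extended by 0 to all indices k and argument lists outside its domain, so that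
  cochains of bidegree (p, q) are equal iff they are equal as HOL functions.
\<close>

definition weil_cochains ::
    "'m smooth_atlas \<Rightarrow> ('m, 'a::real_vector) algebroid \<Rightarrow> ('m, 'v::real_vector) vbundle \<Rightarrow>
     nat \<Rightarrow> nat \<Rightarrow> ('m, 'a, 'v) cochain set" where
  "weil_cochains M A V p q = {c.
     \<comment> \<open>domain and values\<close>
     (\<forall>k \<alpha>s \<beta>s.
        if k \<le> p \<and> k \<le> q \<and> \<alpha>s \<in> tuples (sections M A) (p - k) \<and> \<beta>s \<in> tuples (sections M A) k
        then c k \<alpha>s \<beta>s \<in> forms M V (q - k)
        else c k \<alpha>s \<beta>s = 0) \<and>
     (\<forall>k \<le> p.
        (\<forall>\<beta>s \<in> tuples (sections M A) k.
           alternating_on (sections M A) (p - k) (\<lambda>\<alpha>s. c k \<alpha>s \<beta>s) \<and>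
           (\<forall>Xs. multilinear_on (range (\<lambda>r _. r)) (\<cdot>\<^sub>s) (sections M A) (p - k)
                   (\<lambda>\<alpha>s. c k \<alpha>s \<beta>s Xs))) \<and>
        (\<forall>\<alpha>s \<in> tuples (sections M A) (p - k).
           symmetric_on (sections M A) k (c k \<alpha>s) \<and>
           (\<forall>Xs. multilinear_on (smooth_functions M) (\<cdot>\<^sub>s) (sections M A) k
                   (\<lambda>\<beta>s. c k \<alpha>s \<beta>s Xs)))) \<and>
     \<comment> \<open>Leibniz identity\<close>
     (\<forall>k < p. \<forall>\<alpha> \<in> sections M A. \<forall>\<alpha>s \<in> tuples (sections M A) (p - k - 1).
        \<forall>\<beta>s \<in> tuples (sections M A) k. \<forall>f \<in> smooth_functions M. \<forall>Xs \<in> lists (vector_fields M).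
          c k (f \<cdot>\<^sub>s \<alpha> # \<alpha>s) \<beta>s Xs =
            f \<cdot>\<^sub>s c k (\<alpha> # \<alpha>s) \<beta>s Xs + d_wedge f (c (Suc k) \<alpha>s (\<alpha> # \<beta>s)) Xs)}"

definition weil_domain ::
    "'m smooth_atlas \<Rightarrow> ('m, 'a::real_vector) algebroid \<Rightarrow> nat \<Rightarrow>
     ('m \<Rightarrow> 'a) list \<Rightarrow> ('m \<Rightarrow> 'a) list \<Rightarrow> 'm vfield list \<Rightarrow> bool" where
  "weil_domain M A k \<alpha>s \<beta>s Xs \<longleftrightarrow>
     \<alpha>s \<in> lists (sections M A) \<and> \<beta>s \<in> tuples (sections M A) k \<and> Xs \<in> lists (vector_fields M)"

text \<open>
  Since cochains vanish on lists of the wrong length, the following formulas, applied to a cochain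
  of bidegree (p, q), also give 0 on lists whose lengths do not fit bidegree (p + 1, q),
  resp. (p, q + 1). The terms with index k - 1 are absent for k = 0.
\<close>

definition simplicial_diff ::
    "'m smooth_atlas \<Rightarrow> ('m, 'a::real_vector) algebroid \<Rightarrow>
     (('m \<Rightarrow> 'a) \<Rightarrow> ('m \<Rightarrow> 'v::real_vector) \<Rightarrow> 'm \<Rightarrow> 'v) \<Rightarrow>
     ('m, 'a, 'v) cochain \<Rightarrow> ('m, 'a, 'v) cochain" where
  "simplicial_diff M A DA c k \<alpha>s \<beta>s Xs =
     (if weil_domain M A k \<alpha>s \<beta>s Xs then
        msign k (
          (\<Sum>i < length \<alpha>s. msign i (lie_deriv A DA (\<alpha>s ! i) (c k (omit i \<alpha>s)) \<beta>s Xs)) +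
          (\<Sum>j < length \<alpha>s. \<Sum>i < j.
             msign (i + j) (c k (bracket A (\<alpha>s ! i) (\<alpha>s ! j) # omit i (omit j \<alpha>s)) \<beta>s Xs)) -
          (\<Sum>j < k. contract (anchor_sec A (\<beta>s ! j)) (c (k - 1) \<alpha>s (omit j \<beta>s)) Xs))
      else 0)"

definition weil_ext_cov_deriv ::
    "'m smooth_atlas \<Rightarrow> ('m, 'a::real_vector) algebroid \<Rightarrow>
     ('m vfield \<Rightarrow> ('m \<Rightarrow> 'v::real_vector) \<Rightarrow> 'm \<Rightarrow> 'v) \<Rightarrow>
     ('m, 'a, 'v) cochain \<Rightarrow> ('m, 'a, 'v) cochain" where
  "weil_ext_cov_deriv M A D c k \<alpha>s \<beta>s Xs =
     (if weil_domain M A k \<alpha>s \<beta>s Xs then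
        msign k (
          ext_cov_deriv D (c k \<alpha>s \<beta>s) Xs -
          (\<Sum>i < k. c (k - 1) (\<beta>s ! i # \<alpha>s) (omit i \<beta>s) Xs))
      else 0)"

definition IM_forms ::
    "'m smooth_atlas \<Rightarrow> ('m, 'a::real_vector) algebroid \<Rightarrow> ('m, 'v::real_vector) vbundle \<Rightarrow>
     (('m \<Rightarrow> 'a) \<Rightarrow> ('m \<Rightarrow> 'v) \<Rightarrow> 'm \<Rightarrow> 'v) \<Rightarrow> nat \<Rightarrow> ('m, 'a, 'v) cochain set" where
  "IM_forms M A V DA q = {c \<in> weil_cochains M A V 1 q. simplicial_diff M A DA c = 0}"

end

theory Submission
  imports Defs
begin

text \<open>
  If \<open>\<nabla>\<close> is A-invariant, the two operators commute because both are built from two Cartan calculi, one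
  on M and one on A, that fit together. On M, Cartan's formula \<open>\<iota>\<^sub>X d + d \<iota>\<^sub>X = L\<^sub>X\<close> holds for the
  exterior covariant derivative and the Lie derivative with respect to \<open>\<nabla>\<close>, and \<open>L\<^sub>X\<close> commutes with
  \<open>d\<close> as soon as X is in the kernel of the curvature. Invariance says that the Lie derivatives in the
  simplicial differential are exactly such Lie derivatives, along \<open>X = \<rho>(\<alpha>)\<close>. Hence the part CE of
  the simplicial differential that preserves the index k (a Chevalley--Eilenberg differential with
  respect to the sections of A) commutes with \<open>d\<close>. The other part of \<open>\<delta>\<close> contracts with \<open>\<rho>(\<beta>\<^sub>j)\<close>, the
  other part of \<open>d\<close> moves a \<open>\<beta>\<^sub>i\<close> from the symmetric to the alternating arguments; these two commute. The
  mixed terms are of two kinds. Contraction and \<open>d\<close> on M combine to the sum of the Lie derivatives along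
  the \<open>\<rho>(\<beta>\<^sub>j)\<close>, by Cartan's formula on M. CE and the shift of the \<open>\<beta>\<^sub>i\<close> combine to the same sum, by
  Cartan's formula on A (\<open>CE_cartan_sum\<close>); there the brackets \<open>[\<beta>\<^sub>i, \<beta>\<^sub>l]\<close> cancel in pairs, as the
  \<open>\<beta>\<close> are symmetric arguments and the bracket is antisymmetric.

  Conversely, it suffices to test on a section s of V, a cochain of bidegree (0, 0): commutation at
  the indices 1 and 0 gives the two conditions for invariance (\<open>A_invariant_if_commute\<close>).

  For IM forms it remains to see that \<open>d\<close> maps Weil cochains to Weil cochains. This is where
  linearity over the smooth functions has to be controlled: the derivatives of f that
  the exterior derivative produces are those that the Leibniz identity of a Weil cochain prescribes.

  Cartan's formula is used as a recursion on the list of vector fields, which replaces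
  computations with alternating sums over vector fields. So that contraction is always possible in this recursion, forms
  are treated without fixing their degree (\<open>mixed_forms\<close>).
\<close>

section \<open>Smooth functions and smooth sections\<close>

text \<open>
  Partial derivatives at a point of an open set depend only on the values on that set, because
  the coordinate line through the point stays in the set for a while.
\<close>

lemma eventually_fun_upd_in_open:
  assumes S: "openin (Euclidean_space n) S" and y: "y \<in> S" and i: "i < n"
  shows "\<forall>\<^sub>F t in nhds (y i). y(i := t) \<in> S"
proof -
  have y0: "\<forall>j\<ge>n. y j = 0"
    using openin_subset[OF S] y by (auto simp: topspace_Euclidean_space)
  have "continuous_map euclideanreal (Euclidean_space n) (\<lambda>t. y(i := t))"
    unfolding Euclidean_space_def continuous_map_in_subtopology continuous_map_componentwise_UNIV
    using y0 i by (auto simp: fun_upd_def)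
  then have "openin euclideanreal {t \<in> topspace euclideanreal. y(i := t) \<in> S}"
    using S by (auto simp: continuous_map_def)
  then have "open {t. y(i := t) \<in> S}"
    by simp
  moreover have "y i \<in> {t. y(i := t) \<in> S}"
    using y by simp
  ultimately show ?thesis
    by (auto simp: eventually_nhds)
qed

lemma eventually_fun_upd_eq:
  assumes "openin (Euclidean_space n) S" "\<And>y. y \<in> S \<Longrightarrow> F y = G y" "y \<in> S" "i < n"
  shows "\<forall>\<^sub>F t in nhds (y i). F (y(i := t)) = G (y(i := t))"
  using eventually_fun_upd_in_open[OF assms(1,3,4)] by eventually_elim (use assms(2) in auto)

lemma partial_deriv_cong_open:
  assumes "openin (Euclidean_space n) S" "\<And>y. y \<in> S \<Longrightarrow> F y = G y" "y \<in> S" "i < n"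
  shows "partial_deriv i F y = partial_deriv i G y"
  unfolding partial_deriv_def by (intro deriv_cong_ev eventually_fun_upd_eq[OF assms]) auto

text \<open>
  The sum and product rules describe partial derivatives only at the points of S; this lemma allows to
  use them although \<open>Ck_on\<close> speaks about functions that are defined everywhere.
\<close>

lemma Ck_on_cong_open:
  assumes "openin (Euclidean_space n) S" "\<And>y. y \<in> S \<Longrightarrow> F y = G y" "Ck_on n r S F"
  shows "Ck_on n r S G"
  using assms(2,3)
proof (induction r arbitrary: F G)
  case 0
  then show ?case
    by (auto intro: continuous_map_eq)
next
  case (Suc r)
  have "continuous_map (subtopology (Euclidean_space n) S) euclideanreal G"
    using Suc.prems by (auto intro: continuous_map_eq[of _ _ F])
  moreover have "(\<lambda>t. G (y(i := t))) differentiable at (y i)" if "i < n" "y \<in> S" for i y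
  proof -
    obtain d where d: "((\<lambda>t. F (y(i := t))) has_derivative d) (at (y i))"
      using Suc.prems(2) \<open>i < n\<close> \<open>y \<in> S\<close> by (auto simp: differentiable_def)
    have "\<forall>\<^sub>F t in at (y i). F (y(i := t)) = G (y(i := t))"
      unfolding eventually_at_filter
      by (rule eventually_mono[OF eventually_fun_upd_eq[OF assms(1) Suc.prems(1) \<open>y \<in> S\<close> \<open>i < n\<close>]])
        auto
    then have "((\<lambda>t. G (y(i := t))) has_derivative d) (at (y i))"
      using d Suc.prems(1)[OF \<open>y \<in> S\<close>] by (auto intro: has_derivative_transform_eventually)
    then show ?thesis
      by (auto simp: differentiable_def)
  qed
  moreover have "Ck_on n r S (partial_deriv i G)" if "i < n" for i
    using Suc.IH[of "partial_deriv i F" "partial_deriv i G"] Suc.prems that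
      partial_deriv_cong_open[OF assms(1) Suc.prems(1)] by auto
  ultimately show ?case
    by simp
qed

lemma Ck_on_Suc_imp: "Ck_on n (Suc r) S F \<Longrightarrow> Ck_on n r S F"
  by (induction r arbitrary: F) auto

lemma Ck_on_const: "Ck_on n r S (\<lambda>_. a)"
proof (induction r arbitrary: a)
  case (Suc r)
  have "partial_deriv i (\<lambda>_. a) = (\<lambda>_. 0)" for i
    by (simp add: partial_deriv_def fun_eq_iff)
  with Suc show ?case
    by simp
qed simp

lemma partial_deriv_add:
  assumes "(\<lambda>t. F (y(i := t))) differentiable at (y i)" "(\<lambda>t. G (y(i := t))) differentiable at (y i)"
  shows "partial_deriv i (\<lambda>y. F y + G y) y = partial_deriv i F y + partial_deriv i G y"
  unfolding partial_deriv_def using assms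
  by (intro deriv_add) (auto simp: real_differentiableE field_differentiable_def real_differentiable_def)

lemma partial_deriv_mult:
  assumes "(\<lambda>t. F (y(i := t))) differentiable at (y i)" "(\<lambda>t. G (y(i := t))) differentiable at (y i)"
  shows "partial_deriv i (\<lambda>y. F y * G y) y = F y * partial_deriv i G y + partial_deriv i F y * G y"
  unfolding partial_deriv_def using assms
  by (subst deriv_mult) (auto simp: field_differentiable_def real_differentiable_def)

lemma Ck_on_add:
  assumes S: "openin (Euclidean_space n) S" and "Ck_on n r S F" "Ck_on n r S G"
  shows "Ck_on n r S (\<lambda>y. F y + G y)"
  using assms(2,3)
proof (induction r arbitrary: F G)
  case 0
  then show ?case
    by (auto intro: continuous_map_add)
next
  case (Suc r)
  have "Ck_on n r S (partial_deriv i (\<lambda>y. F y + G y))" if "i < n" for i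
    by (rule Ck_on_cong_open[OF S _ Suc.IH[of "partial_deriv i F" "partial_deriv i G"]])
      (use Suc.prems that in \<open>auto simp: partial_deriv_add\<close>)
  then show ?case
    using Suc.prems by (auto intro: continuous_map_add)
qed

lemma Ck_on_mult:
  assumes S: "openin (Euclidean_space n) S" and "Ck_on n r S F" "Ck_on n r S G"
  shows "Ck_on n r S (\<lambda>y. F y * G y)"
  using assms(2,3)
proof (induction r arbitrary: F G)
  case 0
  then show ?case
    by (auto intro: continuous_map_real_mult)
next
  case (Suc r)
  have "Ck_on n r S (partial_deriv i (\<lambda>y. F y * G y))" if "i < n" for i
  proof (rule Ck_on_cong_open[OF S])
    show "Ck_on n r S (\<lambda>y. F y * partial_deriv i G y + partial_deriv i F y * G y)"
      using Suc.prems that by (intro Ck_on_add[OF S] Suc.IH) (auto intro: Ck_on_Suc_imp)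
  qed (use Suc.prems that in \<open>auto simp: partial_deriv_mult\<close>)
  then show ?case
    using Suc.prems by (auto intro: continuous_map_real_mult)
qed

lemma smooth_manifold_chart_open:
  assumes "smooth_manifold M" "open S" "(U, \<phi>) \<in> charts M"
  shows "openin (Euclidean_space (mdim M)) (\<phi> ` (S \<inter> U))"
proof -
  have U: "openin (Euclidean_space (mdim M)) (\<phi> ` U)"
    and \<phi>: "homeomorphic_map (top_of_set U) (subtopology (Euclidean_space (mdim M)) (\<phi> ` U)) \<phi>"
    using assms unfolding smooth_manifold_def by auto
  have "openin (subtopology (Euclidean_space (mdim M)) (\<phi> ` U)) (\<phi> ` (S \<inter> U))"
    using homeomorphic_imp_open_map[OF \<phi>] \<open>open S\<close>
    unfolding open_map_def by (auto simp: Int_commute openin_open)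
  with U show ?thesis
    by (rule openin_trans_full[rotated])
qed

context
  fixes M :: "('m::{t2_space, second_countable_topology}) smooth_atlas"
  assumes M: "smooth_manifold M"
begin

lemma smooth_on_const: "smooth_on M S (\<lambda>_. a)"
  by (auto simp: smooth_on_def Cinf_on_def comp_def Ck_on_const)

lemma smooth_on_add:
  assumes "open S" "smooth_on M S f" "smooth_on M S g"
  shows "smooth_on M S (\<lambda>x. f x + g x)"
  using assms smooth_manifold_chart_open[OF M]
  unfolding smooth_on_def Cinf_on_def comp_def by (fastforce intro!: Ck_on_add)

lemma smooth_on_mult:
  assumes "open S" "smooth_on M S f" "smooth_on M S g"
  shows "smooth_on M S (\<lambda>x. f x * g x)"
  using assms smooth_manifold_chart_open[OF M]
  unfolding smooth_on_def Cinf_on_def comp_def by (fastforce intro!: Ck_on_mult)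

end

lemma sec_scale_simps:
  "f \<cdot>\<^sub>s (s + t) = f \<cdot>\<^sub>s s + f \<cdot>\<^sub>s t"
  "f \<cdot>\<^sub>s (s - t) = f \<cdot>\<^sub>s s - f \<cdot>\<^sub>s t"
  "f \<cdot>\<^sub>s (- s) = - (f \<cdot>\<^sub>s s)"
  "f \<cdot>\<^sub>s 0 = 0"
  "0 \<cdot>\<^sub>s s = 0"
  "(f + g) \<cdot>\<^sub>s s = f \<cdot>\<^sub>s s + g \<cdot>\<^sub>s s"
  "(f - g) \<cdot>\<^sub>s s = f \<cdot>\<^sub>s s - g \<cdot>\<^sub>s s"
  "(- f) \<cdot>\<^sub>s s = - (f \<cdot>\<^sub>s s)"
  by (auto simp: sec_scale_def fun_eq_iff algebra_simps)

lemma vapply_bracket: "vapply (vf_bracket X Y) f = vapply X (vapply Y f) - vapply Y (vapply X f)"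
  by (simp add: vf_bracket_def vapply_def fun_eq_iff)

lemma vapply_simps:
  "vapply (X + Y) f = vapply X f + vapply Y f"
  "vapply (f \<cdot>\<^sub>v X) g = f * vapply X g"
  by (auto simp: vapply_def vf_scale_def fun_eq_iff)

lemma sec_scale_mult: "(f * g) \<cdot>\<^sub>s s = f \<cdot>\<^sub>s g \<cdot>\<^sub>s s"
  by (auto simp: sec_scale_def fun_eq_iff)

lemma sec_scale_commute: "f \<cdot>\<^sub>s g \<cdot>\<^sub>s s = g \<cdot>\<^sub>s f \<cdot>\<^sub>s s"
  by (auto simp: sec_scale_def fun_eq_iff)

context
  fixes M :: "('m::{t2_space, second_countable_topology}) smooth_atlas"
  assumes M: "smooth_manifold M"
begin

lemma smooth_functions_closed:
  "0 \<in> smooth_functions M"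
  "f \<in> smooth_functions M \<Longrightarrow> g \<in> smooth_functions M \<Longrightarrow> f + g \<in> smooth_functions M"
  "f \<in> smooth_functions M \<Longrightarrow> g \<in> smooth_functions M \<Longrightarrow> f * g \<in> smooth_functions M"
  "f \<in> smooth_functions M \<Longrightarrow> - f \<in> smooth_functions M"
  "f \<in> smooth_functions M \<Longrightarrow> g \<in> smooth_functions M \<Longrightarrow> f - g \<in> smooth_functions M"
proof -
  show "0 \<in> smooth_functions M"
    using smooth_on_const[OF M, of _ 0] by (simp add: zero_fun_def)
  show add: "f + g \<in> smooth_functions M"
    if "f \<in> smooth_functions M" "g \<in> smooth_functions M" for f g
    using that smooth_on_add[OF M, of UNIV f g] by (simp add: plus_fun_def)
  show "f * g \<in> smooth_functions M"
    if "f \<in> smooth_functions M" "g \<in> smooth_functions M" for f g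
    using that smooth_on_mult[OF M, of UNIV f g] by (simp add: times_fun_def)
  show neg: "- f \<in> smooth_functions M" if "f \<in> smooth_functions M" for f
    using that smooth_on_mult[OF M, of UNIV "\<lambda>_. -1" f] smooth_on_const[OF M, of UNIV "-1"]
    by (simp add: fun_Compl_def)
  show "f - g \<in> smooth_functions M"
    if "f \<in> smooth_functions M" "g \<in> smooth_functions M" for f g
    using add[OF that(1) neg[OF that(2)]] by simp
qed

lemma const_smooth_functions: "(\<lambda>_. r) \<in> smooth_functions M"
  using smooth_on_const[OF M] by simp

lemma section_coefficients:
  assumes "s \<in> sections M E" "(U, e) \<in> frames E"
  shows "\<exists>a. (\<forall>i < vrank E. smooth_on M U (a i)) \<and> (\<forall>x \<in> U. s x = (\<Sum>i < vrank E. a i x *\<^sub>R e i x))"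
proof -
  have "\<forall>(U, e) \<in> frames E. \<exists>a. (\<forall>i < vrank E. smooth_on M (UNIV \<inter> U) (a i)) \<and>
                               (\<forall>x \<in> UNIV \<inter> U. s x = (\<Sum>i < vrank E. a i x *\<^sub>R e i x))"
    using assms(1) unfolding sections_def smooth_section_on_def by blast
  from bspec[OF this assms(2)] show ?thesis
    by simp
qed

lemma smooth_on_mono:
  assumes "smooth_on M S h" "U \<subseteq> S"
  shows "smooth_on M U h"
proof -
  have mono: "Ck_on n r T F" if "Ck_on n r S F" "T \<subseteq> S" for n r S T F
    using that
  proof (induction r arbitrary: F)
    case 0
    then show ?case
      by (simp add: continuous_map_from_subtopology_mono)
  next
    case (Suc r)
    then have "continuous_map (subtopology (Euclidean_space n) T) euclideanreal F"
      by (meson Ck_on.simps(2) continuous_map_from_subtopology_mono)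
    with Suc show ?case
      by (simp add: subset_iff)
  qed
  have "Cinf_on (mdim M) (\<phi> ` (U \<inter> W)) (h \<circ> inv_into W \<phi>)" if "(W, \<phi>) \<in> charts M" for W \<phi>
  proof -
    have "Cinf_on (mdim M) (\<phi> ` (S \<inter> W)) (h \<circ> inv_into W \<phi>)"
      using assms(1) that by (auto simp: smooth_on_def)
    moreover have "\<phi> ` (U \<inter> W) \<subseteq> \<phi> ` (S \<inter> W)"
      using assms(2) by auto
    ultimately show ?thesis
      unfolding Cinf_on_def using mono by blast
  qed
  then show ?thesis
    by (auto simp: smooth_on_def)
qed

text \<open>
  One combination that gives all closure properties of sections, by inserting constant functions.
\<close>

lemma sections_scale_add:
  assumes E: "vector_bundle M E" and "f \<in> smooth_functions M" "g \<in> smooth_functions M"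
    and "s \<in> sections M E" "t \<in> sections M E"
  shows "f \<cdot>\<^sub>s s + g \<cdot>\<^sub>s t \<in> sections M E"
proof -
  have fib: "subspace (fibre E x)" for x
    using E by (auto simp: vector_bundle_def)
  have st: "s x \<in> fibre E x" "t x \<in> fibre E x" for x
    using assms by (auto simp: sections_def smooth_section_on_def)
  have "\<exists>c. (\<forall>i < vrank E. smooth_on M (UNIV \<inter> U) (c i)) \<and>
            (\<forall>x \<in> UNIV \<inter> U. (f \<cdot>\<^sub>s s + g \<cdot>\<^sub>s t) x = (\<Sum>i < vrank E. c i x *\<^sub>R e i x))"
    if Ue: "(U, e) \<in> frames E" for U e
  proof -
    have U: "open U"
      using E Ue by (auto simp: vector_bundle_def)
    obtain a where a: "\<And>i. i < vrank E \<Longrightarrow> smooth_on M U (a i)"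
      "\<And>x. x \<in> U \<Longrightarrow> s x = (\<Sum>i < vrank E. a i x *\<^sub>R e i x)"
      using section_coefficients[OF \<open>s \<in> sections M E\<close> Ue] by blast
    obtain b where b: "\<And>i. i < vrank E \<Longrightarrow> smooth_on M U (b i)"
      "\<And>x. x \<in> U \<Longrightarrow> t x = (\<Sum>i < vrank E. b i x *\<^sub>R e i x)"
      using section_coefficients[OF \<open>t \<in> sections M E\<close> Ue] by blast
    have fg: "smooth_on M U f" "smooth_on M U g"
      using assms smooth_on_mono[of UNIV _ U] by auto
    have "smooth_on M U (\<lambda>x. f x * a i x + g x * b i x)" if "i < vrank E" for i
      by (intro smooth_on_add[OF M U] smooth_on_mult[OF M U] fg a(1)[OF that] b(1)[OF that])
    moreover have "(f \<cdot>\<^sub>s s + g \<cdot>\<^sub>s t) x = (\<Sum>i < vrank E. (f x * a i x + g x * b i x) *\<^sub>R e i x)"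
      if "x \<in> U" for x
      using a(2)[OF that] b(2)[OF that]
      by (simp add: sec_scale_def scaleR_sum_right scaleR_add_left sum.distrib)
    ultimately show ?thesis
      by (intro exI[of _ "\<lambda>i x. f x * a i x + g x * b i x"]) auto
  qed
  moreover have "(f \<cdot>\<^sub>s s + g \<cdot>\<^sub>s t) x \<in> fibre E x" for x
    using st[of x] fib[of x] by (auto simp: sec_scale_def intro!: subspace_add subspace_scale)
  ultimately show ?thesis
    by (auto simp: sections_def smooth_section_on_def)
qed

lemma zero_section:
  fixes E :: "('m, 'e::real_vector, 'z) vbundle_scheme"
  assumes "vector_bundle M E"
  shows "0 \<in> sections M E"
proof -
  have "\<exists>a. (\<forall>i < vrank E. smooth_on M (UNIV \<inter> U) (a i)) \<and>
            (\<forall>x \<in> UNIV \<inter> U. 0 = (\<Sum>i < vrank E. a i x *\<^sub>R e i x))" for U and e :: "nat \<Rightarrow> 'm \<Rightarrow> 'e"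
    by (intro exI[of _ "\<lambda>_ _. 0"]) (simp add: smooth_on_const[OF M])
  then show ?thesis
    using assms by (auto simp: sections_def smooth_section_on_def vector_bundle_def subspace_0)
qed

lemma sections_closed:
  fixes E :: "('m, 'e::real_vector, 'z) vbundle_scheme"
  assumes E: "vector_bundle M E"
  shows "0 \<in> sections M E"
    "s \<in> sections M E \<Longrightarrow> t \<in> sections M E \<Longrightarrow> s + t \<in> sections M E"
    "s \<in> sections M E \<Longrightarrow> - s \<in> sections M E"
    "s \<in> sections M E \<Longrightarrow> t \<in> sections M E \<Longrightarrow> s - t \<in> sections M E"
    "f \<in> smooth_functions M \<Longrightarrow> s \<in> sections M E \<Longrightarrow> f \<cdot>\<^sub>s s \<in> sections M E"
proof -
  have *: "(\<lambda>_. 1) \<cdot>\<^sub>s s + (\<lambda>_. 1) \<cdot>\<^sub>s t = s + t" "(\<lambda>_. 1) \<cdot>\<^sub>s s + (\<lambda>_. -1) \<cdot>\<^sub>s t = s - t"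
    "(\<lambda>_. -1) \<cdot>\<^sub>s s + (\<lambda>_. 0) \<cdot>\<^sub>s s = - s" "f \<cdot>\<^sub>s s + (\<lambda>_. 0) \<cdot>\<^sub>s s = f \<cdot>\<^sub>s s" for f and s t :: "'m \<Rightarrow> 'e"
    by (simp_all add: sec_scale_def fun_eq_iff)
  show "0 \<in> sections M E"
    by (rule zero_section[OF E])
  show "s + t \<in> sections M E" "s - t \<in> sections M E"
    if "s \<in> sections M E" "t \<in> sections M E"
    using sections_scale_add[OF E const_smooth_functions const_smooth_functions that, of 1 1]
      sections_scale_add[OF E const_smooth_functions const_smooth_functions that, of 1 "-1"]
    by (simp_all only: *)
  show "- s \<in> sections M E" if "s \<in> sections M E"
    using sections_scale_add[OF E const_smooth_functions const_smooth_functions that that, of "-1" 0]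
    by (simp only: *)
  show "f \<cdot>\<^sub>s s \<in> sections M E" if "f \<in> smooth_functions M" "s \<in> sections M E"
    using sections_scale_add[OF E that(1) const_smooth_functions that(2) that(2), of 0]
    by (simp only: *)
qed

end

section \<open>Vector fields and their bracket\<close>

lemma vector_field_derivation:
  assumes "X \<in> vector_fields M" "f \<in> smooth_functions M" "g \<in> smooth_functions M"
  shows "X x (f + g) = X x f + X x g" "X x (f * g) = f x * X x g + g x * X x f"
    "X x (\<lambda>y. r * f y) = r * X x f"
  using assms by (auto simp: vector_fields_def tangent_space_def)

lemma vector_field_not_smooth: "X \<in> vector_fields M \<Longrightarrow> f \<notin> smooth_functions M \<Longrightarrow> X x f = 0"
  by (auto simp: vector_fields_def tangent_space_def)

lemma vf_minus_eq: "- X = (\<lambda>_. -1) \<cdot>\<^sub>v X"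
  by (simp add: vf_scale_def fun_eq_iff)

lemma vf_bracket_swap: "vf_bracket X Y = - vf_bracket Y X"
  by (auto simp: vf_bracket_def fun_eq_iff)

lemma vf_bracket_self: "vf_bracket X X = 0"
  by (auto simp: vf_bracket_def fun_eq_iff)

context
  fixes M :: "('m::{t2_space, second_countable_topology}) smooth_atlas"
  assumes M: "smooth_manifold M"
begin

lemma vector_field_zero: "X \<in> vector_fields M \<Longrightarrow> X x 0 = 0"
  using vector_field_derivation(1)[OF _ smooth_functions_closed(1,1)[OF M], of X x] by simp

lemma vector_field_diff:
  assumes "X \<in> vector_fields M" "f \<in> smooth_functions M" "g \<in> smooth_functions M"
  shows "X x (f - g) = X x f - X x g"
  using vector_field_derivation(1)[OF assms(1) smooth_functions_closed(5)[OF M assms(2,3)] assms(3), of x]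
  by simp

text \<open>
  Since tangent vectors vanish on functions that are not smooth, the identities between brackets below
  are equalities of HOL functions, without a restriction to smooth functions.
\<close>

lemma vapply_not_smooth: "X \<in> vector_fields M \<Longrightarrow> f \<notin> smooth_functions M \<Longrightarrow> vapply X f = 0"
  using vector_field_not_smooth[of X M f] by (auto simp: vapply_def fun_eq_iff)

lemma vapply_smooth: "X \<in> vector_fields M \<Longrightarrow> vapply X f \<in> smooth_functions M"
  using vapply_not_smooth[of X f] smooth_functions_closed(1)[OF M]
  by (cases "f \<in> smooth_functions M") (auto simp: vector_fields_def)

lemma vapply_derivation:
  assumes "X \<in> vector_fields M" "f \<in> smooth_functions M" "g \<in> smooth_functions M"
  shows "vapply X (f + g) = vapply X f + vapply X g"
    "vapply X (f * g) = f * vapply X g + g * vapply X f"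
    "vapply X (\<lambda>y. r * f y) = (\<lambda>y. r * vapply X f y)"
  using vector_field_derivation[OF assms] by (auto simp: vapply_def fun_eq_iff)

lemma vector_fields_add: "X \<in> vector_fields M \<Longrightarrow> Y \<in> vector_fields M \<Longrightarrow> X + Y \<in> vector_fields M"
  using smooth_functions_closed(2)[OF M]
  by (auto simp: vector_fields_def tangent_space_def vapply_simps algebra_simps)

lemma vector_fields_scale:
  assumes f: "f \<in> smooth_functions M" and X: "X \<in> vector_fields M"
  shows "f \<cdot>\<^sub>v X \<in> vector_fields M"
proof -
  have "(f \<cdot>\<^sub>v X) x \<in> tangent_space M x" for x
    using vector_field_derivation[OF X] vector_field_not_smooth[OF X]
    by (simp add: tangent_space_def vf_scale_def algebra_simps)
  moreover have "vapply (f \<cdot>\<^sub>v X) g \<in> smooth_functions M" for g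
    unfolding vapply_simps by (rule smooth_functions_closed(3)[OF M f vapply_smooth[OF X]])
  ultimately show ?thesis
    unfolding vector_fields_def by blast
qed

lemma vector_fields_minus: "X \<in> vector_fields M \<Longrightarrow> - X \<in> vector_fields M"
  unfolding vf_minus_eq by (intro vector_fields_scale const_smooth_functions[OF M])

lemma vector_fields_zero: "0 \<in> vector_fields M"
  using smooth_functions_closed(1)[OF M]
  by (auto simp: vector_fields_def tangent_space_def vapply_def zero_fun_def)

lemma vector_fields_bracket:
  assumes X: "X \<in> vector_fields M" and Y: "Y \<in> vector_fields M"
  shows "vf_bracket X Y \<in> vector_fields M"
proof -
  have "vf_bracket X Y x \<in> tangent_space M x" for x
    unfolding tangent_space_def
  proof (intro CollectI conjI ballI allI impI)
    fix f g
    assume f: "f \<in> smooth_functions M" and g: "g \<in> smooth_functions M"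
    note sm = vapply_smooth[OF X] vapply_smooth[OF Y]
    show "vf_bracket X Y x (f + g) = vf_bracket X Y x f + vf_bracket X Y x g"
      by (simp only: vf_bracket_def vapply_derivation(1)[OF X f g] vapply_derivation(1)[OF Y f g]
        vector_field_derivation(1)[OF X sm(2,2)] vector_field_derivation(1)[OF Y sm(1,1)]
        add_diff_add)
    have "X x (f * vapply Y g + g * vapply Y f)
        = f x * X x (vapply Y g) + Y x g * X x f + g x * X x (vapply Y f) + Y x f * X x g"
      by (simp only: vector_field_derivation(1)[OF X smooth_functions_closed(3)[OF M f sm(2)]
          smooth_functions_closed(3)[OF M g sm(2)]]
        vector_field_derivation(2)[OF X f sm(2)] vector_field_derivation(2)[OF X g sm(2)])
        (simp add: vapply_def)
    moreover have "Y x (f * vapply X g + g * vapply X f)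
        = f x * Y x (vapply X g) + X x g * Y x f + g x * Y x (vapply X f) + X x f * Y x g"
      by (simp only: vector_field_derivation(1)[OF Y smooth_functions_closed(3)[OF M f sm(1)]
          smooth_functions_closed(3)[OF M g sm(1)]]
        vector_field_derivation(2)[OF Y f sm(1)] vector_field_derivation(2)[OF Y g sm(1)])
        (simp add: vapply_def)
    ultimately show "vf_bracket X Y x (f * g) = f x * vf_bracket X Y x g + g x * vf_bracket X Y x f"
      by (simp only: vf_bracket_def vapply_derivation(2)[OF X f g] vapply_derivation(2)[OF Y f g])
        (simp add: algebra_simps)
  next
    fix f r
    assume f: "f \<in> smooth_functions M"
    note sm = vapply_smooth[OF X, of f] vapply_smooth[OF Y, of f]
    show "vf_bracket X Y x (\<lambda>y. r * f y) = r * vf_bracket X Y x f"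
      by (simp only: vf_bracket_def vapply_derivation(3)[OF X f f] vapply_derivation(3)[OF Y f f]
        vector_field_derivation(3)[OF X sm(2,2)] vector_field_derivation(3)[OF Y sm(1,1)])
        (simp add: algebra_simps)
  next
    fix f
    assume f: "f \<notin> smooth_functions M"
    show "vf_bracket X Y x f = 0"
      by (simp only: vf_bracket_def vapply_not_smooth[OF X f] vapply_not_smooth[OF Y f]
        vector_field_zero[OF X] vector_field_zero[OF Y] diff_self)
  qed
  moreover have "vapply (vf_bracket X Y) f = vapply X (vapply Y f) - vapply Y (vapply X f)" for f
    by (auto simp: vf_bracket_def vapply_def fun_eq_iff)
  then have "vapply (vf_bracket X Y) f \<in> smooth_functions M" for f
    by (simp only: smooth_functions_closed(5)[OF M vapply_smooth[OF X] vapply_smooth[OF Y]])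
  ultimately show ?thesis
    unfolding vector_fields_def by blast
qed

lemma vf_bracket_add:
  assumes "X \<in> vector_fields M" "Y \<in> vector_fields M" "Z \<in> vector_fields M"
  shows "vf_bracket X (Y + Z) = vf_bracket X Y + vf_bracket X Z"
    and "vf_bracket (X + Y) Z = vf_bracket X Z + vf_bracket Y Z"
  by (auto simp: vf_bracket_def fun_eq_iff vapply_simps vector_field_derivation(1)[OF assms(1)]
      vector_field_derivation(1)[OF assms(3)] assms vapply_smooth[OF assms(1), simplified]
      vapply_smooth[OF assms(2), simplified] vapply_smooth[OF assms(3), simplified])

lemma vf_bracket_scale:
  assumes X: "X \<in> vector_fields M" and Y: "Y \<in> vector_fields M" and f: "f \<in> smooth_functions M"
  shows "vf_bracket X (f \<cdot>\<^sub>v Y) = f \<cdot>\<^sub>v vf_bracket X Y + vapply X f \<cdot>\<^sub>v Y"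
proof -
  have "X x (f * vapply Y g) = f x * X x (vapply Y g) + Y x g * X x f" for x g
    using vector_field_derivation(2)[OF X f vapply_smooth[OF Y]] by (simp add: vapply_def)
  moreover have "vapply (f \<cdot>\<^sub>v Y) g = f * vapply Y g" for g
    by (rule vapply_simps)
  ultimately show ?thesis
    by (intro ext) (simp add: vf_bracket_def,
      simp add: vf_scale_def algebra_simps vapply_def[of X f])
qed

lemma vf_bracket_scale_left:
  assumes X: "X \<in> vector_fields M" and Y: "Y \<in> vector_fields M" and f: "f \<in> smooth_functions M"
  shows "vf_bracket (f \<cdot>\<^sub>v X) Y = f \<cdot>\<^sub>v vf_bracket X Y + (- vapply Y f) \<cdot>\<^sub>v X"
proof -
  have "vf_bracket (f \<cdot>\<^sub>v X) Y = - (f \<cdot>\<^sub>v vf_bracket Y X + vapply Y f \<cdot>\<^sub>v X)"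
    by (simp only: vf_bracket_swap[of "f \<cdot>\<^sub>v X" Y] vf_bracket_scale[OF Y X f])
  then show ?thesis
    unfolding vf_bracket_swap[of X Y] by (simp add: vf_scale_def fun_eq_iff)
qed

text \<open>
  The form of the Jacobi identity that says that \<open>[X, _]\<close> is a derivation of the bracket.
\<close>

lemma vf_bracket_jacobi:
  assumes X: "X \<in> vector_fields M" and Y: "Y \<in> vector_fields M" and Z: "Z \<in> vector_fields M"
  shows "vf_bracket X (vf_bracket Y Z) = vf_bracket (vf_bracket X Y) Z + vf_bracket Y (vf_bracket X Z)"
proof -
  have [simp]: "vapply (vf_bracket X Y) f = vapply X (vapply Y f) - vapply Y (vapply X f)" for X Y and f :: "'m \<Rightarrow> real"
    by (auto simp: vf_bracket_def vapply_def fun_eq_iff)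
  note sm = vapply_smooth[OF X] vapply_smooth[OF Y] vapply_smooth[OF Z]
  have "X x (vapply Y (vapply Z f) - vapply Z (vapply Y f)) = X x (vapply Y (vapply Z f)) - X x (vapply Z (vapply Y f))"
    "Y x (vapply X (vapply Z f) - vapply Z (vapply X f)) = Y x (vapply X (vapply Z f)) - Y x (vapply Z (vapply X f))"
    "Z x (vapply X (vapply Y f) - vapply Y (vapply X f)) = Z x (vapply X (vapply Y f)) - Z x (vapply Y (vapply X f))"
    for x f
    by (intro vector_field_diff X Y Z sm)+
  then show ?thesis
    by (simp add: fun_eq_iff vf_bracket_def[of "vf_bracket X Y" Z] vf_bracket_def[of X "vf_bracket Y Z"]
      vf_bracket_def[of Y "vf_bracket X Z"])
      (simp add: vf_bracket_def)
qed

end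

lemma vapply_const:
  assumes M: "smooth_manifold M" and X: "X \<in> vector_fields M"
  shows "vapply X (\<lambda>_. r) = 0"
proof -
  note one = const_smooth_functions[OF M, of 1]
  have "X x (\<lambda>_. 1) = 0" for x
    using vector_field_derivation(2)[OF X one one, of x] by (simp add: times_fun_def)
  then show ?thesis
    using vector_field_derivation(3)[OF X one one, of _ r] by (simp add: vapply_def fun_eq_iff zero_fun_apply)
qed

section \<open>Alternating maps on lists\<close>

text \<open>
  From here on, sections and forms are treated as elements of abelian groups. The rules that
  evaluate a sum at a point would only break up the sums.
\<close>

declare plus_fun_apply [simp del] zero_fun_apply [simp del] times_fun_apply [simp del]
  uminus_apply [simp del] minus_apply [simp del]

lemma msign_simps [simp]:
  "msign 0 s = s"
  "msign (Suc i) s = - msign i s"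
  by (simp_all add: msign_def)

lemma msign_add: "msign i (s + t) = msign i s + msign i (t :: 'b::ab_group_add)"
  by (simp add: msign_def)

lemma msign_diff: "msign i (s - t) = msign i s - msign i (t :: 'b::ab_group_add)"
  by (simp add: msign_def)

lemma msign_minus: "msign i (- s) = - msign i s"
  by (simp add: msign_def)

lemma msign_zero [simp]: "msign i 0 = 0"
  by (simp add: msign_def)

lemma msign_msign [simp]: "msign i (msign i s) = s"
  by (simp add: msign_def)

lemma msign_sum: "msign i (sum f S) = (\<Sum>x\<in>S. msign i (f x :: 'b::ab_group_add))"
  by (simp add: msign_def sum_negf)

lemma msign_apply: "msign i F x = msign i (F x)"
  by (simp add: msign_def uminus_apply)

lemma msign_msign_commute: "msign i (msign j s) = msign j (msign i s)"
  by (simp add: msign_def)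

lemma omit_simps [simp]:
  "omit 0 (x # xs) = xs"
  "omit (Suc i) (x # xs) = x # omit i xs"
  by (simp_all add: omit_def)

lemma length_omit [simp]: "i < length xs \<Longrightarrow> length (omit i xs) = length xs - 1"
  by (simp add: omit_def)

lemma omit_in_lists [simp]: "xs \<in> lists C \<Longrightarrow> omit i xs \<in> lists C"
  by (auto simp: omit_def lists_eq_set dest: in_set_takeD in_set_dropD)

lemma nth_in_lists [simp]: "xs \<in> lists C \<Longrightarrow> i < length xs \<Longrightarrow> xs ! i \<in> C"
  by (auto simp: lists_eq_set)

lemma list_update_in_lists [simp]: "xs \<in> lists C \<Longrightarrow> x \<in> C \<Longrightarrow> xs[i := x] \<in> lists C"
  using set_update_subset_insert[of xs i x] by (auto simp: lists_eq_set)

text \<open>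
  No degree is fixed here: lists of any length are allowed, and an alternating map of degree n
  is one that vanishes on the lists whose length is not n. This makes contraction with a first
  argument a total operation, so that identities can be proved by induction on the list.
\<close>

definition multi_alternating :: "'x::plus set \<Rightarrow> ('x list \<Rightarrow> 'b::ab_group_add) \<Rightarrow> bool" where
  "multi_alternating C F \<longleftrightarrow>
     (\<forall>us \<in> lists C. \<forall>vs \<in> lists C. \<forall>x \<in> C.
        (\<forall>y \<in> C. F (us @ (x + y) # vs) = F (us @ x # vs) + F (us @ y # vs)) \<and>
        F (us @ x # x # vs) = 0)"

lemma multi_alternating_prefix:
  "multi_alternating C F \<Longrightarrow> us \<in> lists C \<Longrightarrow> multi_alternating C (\<lambda>xs. F (us @ xs))"
  unfolding multi_alternating_def append_assoc[symmetric] by (simp del: append_assoc)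

lemma multi_alternating_Cons:
  "multi_alternating C F \<Longrightarrow> x \<in> C \<Longrightarrow> multi_alternating C (\<lambda>xs. F (x # xs))"
  using multi_alternating_prefix[of C F "[x]"] by simp

lemma multi_alternating_swap:
  assumes F: "multi_alternating C F" and C: "\<And>x y. x \<in> C \<Longrightarrow> y \<in> C \<Longrightarrow> x + y \<in> C"
    and "x \<in> C" "y \<in> C" "vs \<in> lists C"
  shows "F (y # x # vs) = - F (x # y # vs)"
proof -
  have add: "F (us @ (a + b) # ws) = F (us @ a # ws) + F (us @ b # ws)" and diag: "F (us @ a # a # ws) = 0"
    if "us \<in> lists C" "ws \<in> lists C" "a \<in> C" "b \<in> C" for us ws a b
    using F that unfolding multi_alternating_def by blast+
  have "0 = F ((x + y) # (x + y) # vs)"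
    using diag[of "[]" vs "x + y"] assms by simp
  also have "\<dots> = F (x # (x + y) # vs) + F (y # (x + y) # vs)"
    using add[of "[]" "(x + y) # vs" x y] assms by simp
  also have "\<dots> = F (x # y # vs) + F (y # x # vs)"
    using add[of "[x]" vs x y] add[of "[y]" vs x y] diag[of "[]" vs x] diag[of "[]" vs y] assms by simp
  finally show ?thesis
    by (simp add: eq_neg_iff_add_eq_0 add.commute)
qed

lemma multi_alternating_uminus:
  fixes F :: "'x::ab_group_add list \<Rightarrow> 'b::ab_group_add"
  assumes F: "multi_alternating C F" and "0 \<in> C" "x \<in> C" "- x \<in> C" "xs \<in> lists C"
  shows "F (- x # xs) = - F (x # xs)"
proof -
  have add: "F ((a + b) # xs) = F (a # xs) + F (b # xs)" if "a \<in> C" "b \<in> C" for a b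
    using F[unfolded multi_alternating_def, rule_format, of "[]" xs a] that assms by simp
  have "F (0 # xs) = 0"
    using add[of 0 0] assms by simp
  then show ?thesis
    using add[of x "- x"] assms by (simp add: eq_neg_iff_add_eq_0 add.commute)
qed

lemma multi_alternating_move:
  assumes "multi_alternating C F" and C: "\<And>x y. x \<in> C \<Longrightarrow> y \<in> C \<Longrightarrow> x + y \<in> C"
    and "us \<in> lists C" "x \<in> C" "vs \<in> lists C"
  shows "F (us @ x # vs) = msign (length us) (F (x # us @ vs))"
  using assms
proof (induction us arbitrary: F)
  case (Cons u us)
  have "F ((u # us) @ x # vs) = msign (length us) (F (u # x # us @ vs))"
    using Cons.IH[OF multi_alternating_Cons[OF Cons.prems(1)]] Cons.prems by simp
  also have "\<dots> = msign (length us) (- F (x # u # us @ vs))"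
    using multi_alternating_swap[OF Cons.prems(1) C, of x u "us @ vs"] Cons.prems by simp
  finally show ?case
    by (simp add: msign_minus)
qed simp

lemma multi_alternating_update:
  assumes "multi_alternating C F" and C: "\<And>x y. x \<in> C \<Longrightarrow> y \<in> C \<Longrightarrow> x + y \<in> C"
    and xs: "xs \<in> lists C" and "x \<in> C" and j: "j < length xs"
  shows "F (xs[j := x]) = msign j (F (x # omit j xs))"
proof -
  have "take j xs \<in> lists C" "drop (Suc j) xs \<in> lists C"
    using xs by (auto dest: in_set_takeD in_set_dropD simp: lists_eq_set)
  then show ?thesis
    using multi_alternating_move[OF assms(1) C, of "take j xs" x "drop (Suc j) xs"] \<open>x \<in> C\<close> j
    by (simp add: upd_conv_take_nth_drop omit_def)
qed

lemma multi_alternating_not_distinct: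
  assumes F: "multi_alternating C F" and C: "\<And>x y. x \<in> C \<Longrightarrow> y \<in> C \<Longrightarrow> x + y \<in> C"
    and xs: "xs \<in> lists C" "\<not> distinct xs"
  shows "F xs = 0"
proof -
  obtain us x ws vs where eq: "xs = us @ [x] @ ws @ [x] @ vs"
    using not_distinct_decomp[OF xs(2)] by blast
  note mem = xs(1)[unfolded eq]
  have "F (us @ x # ws @ x # vs) = msign (length ws) (F (us @ x # x # ws @ vs))"
    using multi_alternating_move[OF multi_alternating_prefix[OF F, of "us @ [x]"] C, of ws x vs] mem
    by simp
  also have "F (us @ x # x # ws @ vs) = 0"
    using F mem unfolding multi_alternating_def by simp
  finally show ?thesis
    by (simp add: eq)
qed

text \<open>
  The Chevalley--Eilenberg formula for an arbitrary action and bracket. Both the exterior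
  covariant derivative and the part of the simplicial differential that preserves the index k are
  of this form.
\<close>

definition ce_diff ::
    "('x \<Rightarrow> 'b \<Rightarrow> 'b::ab_group_add) \<Rightarrow> ('x \<Rightarrow> 'x \<Rightarrow> 'x) \<Rightarrow> ('x list \<Rightarrow> 'b) \<Rightarrow> 'x list \<Rightarrow> 'b" where
  "ce_diff act br F xs =
     (\<Sum>i < length xs. msign i (act (xs ! i) (F (omit i xs)))) +
     (\<Sum>j < length xs. \<Sum>i < j. msign (i + j) (F (br (xs ! i) (xs ! j) # omit i (omit j xs))))"

lemma ext_cov_deriv_eq_ce_diff: "ext_cov_deriv D \<omega> = ce_diff D vf_bracket \<omega>"
  by (auto simp: ext_cov_deriv_def ce_diff_def fun_eq_iff)

text \<open>
  Cartan's formula in disguise: the terms that involve the first argument x form the Lie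
  derivative along x, and in the others x can be moved to the front at the cost of a sign.
\<close>

lemma ce_diff_Cons:
  assumes F: "multi_alternating C F" and C: "\<And>x y. x \<in> C \<Longrightarrow> y \<in> C \<Longrightarrow> x + y \<in> C"
    and br: "\<And>x y. x \<in> C \<Longrightarrow> y \<in> C \<Longrightarrow> br x y \<in> C" and x: "x \<in> C" and xs: "xs \<in> lists C"
  shows "ce_diff act br F (x # xs) =
    act x (F xs) - (\<Sum>j < length xs. msign j (F (br x (xs ! j) # omit j xs)))
    - ce_diff act br (\<lambda>ys. F (x # ys)) xs"
proof -
  have "(\<Sum>i < length (x # xs). msign i (act ((x # xs) ! i) (F (omit i (x # xs)))))
      = act x (F xs) - (\<Sum>i < length xs. msign i (act (xs ! i) (F (x # omit i xs))))"
    unfolding length_Cons sum.lessThan_Suc_shift by (simp add: sum_negf)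
  moreover have "(\<Sum>j < length (x # xs). \<Sum>i < j.
        msign (i + j) (F (br ((x # xs) ! i) ((x # xs) ! j) # omit i (omit j (x # xs)))))
      = (\<Sum>j < length xs. - msign j (F (br x (xs ! j) # omit j xs)) +
          (\<Sum>i < j. msign (i + j) (F (br (xs ! i) (xs ! j) # x # omit i (omit j xs)))))"
    unfolding length_Cons sum.lessThan_Suc_shift by (simp add: sum.lessThan_Suc_shift)
  moreover have "F (br (xs ! i) (xs ! j) # x # omit i (omit j xs))
      = - F (x # br (xs ! i) (xs ! j) # omit i (omit j xs))" if "i < j" "j < length xs" for i j
    using that xs br x by (intro multi_alternating_swap[OF F C]) auto
  ultimately show ?thesis
    by (simp add: ce_diff_def sum.distrib sum_negf sum_subtractf msign_minus)
qed

section \<open>Sums over the entries of a list\<close>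

lemma sum_fun_apply: "sum f I x = (\<Sum>i\<in>I. f i x :: 'b::comm_monoid_add)"
  by (induction I rule: infinite_finite_induct) (simp_all add: plus_fun_apply zero_fun_apply)

text \<open>
  The sums on both sides are those that occur when a derivation of the entries acts on a list: on the
  left after the i-th entry has been moved elsewhere, on the right before that.
\<close>

lemma sum_omit_update:
  fixes G :: "'x list \<Rightarrow> 'b::comm_monoid_add"
  assumes "i < length xs"
  shows "(\<Sum>l < length (omit i xs). G ((omit i xs)[l := f (omit i xs ! l)])) =
    (\<Sum>l < length xs. if l = i then 0 else G (omit i (xs[l := f (xs ! l)])))"
  using assms
proof (induction xs arbitrary: i G)
  case (Cons x xs)
  show ?case
  proof (cases i)
    case 0
    then show ?thesis
      unfolding length_Cons sum.lessThan_Suc_shift by simp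
  next
    case (Suc i')
    with Cons.prems have "i' < length xs"
      by simp
    from Cons.IH[OF this, of "\<lambda>ys. G (x # ys)"] show ?thesis
      unfolding Suc omit_simps length_Cons sum.lessThan_Suc_shift by (simp cong: if_cong)
  qed
qed simp

text \<open>
  An ordered pair of different positions can be chosen by its first or by its second component.
\<close>

lemma sum_omit_omit_commute:
  fixes h :: "'x \<Rightarrow> 'x \<Rightarrow> 'x list \<Rightarrow> 'b::comm_monoid_add"
  shows "(\<Sum>i < length xs. \<Sum>j < length (omit i xs). h (xs ! i) (omit i xs ! j) (omit j (omit i xs))) =
    (\<Sum>i < length xs. \<Sum>j < length (omit i xs). h (omit i xs ! j) (xs ! i) (omit j (omit i xs)))"
proof (induction xs arbitrary: h)
  case (Cons x xs)
  show ?case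
    using Cons.IH[of "\<lambda>a b r. h a b (x # r)"]
    unfolding length_Cons sum.lessThan_Suc_shift omit_simps
    by (simp add: sum.lessThan_Suc_shift sum.distrib ac_simps del: length_omit)
qed simp

lemma mset_omit: "i < length xs \<Longrightarrow> add_mset (xs ! i) (mset (omit i xs)) = mset xs"
  unfolding omit_def by (subst (3) id_take_nth_drop[of i xs]) simp_all

lemma mset_omit_update:
  assumes "i < length xs" "l < length xs" "i \<noteq> l"
  shows "mset (omit i (xs[l := x])) = mset (omit l (xs[i := x]))"
proof -
  have "add_mset (xs ! l) (add_mset (xs ! i) (mset (omit i (xs[l := x])))) = add_mset x (mset xs)"
    if "i < length xs" "l < length xs" "i \<noteq> l" for i l
    using mset_omit[of i "xs[l := x]"] that by (simp add: mset_update)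
  from this[of i l] this[of l i] assms
  have "add_mset (xs ! l) (add_mset (xs ! i) (mset (omit i (xs[l := x]))))
      = add_mset (xs ! i) (add_mset (xs ! l) (mset (omit l (xs[i := x]))))"
    by metis
  then show ?thesis
    by (simp add: add_mset_commute[of "xs ! l"])
qed

lemma sum_split_at:
  fixes g :: "nat \<Rightarrow> 'b::comm_monoid_add"
  assumes "i < n"
  shows "(\<Sum>l < n. g l) = g i + (\<Sum>l < n. if l = i then 0 else g l)"
proof -
  have "(\<Sum>l < n. if l = i then 0 else g l) = (\<Sum>l \<in> {..<n} - {i}. g l)"
    using assms by (subst sum.remove[of _ i]) (auto intro!: sum.cong)
  then show ?thesis
    using assms by (simp add: sum.remove[of _ i g])
qed

lemma omit_update_same: "omit i (xs[i := x]) = omit i xs"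
  by (simp add: omit_def)

lemma omit_update_other:
  assumes "l \<noteq> i" "i < length xs"
  shows "omit i (xs[l := x]) = (omit i xs)[(if l < i then l else l - 1) := x]"
  using assms by (auto simp: omit_def list_update_append take_update_swap drop_update_swap list_update_beyond
      Suc_diff_Suc)

lemma zero_if_self_uminus: "S = 0" if "S = - S" for S :: "'m \<Rightarrow> 'v::real_vector"
proof
  fix x
  have "S x + S x = 0"
    using fun_cong[OF that, of x] by (simp add: uminus_apply eq_neg_iff_add_eq_0)
  then show "S x = 0 x"
    by (simp add: zero_fun_apply flip: scaleR_2)
qed

text \<open>
  If g is symmetric in the list, then its value at the i-th entry and the rest of the list is
  determined by this entry and the multiset of all entries, so that the sum is one over a multiset.
\<close>

lemma sum_nth_omit_cong_mset:
  fixes g :: "'x \<Rightarrow> 'x list \<Rightarrow> 'b::comm_monoid_add"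
  assumes g: "\<And>x ys zs. mset ys = mset zs \<Longrightarrow> g x ys = g x zs" and eq: "mset xs = mset xs'"
  shows "(\<Sum>i < length xs. g (xs ! i) (omit i xs)) = (\<Sum>i < length xs'. g (xs' ! i) (omit i xs'))"
proof -
  have *: "(\<Sum>i < length ys. g (ys ! i) (omit i ys)) =
      (\<Sum>x \<in># mset ys. g x (SOME zs. mset zs = mset ys - {#x#}))" for ys
  proof -
    have "g (ys ! i) (omit i ys) = g (ys ! i) (SOME zs. mset zs = mset ys - {#ys ! i#})" if "i < length ys" for i
    proof (rule g)
      have "mset (omit i ys) = mset ys - {#ys ! i#}"
        unfolding mset_omit[OF that, symmetric] by simp
      then show "mset (omit i ys) = mset (SOME zs. mset zs = mset ys - {#ys ! i#})"
        by (metis (mono_tags, lifting) someI_ex)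
    qed
    then have "(\<Sum>i < length ys. g (ys ! i) (omit i ys)) =
        sum_list (map (\<lambda>x. g x (SOME zs. mset zs = mset ys - {#x#})) ys)"
      by (simp add: sum_list_sum_nth atLeast0LessThan)
    then show ?thesis
      by (simp flip: sum_mset_sum_list)
  qed
  show ?thesis
    unfolding * eq ..
qed

section \<open>Forms of mixed degree\<close>

text \<open>
  The derivative of the values is covariant, that of the arguments is the Lie bracket. For an
  A-invariant connection, the operator \<open>lie_deriv\<close> is of this form apart from its action on the
  symmetric arguments.
\<close>

definition lie_cov ::
    "('m vfield \<Rightarrow> ('m \<Rightarrow> 'v::real_vector) \<Rightarrow> 'm \<Rightarrow> 'v) \<Rightarrow> 'm vfield \<Rightarrow> ('m, 'v) vform \<Rightarrow> ('m, 'v) vform" where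
  "lie_cov D X \<omega> Xs = D X (\<omega> Xs) - (\<Sum>j < length Xs. \<omega> (Xs[j := vf_bracket X (Xs ! j)]))"

lemma lie_cov_Nil: "lie_cov D X \<omega> [] = D X (\<omega> [])"
  by (simp add: lie_cov_def)

lemma lie_cov_Cons: "lie_cov D X \<omega> (Y # Ys) = lie_cov D X (contract Y \<omega>) Ys - \<omega> (vf_bracket X Y # Ys)"
  unfolding lie_cov_def length_Cons sum.lessThan_Suc_shift by (simp add: contract_def)

lemma d_wedge_Nil: "d_wedge f \<omega> [] = 0"
  by (simp add: d_wedge_def)

lemma d_wedge_Cons: "d_wedge f \<omega> (Y # Ys) = vapply Y f \<cdot>\<^sub>s \<omega> Ys - d_wedge f (contract Y \<omega>) Ys"
  unfolding d_wedge_def length_Cons sum.lessThan_Suc_shift by (simp add: contract_def sum_negf)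

lemma ext_cov_deriv_Nil: "ext_cov_deriv D \<omega> [] = 0"
  by (simp add: ext_cov_deriv_def)

text \<open>
  Sums of forms of different degrees: the component of degree m is given by the values on lists of
  length m.
\<close>

definition mixed_forms ::
    "'m smooth_atlas \<Rightarrow> ('m, 'v::real_vector) vbundle \<Rightarrow> ('m, 'v) vform set" where
  "mixed_forms M V = {\<omega>.
     multi_alternating (vector_fields M) \<omega> \<and>
     (\<forall>Xs \<in> lists (vector_fields M). \<omega> Xs \<in> sections M V) \<and>
     (\<forall>us \<in> lists (vector_fields M). \<forall>vs \<in> lists (vector_fields M). \<forall>X \<in> vector_fields M.
        \<forall>f \<in> smooth_functions M. \<omega> (us @ (f \<cdot>\<^sub>v X) # vs) = f \<cdot>\<^sub>s \<omega> (us @ X # vs))}"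

locale bundle_connection =
  fixes M :: "('m::{t2_space, second_countable_topology}) smooth_atlas"
    and V :: "('m, 'v::real_vector) vbundle"
    and D :: "'m vfield \<Rightarrow> ('m \<Rightarrow> 'v) \<Rightarrow> 'm \<Rightarrow> 'v"
  assumes manifold: "smooth_manifold M" and vbundle: "vector_bundle M V"
    and connection: "linear_connection M V D"
begin

abbreviation "VF \<equiv> vector_fields M"
abbreviation "\<Gamma>V \<equiv> sections M V"
abbreviation "\<Omega> \<equiv> mixed_forms M V"

lemmas VF_closed [simp] =
  vector_fields_add[OF manifold] vector_fields_scale[OF manifold, simplified]
  vector_fields_minus[OF manifold] vector_fields_zero[OF manifold] vector_fields_bracket[OF manifold]

lemmas sections_closed' [simp] = sections_closed[OF manifold vbundle, simplified]

lemmas smooth_closed [simp] = smooth_functions_closed[OF manifold, simplified]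
  vapply_smooth[OF manifold, simplified] const_smooth_functions[OF manifold, simplified]

lemma sections_msign: "s \<in> \<Gamma>V \<Longrightarrow> msign i s \<in> \<Gamma>V"
  by (simp add: msign_def)

lemma D_section [simp]: "X \<in> VF \<Longrightarrow> s \<in> \<Gamma>V \<Longrightarrow> D X s \<in> \<Gamma>V"
  using connection unfolding linear_connection_def by blast

lemma D_add: "X \<in> VF \<Longrightarrow> s \<in> \<Gamma>V \<Longrightarrow> t \<in> \<Gamma>V \<Longrightarrow> D X (s + t) = D X s + D X t"
  using connection unfolding linear_connection_def by blast

lemma D_field_add: "X \<in> VF \<Longrightarrow> Y \<in> VF \<Longrightarrow> s \<in> \<Gamma>V \<Longrightarrow> D (X + Y) s = D X s + D Y s"
  using connection unfolding linear_connection_def by blast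

lemma D_field_scale: "X \<in> VF \<Longrightarrow> s \<in> \<Gamma>V \<Longrightarrow> f \<in> smooth_functions M \<Longrightarrow> D (f \<cdot>\<^sub>v X) s = f \<cdot>\<^sub>s D X s"
  using connection unfolding linear_connection_def by blast

lemma D_scale:
  "X \<in> VF \<Longrightarrow> s \<in> \<Gamma>V \<Longrightarrow> f \<in> smooth_functions M \<Longrightarrow> D X (f \<cdot>\<^sub>s s) = f \<cdot>\<^sub>s D X s + vapply X f \<cdot>\<^sub>s s"
  using connection unfolding linear_connection_def by blast

lemma D_diff: "X \<in> VF \<Longrightarrow> s \<in> \<Gamma>V \<Longrightarrow> t \<in> \<Gamma>V \<Longrightarrow> D X (s - t) = D X s - D X t"
  using D_add[of X "s - t" t] by simp

lemma D_zero [simp]: "X \<in> VF \<Longrightarrow> D X 0 = 0"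
  using D_diff[of X 0 0] by simp

lemma D_minus: "X \<in> VF \<Longrightarrow> s \<in> \<Gamma>V \<Longrightarrow> D X (- s) = - D X s"
  using D_diff[of X 0 s] by simp

lemma mixed_formsD:
  assumes "\<omega> \<in> \<Omega>" "Xs \<in> lists VF"
  shows "\<omega> Xs \<in> \<Gamma>V"
    "X \<in> VF \<Longrightarrow> Y \<in> VF \<Longrightarrow> \<omega> ((X + Y) # Xs) = \<omega> (X # Xs) + \<omega> (Y # Xs)"
    "X \<in> VF \<Longrightarrow> \<omega> (X # X # Xs) = 0"
    "X \<in> VF \<Longrightarrow> f \<in> smooth_functions M \<Longrightarrow> \<omega> ((f \<cdot>\<^sub>v X) # Xs) = f \<cdot>\<^sub>s \<omega> (X # Xs)"
proof -
  have ma: "multi_alternating VF \<omega>" and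
    sc: "\<And>us vs X f. us \<in> lists VF \<Longrightarrow> vs \<in> lists VF \<Longrightarrow> X \<in> VF \<Longrightarrow> f \<in> smooth_functions M \<Longrightarrow>
      \<omega> (us @ (f \<cdot>\<^sub>v X) # vs) = f \<cdot>\<^sub>s \<omega> (us @ X # vs)"
    using assms(1) unfolding mixed_forms_def by blast+
  show "\<omega> Xs \<in> \<Gamma>V"
    using assms unfolding mixed_forms_def by blast
  show "X \<in> VF \<Longrightarrow> Y \<in> VF \<Longrightarrow> \<omega> ((X + Y) # Xs) = \<omega> (X # Xs) + \<omega> (Y # Xs)"
    and "X \<in> VF \<Longrightarrow> \<omega> (X # X # Xs) = 0"
    using ma[unfolded multi_alternating_def, rule_format, of "[]" Xs X] assms(2) by auto
  show "X \<in> VF \<Longrightarrow> f \<in> smooth_functions M \<Longrightarrow> \<omega> ((f \<cdot>\<^sub>v X) # Xs) = f \<cdot>\<^sub>s \<omega> (X # Xs)"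
    using sc[of "[]" Xs X f] assms(2) by simp
qed

lemma mixed_forms_alternating: "\<omega> \<in> \<Omega> \<Longrightarrow> multi_alternating VF \<omega>"
  by (simp add: mixed_forms_def)

lemma mixed_forms_minus_arg:
  assumes "\<omega> \<in> \<Omega>" "Xs \<in> lists VF" "X \<in> VF"
  shows "\<omega> ((- X) # Xs) = - \<omega> (X # Xs)"
  using mixed_formsD(4)[OF assms(1,2,3), of "\<lambda>_. -1"]
  unfolding vf_minus_eq[of X] by (simp add: sec_scale_def fun_eq_iff uminus_apply)

lemma mixed_forms_zero_arg: "\<omega> \<in> \<Omega> \<Longrightarrow> Xs \<in> lists VF \<Longrightarrow> \<omega> (0 # Xs) = 0"
  using mixed_formsD(2)[of \<omega> Xs 0 0] by simp

lemma mixed_forms_swap: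
  "\<omega> \<in> \<Omega> \<Longrightarrow> Xs \<in> lists VF \<Longrightarrow> X \<in> VF \<Longrightarrow> Y \<in> VF \<Longrightarrow> \<omega> (Y # X # Xs) = - \<omega> (X # Y # Xs)"
  by (intro multi_alternating_swap[OF mixed_forms_alternating]) auto

lemma mixed_forms_contract [simp]:
  assumes \<omega>: "\<omega> \<in> \<Omega>" and X: "X \<in> VF"
  shows "contract X \<omega> \<in> \<Omega>"
proof -
  have eq: "contract X \<omega> = (\<lambda>Xs. \<omega> (X # Xs))"
    by (simp add: fun_eq_iff contract_def)
  have "multi_alternating VF (contract X \<omega>)"
    unfolding eq by (rule multi_alternating_Cons[OF mixed_forms_alternating[OF \<omega>] X])
  moreover have "\<omega> (X # us @ (f \<cdot>\<^sub>v Y) # vs) = f \<cdot>\<^sub>s \<omega> (X # us @ Y # vs)"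
    if "us \<in> lists VF" "vs \<in> lists VF" "Y \<in> VF" "f \<in> smooth_functions M" for us vs Y f
  proof -
    have "\<forall>us \<in> lists VF. \<forall>vs \<in> lists VF. \<forall>X \<in> VF. \<forall>f \<in> smooth_functions M.
        \<omega> (us @ (f \<cdot>\<^sub>v X) # vs) = f \<cdot>\<^sub>s \<omega> (us @ X # vs)"
      using \<omega> unfolding mixed_forms_def by blast
    from this[rule_format, of "X # us" vs Y f] show ?thesis
      using that X by simp
  qed
  moreover have "\<omega> (X # Xs) \<in> \<Gamma>V" if "Xs \<in> lists VF" for Xs
    using mixed_formsD(1)[OF \<omega>, of "X # Xs"] that X by simp
  ultimately show ?thesis
    unfolding mixed_forms_def mem_Collect_eq by (auto simp: eq)
qed

text \<open>
  For an operator on forms, the conditions on a first argument are easy to check, and contraction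
  with a first argument leads to values of the same operator, up to sign and up to forms that are
  already known. By induction on the position of the argument this is enough. There is no degree to
  induct on, which gives the principle its coinductive shape.
\<close>

lemma mixed_forms_coinduct:
  assumes "\<omega> \<in> \<S>"
    and nil: "\<And>\<sigma>. \<sigma> \<in> \<S> \<Longrightarrow> \<sigma> [] \<in> \<Gamma>V"
    and add: "\<And>\<sigma> X Y Xs. \<sigma> \<in> \<S> \<Longrightarrow> Xs \<in> lists VF \<Longrightarrow> X \<in> VF \<Longrightarrow> Y \<in> VF \<Longrightarrow>
      \<sigma> ((X + Y) # Xs) = \<sigma> (X # Xs) + \<sigma> (Y # Xs)"
    and diag: "\<And>\<sigma> X Xs. \<sigma> \<in> \<S> \<Longrightarrow> Xs \<in> lists VF \<Longrightarrow> X \<in> VF \<Longrightarrow> \<sigma> (X # X # Xs) = 0"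
    and scale: "\<And>\<sigma> X f Xs. \<sigma> \<in> \<S> \<Longrightarrow> Xs \<in> lists VF \<Longrightarrow> X \<in> VF \<Longrightarrow> f \<in> smooth_functions M \<Longrightarrow>
      \<sigma> ((f \<cdot>\<^sub>v X) # Xs) = f \<cdot>\<^sub>s \<sigma> (X # Xs)"
    and step: "\<And>\<sigma> X. \<sigma> \<in> \<S> \<Longrightarrow> X \<in> VF \<Longrightarrow>
      \<exists>\<tau> \<sigma>' i. \<tau> \<in> \<Omega> \<and> \<sigma>' \<in> \<S> \<and> (\<forall>Xs \<in> lists VF. \<sigma> (X # Xs) = \<tau> Xs + msign i (\<sigma>' Xs))"
  shows "\<omega> \<in> \<Omega>"
proof -
  have "\<sigma> us \<in> \<Gamma>V \<and> (\<forall>vs \<in> lists VF. \<forall>X \<in> VF.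
      (\<forall>Y \<in> VF. \<sigma> (us @ (X + Y) # vs) = \<sigma> (us @ X # vs) + \<sigma> (us @ Y # vs)) \<and>
      \<sigma> (us @ X # X # vs) = 0 \<and>
      (\<forall>f \<in> smooth_functions M. \<sigma> (us @ (f \<cdot>\<^sub>v X) # vs) = f \<cdot>\<^sub>s \<sigma> (us @ X # vs)))"
    if "us \<in> lists VF" "\<sigma> \<in> \<S>" for us \<sigma>
    using that
  proof (induction us arbitrary: \<sigma> rule: list.induct)
    case Nil
    then show ?case
      unfolding append_Nil using nil add diag scale by blast
  next
    case (Cons Z us)
    from Cons.prems(1) have Z: "Z \<in> VF" and us: "us \<in> lists VF"
      by simp_all
    obtain \<tau> \<sigma>' i where \<tau>: "\<tau> \<in> \<Omega>" and \<sigma>': "\<sigma>' \<in> \<S>"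
      and eq: "\<And>Xs. Xs \<in> lists VF \<Longrightarrow> \<sigma> (Z # Xs) = \<tau> Xs + msign i (\<sigma>' Xs)"
      using step[OF Cons.prems(2) Z] by blast
    have t: "\<tau> us \<in> \<Gamma>V" "\<And>vs X. vs \<in> lists VF \<Longrightarrow> X \<in> VF \<Longrightarrow> \<tau> (us @ X # X # vs) = 0"
      "\<And>vs X Y. vs \<in> lists VF \<Longrightarrow> X \<in> VF \<Longrightarrow> Y \<in> VF \<Longrightarrow>
        \<tau> (us @ (X + Y) # vs) = \<tau> (us @ X # vs) + \<tau> (us @ Y # vs)"
      "\<And>vs X f. vs \<in> lists VF \<Longrightarrow> X \<in> VF \<Longrightarrow> f \<in> smooth_functions M \<Longrightarrow>
        \<tau> (us @ (f \<cdot>\<^sub>v X) # vs) = f \<cdot>\<^sub>s \<tau> (us @ X # vs)"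
      using \<tau> us unfolding mixed_forms_def multi_alternating_def by blast+
    have IH: "\<sigma>' us \<in> \<Gamma>V" "\<And>vs X. vs \<in> lists VF \<Longrightarrow> X \<in> VF \<Longrightarrow> \<sigma>' (us @ X # X # vs) = 0"
      "\<And>vs X Y. vs \<in> lists VF \<Longrightarrow> X \<in> VF \<Longrightarrow> Y \<in> VF \<Longrightarrow>
        \<sigma>' (us @ (X + Y) # vs) = \<sigma>' (us @ X # vs) + \<sigma>' (us @ Y # vs)"
      "\<And>vs X f. vs \<in> lists VF \<Longrightarrow> X \<in> VF \<Longrightarrow> f \<in> smooth_functions M \<Longrightarrow>
        \<sigma>' (us @ (f \<cdot>\<^sub>v X) # vs) = f \<cdot>\<^sub>s \<sigma>' (us @ X # vs)"
      using Cons.IH[OF us \<sigma>'] by blast+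
    show ?case
    proof (intro conjI ballI)
      show "\<sigma> (Z # us) \<in> \<Gamma>V"
        using eq[OF us] t IH by (simp add: sections_msign)
      fix vs X
      assume vs: "vs \<in> lists VF" and X: "X \<in> VF"
      show "\<sigma> ((Z # us) @ X # X # vs) = 0"
        using eq[of "us @ X # X # vs"] t IH us vs X by simp
      show "\<sigma> ((Z # us) @ (X + Y) # vs) = \<sigma> ((Z # us) @ X # vs) + \<sigma> ((Z # us) @ Y # vs)" if "Y \<in> VF" for Y
        using eq[of "us @ (X + Y) # vs"] eq[of "us @ X # vs"] eq[of "us @ Y # vs"] t IH us vs X that
        by (simp add: msign_add)
      show "\<sigma> ((Z # us) @ (f \<cdot>\<^sub>v X) # vs) = f \<cdot>\<^sub>s \<sigma> ((Z # us) @ X # vs)" if "f \<in> smooth_functions M" for f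
        using eq[of "us @ (f \<cdot>\<^sub>v X) # vs"] eq[of "us @ X # vs"] t IH us vs X that
        by (simp add: msign_def sec_scale_simps)
    qed
  qed
  then show ?thesis
    using \<open>\<omega> \<in> \<S>\<close> unfolding mixed_forms_def multi_alternating_def by blast
qed

end

section \<open>Cartan calculus for forms with values in a bundle with connection\<close>

context bundle_connection
begin

text \<open>
  Linearity of the operators is stated for forms that agree on lists of vector fields; what their
  values are on other lists is irrelevant.
\<close>

lemma lie_cov_add:
  assumes "X \<in> VF" "\<omega>1 \<in> \<Omega>" "\<omega>2 \<in> \<Omega>" "\<And>Ys. Ys \<in> lists VF \<Longrightarrow> \<omega> Ys = \<omega>1 Ys + \<omega>2 Ys" "Ys \<in> lists VF"
  shows "lie_cov D X \<omega> Ys = lie_cov D X \<omega>1 Ys + lie_cov D X \<omega>2 Ys"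
  using assms by (simp add: lie_cov_def D_add mixed_formsD(1) sum.distrib algebra_simps)

lemma lie_cov_diff:
  assumes "X \<in> VF" "\<omega>1 \<in> \<Omega>" "\<omega>2 \<in> \<Omega>" "\<And>Ys. Ys \<in> lists VF \<Longrightarrow> \<omega> Ys = \<omega>1 Ys - \<omega>2 Ys" "Ys \<in> lists VF"
  shows "lie_cov D X \<omega> Ys = lie_cov D X \<omega>1 Ys - lie_cov D X \<omega>2 Ys"
  using assms by (simp add: lie_cov_def D_diff mixed_formsD(1) sum_subtractf)

lemma sec_scale_sum: "f \<cdot>\<^sub>s sum s I = (\<Sum>i\<in>I. f \<cdot>\<^sub>s s i)"
  by (induction I rule: infinite_finite_induct) (simp_all add: sec_scale_simps)

lemma lie_cov_scale:
  assumes "X \<in> VF" "\<omega> \<in> \<Omega>" "f \<in> smooth_functions M"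
    "\<And>Ys. Ys \<in> lists VF \<Longrightarrow> \<omega>' Ys = f \<cdot>\<^sub>s \<omega> Ys" "Ys \<in> lists VF"
  shows "lie_cov D X \<omega>' Ys = f \<cdot>\<^sub>s lie_cov D X \<omega> Ys + vapply X f \<cdot>\<^sub>s \<omega> Ys"
  using assms by (simp add: lie_cov_def D_scale mixed_formsD(1) sec_scale_sum sec_scale_simps algebra_simps)

lemma lie_cov_zero:
  assumes "X \<in> VF" "\<And>Ys. Ys \<in> lists VF \<Longrightarrow> \<omega> Ys = 0" "Ys \<in> lists VF"
  shows "lie_cov D X \<omega> Ys = 0"
  using assms by (simp add: lie_cov_def)

lemma lie_cov_mixed_forms [simp]:
  assumes "\<omega> \<in> \<Omega>" and X: "X \<in> VF"
  shows "lie_cov D X \<omega> \<in> \<Omega>"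
proof (rule mixed_forms_coinduct[where \<S> = "lie_cov D X ` \<Omega>"])
  show "lie_cov D X \<omega> \<in> lie_cov D X ` \<Omega>"
    using assms by blast
next
  fix \<sigma> assume "\<sigma> \<in> lie_cov D X ` \<Omega>"
  then obtain \<omega> where \<sigma>: "\<sigma> = lie_cov D X \<omega>" and \<omega>: "\<omega> \<in> \<Omega>"
    by blast
  show "\<sigma> [] \<in> \<Gamma>V"
    using \<omega> X by (simp add: \<sigma> lie_cov_Nil mixed_formsD(1))
  fix Y assume Y: "Y \<in> VF"
  have eq: "\<sigma> (Y # Ys) = contract (- vf_bracket X Y) \<omega> Ys + lie_cov D X (contract Y \<omega>) Ys"
    if "Ys \<in> lists VF" for Ys
    using that X Y \<omega> by (simp add: \<sigma> lie_cov_Cons contract_def mixed_forms_minus_arg)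
  show "\<exists>\<tau> \<sigma>' i. \<tau> \<in> \<Omega> \<and> \<sigma>' \<in> lie_cov D X ` \<Omega> \<and> (\<forall>Ys\<in>lists VF. \<sigma> (Y # Ys) = \<tau> Ys + msign i (\<sigma>' Ys))"
    by (rule exI[of _ "contract (- vf_bracket X Y) \<omega>"], rule exI[of _ "lie_cov D X (contract Y \<omega>)"], rule exI[of _ 0])
      (use X Y \<omega> eq in simp_all)
  fix Ys assume Ys: "Ys \<in> lists VF"
  have "lie_cov D X (contract Y (contract Y \<omega>)) Ys = 0"
    using X Y Ys \<omega> by (intro lie_cov_zero) (auto simp: contract_def mixed_formsD)
  then show "\<sigma> (Y # Y # Ys) = 0"
    using X Y Ys \<omega> mixed_forms_swap[OF \<omega> Ys, of "vf_bracket X Y" Y]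
    by (simp add: \<sigma> lie_cov_Cons contract_def)
  show "\<sigma> ((Y + Z) # Ys) = \<sigma> (Y # Ys) + \<sigma> (Z # Ys)" if Z: "Z \<in> VF" for Z
    using X Y Z Ys \<omega> lie_cov_add[of X "contract Y \<omega>" "contract Z \<omega>" "contract (Y + Z) \<omega>" Ys]
    by (simp add: \<sigma> lie_cov_Cons contract_def mixed_formsD vf_bracket_add[OF manifold] algebra_simps)
  show "\<sigma> ((f \<cdot>\<^sub>v Y) # Ys) = f \<cdot>\<^sub>s \<sigma> (Y # Ys)" if f: "f \<in> smooth_functions M" for f
    using X Y f Ys \<omega> lie_cov_scale[of X "contract Y \<omega>" f "contract (f \<cdot>\<^sub>v Y) \<omega>" Ys]
    by (simp add: \<sigma> lie_cov_Cons contract_def mixed_formsD vf_bracket_scale[OF manifold] sec_scale_simps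
        algebra_simps)
qed

lemma lie_cov_field_add:
  assumes "X \<in> VF" "Y \<in> VF" "\<omega> \<in> \<Omega>" "Zs \<in> lists VF"
  shows "lie_cov D (X + Y) \<omega> Zs = lie_cov D X \<omega> Zs + lie_cov D Y \<omega> Zs"
  using assms(3,4)
proof (induction Zs arbitrary: \<omega> rule: list.induct)
  case (Cons Z Zs)
  then show ?case
    using assms(1,2) by (simp add: lie_cov_Cons vf_bracket_add[OF manifold] mixed_formsD algebra_simps)
qed (use assms in \<open>simp add: lie_cov_Nil D_field_add mixed_formsD\<close>)

text \<open>
  By induction on the list. The Jacobi identity takes care of the arguments, so the curvature only
  enters at the empty list, where a section is differentiated.
\<close>

lemma lie_cov_commutator:
  assumes X: "X \<in> VF" and Y: "Y \<in> VF" and "\<omega> \<in> \<Omega>" "Zs \<in> lists VF"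
  shows "lie_cov D X (lie_cov D Y \<omega>) Zs =
    lie_cov D Y (lie_cov D X \<omega>) Zs + lie_cov D (vf_bracket X Y) \<omega> Zs + curvature D X Y (\<omega> Zs)"
  using assms(3,4)
proof (induction Zs arbitrary: \<omega> rule: list.induct)
  case Nil
  then show ?case
    by (simp add: lie_cov_Nil curvature_def)
next
  case (Cons Z Zs)
  then have \<omega>: "\<omega> \<in> \<Omega>" and Z: "Z \<in> VF" and Zs: "Zs \<in> lists VF"
    by simp_all
  have *: "lie_cov D X (lie_cov D Y \<omega>) (Z # Zs) = lie_cov D X (lie_cov D Y (contract Z \<omega>)) Zs
      - lie_cov D X (contract (vf_bracket Y Z) \<omega>) Zs - lie_cov D Y (contract (vf_bracket X Z) \<omega>) Zs
      + \<omega> (vf_bracket Y (vf_bracket X Z) # Zs)" if X: "X \<in> VF" and Y: "Y \<in> VF" for X Y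
    using lie_cov_diff[of X "lie_cov D Y (contract Z \<omega>)" "contract (vf_bracket Y Z) \<omega>"
        "contract Z (lie_cov D Y \<omega>)" Zs] X Y \<omega> Z Zs
    by (simp add: lie_cov_Cons contract_def)
  have "\<omega> (vf_bracket X (vf_bracket Y Z) # Zs)
      = \<omega> (vf_bracket (vf_bracket X Y) Z # Zs) + \<omega> (vf_bracket Y (vf_bracket X Z) # Zs)"
    unfolding vf_bracket_jacobi[OF manifold X Y Z] using X Y Z Zs \<omega> by (intro mixed_formsD) auto
  then show ?case
    unfolding *[OF X Y] *[OF Y X] using Cons.IH[of "contract Z \<omega>"] X Y Z Zs \<omega>
    by (simp add: lie_cov_Cons) (simp add: contract_def algebra_simps)
qed

text \<open>
  Cartan's formula \<open>\<iota>\<^sub>X d + d \<iota>\<^sub>X = L\<^sub>X\<close>. Read as a recursion for the exterior covariant derivative,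
  it replaces the defining alternating sum in everything that follows.
\<close>

lemma cartan_formula:
  assumes X: "X \<in> VF" and \<omega>: "\<omega> \<in> \<Omega>" and Xs: "Xs \<in> lists VF"
  shows "ext_cov_deriv D \<omega> (X # Xs) = lie_cov D X \<omega> Xs - ext_cov_deriv D (contract X \<omega>) Xs"
proof -
  have "(\<lambda>ys. \<omega> (X # ys)) = contract X \<omega>"
    by (simp add: contract_def fun_eq_iff)
  moreover have "msign j (\<omega> (vf_bracket X (Xs ! j) # omit j Xs)) = \<omega> (Xs[j := vf_bracket X (Xs ! j)])"
    if "j < length Xs" for j
    using that X Xs by (subst multi_alternating_update[OF mixed_forms_alternating[OF \<omega>]]) simp_all
  ultimately show ?thesis
    using ce_diff_Cons[OF mixed_forms_alternating[OF \<omega>], of vf_bracket X Xs D] X Xs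
    by (simp add: ext_cov_deriv_eq_ce_diff lie_cov_def)
qed

lemma ext_cov_deriv_add:
  assumes "\<omega>1 \<in> \<Omega>" "\<omega>2 \<in> \<Omega>" "\<And>Ys. Ys \<in> lists VF \<Longrightarrow> \<omega> Ys = \<omega>1 Ys + \<omega>2 Ys" "Xs \<in> lists VF"
  shows "ext_cov_deriv D \<omega> Xs = ext_cov_deriv D \<omega>1 Xs + ext_cov_deriv D \<omega>2 Xs"
  using assms
  by (simp add: ext_cov_deriv_def D_add mixed_formsD(1) msign_add sum.distrib algebra_simps)

lemma ext_cov_deriv_diff:
  assumes "\<omega>1 \<in> \<Omega>" "\<omega>2 \<in> \<Omega>" "\<And>Ys. Ys \<in> lists VF \<Longrightarrow> \<omega> Ys = \<omega>1 Ys - \<omega>2 Ys" "Xs \<in> lists VF"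
  shows "ext_cov_deriv D \<omega> Xs = ext_cov_deriv D \<omega>1 Xs - ext_cov_deriv D \<omega>2 Xs"
  using assms
  by (simp add: ext_cov_deriv_def D_diff mixed_formsD(1) msign_diff sum_subtractf add_diff_add)

lemma ext_cov_deriv_zero:
  assumes "\<And>Ys. Ys \<in> lists VF \<Longrightarrow> \<omega> Ys = 0" "Xs \<in> lists VF"
  shows "ext_cov_deriv D \<omega> Xs = 0"
  using assms by (simp add: ext_cov_deriv_def)

lemma ext_cov_deriv_cong:
  assumes "\<And>Ys. Ys \<in> lists VF \<Longrightarrow> \<omega> Ys = \<omega>' Ys" "Xs \<in> lists VF"
  shows "ext_cov_deriv D \<omega> Xs = ext_cov_deriv D \<omega>' Xs"
  using assms by (simp add: ext_cov_deriv_def)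

lemma d_wedge_add:
  assumes "\<And>Ys. Ys \<in> lists VF \<Longrightarrow> \<omega> Ys = \<omega>1 Ys + \<omega>2 Ys" "Xs \<in> lists VF"
  shows "d_wedge f \<omega> Xs = d_wedge f \<omega>1 Xs + d_wedge f \<omega>2 Xs"
  using assms by (simp add: d_wedge_def sec_scale_simps msign_add sum.distrib)

lemma d_wedge_diff:
  assumes "\<And>Ys. Ys \<in> lists VF \<Longrightarrow> \<omega> Ys = \<omega>1 Ys - \<omega>2 Ys" "Xs \<in> lists VF"
  shows "d_wedge f \<omega> Xs = d_wedge f \<omega>1 Xs - d_wedge f \<omega>2 Xs"
  using assms by (simp add: d_wedge_def sec_scale_simps msign_diff sum_subtractf)

lemma d_wedge_minus:
  assumes "\<And>Ys. Ys \<in> lists VF \<Longrightarrow> \<omega> Ys = - \<omega>1 Ys" "Xs \<in> lists VF"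
  shows "d_wedge f \<omega> Xs = - d_wedge f \<omega>1 Xs"
  using assms by (simp add: d_wedge_def sec_scale_simps msign_minus sum_negf)

lemma d_wedge_zero:
  assumes "\<And>Ys. Ys \<in> lists VF \<Longrightarrow> \<omega> Ys = 0" "Xs \<in> lists VF"
  shows "d_wedge f \<omega> Xs = 0"
  using assms by (simp add: d_wedge_def sec_scale_simps)

lemma msign_scale: "msign i (f \<cdot>\<^sub>s s) = f \<cdot>\<^sub>s msign i s"
  by (simp add: msign_def sec_scale_simps)

lemma d_wedge_scale:
  assumes "\<And>Ys. Ys \<in> lists VF \<Longrightarrow> \<omega> Ys = g \<cdot>\<^sub>s \<omega>1 Ys" "Xs \<in> lists VF"
  shows "d_wedge f \<omega> Xs = g \<cdot>\<^sub>s d_wedge f \<omega>1 Xs"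
  using assms by (simp add: d_wedge_def sec_scale_sum msign_scale sec_scale_commute)

lemma mixed_forms_scale [simp]:
  assumes "\<omega> \<in> \<Omega>" "f \<in> smooth_functions M"
  shows "(\<lambda>Xs. f \<cdot>\<^sub>s \<omega> Xs) \<in> \<Omega>"
proof (rule mixed_forms_coinduct[where \<S> = "(\<lambda>\<omega> Xs. f \<cdot>\<^sub>s \<omega> Xs) ` \<Omega>"])
  fix \<sigma> assume "\<sigma> \<in> (\<lambda>\<omega> Xs. f \<cdot>\<^sub>s \<omega> Xs) ` \<Omega>"
  then obtain \<omega> where \<sigma>: "\<sigma> = (\<lambda>Xs. f \<cdot>\<^sub>s \<omega> Xs)" and \<omega>: "\<omega> \<in> \<Omega>"
    by blast
  show "\<sigma> [] \<in> \<Gamma>V"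
    using \<omega> assms(2) by (simp add: \<sigma> mixed_formsD(1))
  fix X assume X: "X \<in> VF"
  have mem: "(\<lambda>Xs. f \<cdot>\<^sub>s \<omega> (X # Xs)) \<in> (\<lambda>\<omega> Xs. f \<cdot>\<^sub>s \<omega> Xs) ` \<Omega>"
    using X \<omega> by (intro image_eqI[of _ _ "contract X \<omega>"]) (simp_all add: contract_def)
  show "\<exists>\<tau> \<sigma>' i. \<tau> \<in> \<Omega> \<and> \<sigma>' \<in> (\<lambda>\<omega> Xs. f \<cdot>\<^sub>s \<omega> Xs) ` \<Omega> \<and> (\<forall>Xs\<in>lists VF. \<sigma> (X # Xs) = \<tau> Xs + msign i (\<sigma>' Xs))"
    by (rule exI[of _ "contract 0 \<omega>"], rule exI[of _ "\<lambda>Xs. f \<cdot>\<^sub>s contract X \<omega> Xs"], rule exI[of _ 0])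
      (use mem X \<omega> mixed_forms_zero_arg[OF \<omega>] in \<open>simp_all add: \<sigma> contract_def\<close>)
  fix Xs assume Xs: "Xs \<in> lists VF"
  show "\<sigma> (X # X # Xs) = 0"
    using X Xs \<omega> by (simp add: \<sigma> mixed_formsD sec_scale_simps)
  show "\<sigma> ((X + Y) # Xs) = \<sigma> (X # Xs) + \<sigma> (Y # Xs)" if "Y \<in> VF" for Y
    using X Xs \<omega> that by (simp add: \<sigma> mixed_formsD sec_scale_simps)
  show "\<sigma> ((g \<cdot>\<^sub>v X) # Xs) = g \<cdot>\<^sub>s \<sigma> (X # Xs)" if "g \<in> smooth_functions M" for g
    using X Xs \<omega> that by (simp add: \<sigma> mixed_formsD sec_scale_commute)
qed (use assms in blast)

lemma mixed_forms_diff [simp]: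
  assumes "\<omega>1 \<in> \<Omega>" "\<omega>2 \<in> \<Omega>"
  shows "(\<lambda>Xs. \<omega>1 Xs - \<omega>2 Xs) \<in> \<Omega>"
proof -
  let ?\<S> = "(\<lambda>(\<omega>1, \<omega>2) Xs. \<omega>1 Xs - \<omega>2 Xs) ` (\<Omega> \<times> \<Omega>)"
  show ?thesis
  proof (rule mixed_forms_coinduct[where \<S> = ?\<S>])
    fix \<sigma> assume "\<sigma> \<in> ?\<S>"
    then obtain \<omega>1 \<omega>2 where \<sigma>: "\<sigma> = (\<lambda>Xs. \<omega>1 Xs - \<omega>2 Xs)" and \<omega>: "\<omega>1 \<in> \<Omega>" "\<omega>2 \<in> \<Omega>"
      by auto
    show "\<sigma> [] \<in> \<Gamma>V"
      using \<omega> by (simp add: \<sigma> mixed_formsD(1))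
    fix X assume X: "X \<in> VF"
    have eq: "(\<lambda>Xs. contract X \<omega>1 Xs - contract X \<omega>2 Xs) \<in> ?\<S>"
      using X \<omega> by (intro image_eqI[of _ _ "(contract X \<omega>1, contract X \<omega>2)"]) auto
  show "\<exists>\<tau> \<sigma>' i. \<tau> \<in> \<Omega> \<and> \<sigma>' \<in> ?\<S> \<and> (\<forall>Xs\<in>lists VF. \<sigma> (X # Xs) = \<tau> Xs + msign i (\<sigma>' Xs))"
      by (rule exI[of _ "contract 0 \<omega>1"], rule exI[of _ "\<lambda>Xs. contract X \<omega>1 Xs - contract X \<omega>2 Xs"], rule exI[of _ 0])
      (use eq X \<omega> mixed_forms_zero_arg[OF \<omega>(1)] in \<open>simp_all add: \<sigma> contract_def\<close>)
    fix Xs assume Xs: "Xs \<in> lists VF"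
    show "\<sigma> (X # X # Xs) = 0"
      using X Xs \<omega> by (simp add: \<sigma> mixed_formsD)
    show "\<sigma> ((X + Y) # Xs) = \<sigma> (X # Xs) + \<sigma> (Y # Xs)" if "Y \<in> VF" for Y
      using X Xs \<omega> that by (simp add: \<sigma> mixed_formsD)
    show "\<sigma> ((g \<cdot>\<^sub>v X) # Xs) = g \<cdot>\<^sub>s \<sigma> (X # Xs)" if "g \<in> smooth_functions M" for g
      using X Xs \<omega> that by (simp add: \<sigma> mixed_formsD sec_scale_simps)
  qed (use assms in auto)
qed

lemma d_wedge_mixed_forms [simp]:
  assumes "\<omega> \<in> \<Omega>" and f: "f \<in> smooth_functions M"
  shows "d_wedge f \<omega> \<in> \<Omega>"
proof (rule mixed_forms_coinduct[where \<S> = "d_wedge f ` \<Omega>"])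
  show "d_wedge f \<omega> \<in> d_wedge f ` \<Omega>"
    using assms by blast
next
  fix \<sigma> assume "\<sigma> \<in> d_wedge f ` \<Omega>"
  then obtain \<omega> where \<sigma>: "\<sigma> = d_wedge f \<omega>" and \<omega>: "\<omega> \<in> \<Omega>"
    by blast
  show "\<sigma> [] \<in> \<Gamma>V"
    by (simp add: \<sigma> d_wedge_Nil)
  fix Y assume Y: "Y \<in> VF"
  show "\<exists>\<tau> \<sigma>' i. \<tau> \<in> \<Omega> \<and> \<sigma>' \<in> d_wedge f ` \<Omega> \<and> (\<forall>Ys\<in>lists VF. \<sigma> (Y # Ys) = \<tau> Ys + msign i (\<sigma>' Ys))"
    by (rule exI[of _ "\<lambda>Ys. vapply Y f \<cdot>\<^sub>s \<omega> Ys"], rule exI[of _ "d_wedge f (contract Y \<omega>)"], rule exI[of _ 1])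
      (use Y \<omega> f in \<open>auto simp: \<sigma> d_wedge_Cons\<close>)
  fix Ys assume Ys: "Ys \<in> lists VF"
  have "d_wedge f (contract Y (contract Y \<omega>)) Ys = 0"
    using Y Ys \<omega> by (intro d_wedge_zero) (auto simp: contract_def mixed_formsD)
  then show "\<sigma> (Y # Y # Ys) = 0"
    by (simp add: \<sigma> d_wedge_Cons) (simp add: contract_def)
  show "\<sigma> ((Y + Z) # Ys) = \<sigma> (Y # Ys) + \<sigma> (Z # Ys)" if Z: "Z \<in> VF" for Z
    using Y Z Ys \<omega> d_wedge_add[of "contract (Y + Z) \<omega>" "contract Y \<omega>" "contract Z \<omega>" Ys f]
    by (simp add: \<sigma> d_wedge_Cons contract_def mixed_formsD vapply_simps sec_scale_simps)
  show "\<sigma> ((g \<cdot>\<^sub>v Y) # Ys) = g \<cdot>\<^sub>s \<sigma> (Y # Ys)" if g: "g \<in> smooth_functions M" for g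
    using Y g Ys \<omega> d_wedge_scale[of "contract (g \<cdot>\<^sub>v Y) \<omega>" g "contract Y \<omega>" Ys f]
    by (simp add: \<sigma> d_wedge_Cons contract_def mixed_formsD vapply_simps sec_scale_simps sec_scale_mult)
qed

lemma lie_cov_field_scale:
  assumes X: "X \<in> VF" and f: "f \<in> smooth_functions M" and "\<omega> \<in> \<Omega>" "Ys \<in> lists VF"
  shows "lie_cov D (f \<cdot>\<^sub>v X) \<omega> Ys = f \<cdot>\<^sub>s lie_cov D X \<omega> Ys + d_wedge f (contract X \<omega>) Ys"
  using assms(3,4)
proof (induction Ys arbitrary: \<omega> rule: list.induct)
  case Nil
  then show ?case
    using X f by (simp add: lie_cov_Nil d_wedge_Nil D_field_scale mixed_formsD(1))
next
  case (Cons Y Ys)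
  then have \<omega>: "\<omega> \<in> \<Omega>" and Y: "Y \<in> VF" and Ys: "Ys \<in> lists VF"
    by simp_all
  have "\<omega> (vf_bracket (f \<cdot>\<^sub>v X) Y # Ys) = f \<cdot>\<^sub>s \<omega> (vf_bracket X Y # Ys) - vapply Y f \<cdot>\<^sub>s \<omega> (X # Ys)"
    using X Y f \<omega> Ys by (simp add: vf_bracket_scale_left[OF manifold] mixed_formsD sec_scale_simps)
  moreover have "d_wedge f (contract X (contract Y \<omega>)) Ys = - d_wedge f (contract Y (contract X \<omega>)) Ys"
    using X Y \<omega> Ys by (intro d_wedge_minus) (simp_all add: contract_def mixed_forms_swap[of \<omega> _ X Y])
  ultimately show ?case
    using Cons.IH[of "contract Y \<omega>"] Y Ys \<omega>
    by (simp add: lie_cov_Cons d_wedge_Cons sec_scale_simps contract_def[of X \<omega> Ys])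
qed

lemma ext_cov_deriv_scale':
  assumes f: "f \<in> smooth_functions M" and "\<omega> \<in> \<Omega>" "Xs \<in> lists VF"
  shows "ext_cov_deriv D (\<lambda>Xs. f \<cdot>\<^sub>s \<omega> Xs) Xs = f \<cdot>\<^sub>s ext_cov_deriv D \<omega> Xs + d_wedge f \<omega> Xs"
  using assms(2,3)
proof (induction Xs arbitrary: \<omega> rule: list.induct)
  case (Cons X Xs)
  then have \<omega>: "\<omega> \<in> \<Omega>" and X: "X \<in> VF" and Xs: "Xs \<in> lists VF"
    by simp_all
  have "contract X (\<lambda>Xs. f \<cdot>\<^sub>s \<omega> Xs) = (\<lambda>Xs. f \<cdot>\<^sub>s contract X \<omega> Xs)"
    by (simp add: contract_def fun_eq_iff)
  then show ?case
    using Cons.IH[of "contract X \<omega>"] X Xs \<omega> f lie_cov_scale[OF X \<omega> f refl Xs]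
    by (simp add: cartan_formula d_wedge_Cons sec_scale_simps)
qed (simp add: ext_cov_deriv_Nil d_wedge_Nil sec_scale_simps)

lemma ext_cov_deriv_scale:
  assumes "f \<in> smooth_functions M" "\<omega> \<in> \<Omega>" "\<And>Ys. Ys \<in> lists VF \<Longrightarrow> \<omega>' Ys = f \<cdot>\<^sub>s \<omega> Ys" "Xs \<in> lists VF"
  shows "ext_cov_deriv D \<omega>' Xs = f \<cdot>\<^sub>s ext_cov_deriv D \<omega> Xs + d_wedge f \<omega> Xs"
  using ext_cov_deriv_scale'[OF assms(1,2,4)] ext_cov_deriv_cong[OF assms(3,4)] by simp

text \<open>
  For the linearity over the smooth functions in the first argument, expand with Cartan's formula:
  the terms with \<open>df\<close> in \<open>lie_cov_field_scale\<close> and \<open>ext_cov_deriv_scale\<close> cancel.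
\<close>

lemma ext_cov_deriv_mixed_forms [simp]:
  assumes "\<omega> \<in> \<Omega>"
  shows "ext_cov_deriv D \<omega> \<in> \<Omega>"
proof (rule mixed_forms_coinduct[where \<S> = "ext_cov_deriv D ` \<Omega>"])
  show "ext_cov_deriv D \<omega> \<in> ext_cov_deriv D ` \<Omega>"
    using assms by blast
next
  fix \<sigma> assume "\<sigma> \<in> ext_cov_deriv D ` \<Omega>"
  then obtain \<omega> where \<sigma>: "\<sigma> = ext_cov_deriv D \<omega>" and \<omega>: "\<omega> \<in> \<Omega>"
    by blast
  show "\<sigma> [] \<in> \<Gamma>V"
    by (simp add: \<sigma> ext_cov_deriv_Nil)
  fix Y assume Y: "Y \<in> VF"
  show "\<exists>\<tau> \<sigma>' i. \<tau> \<in> \<Omega> \<and> \<sigma>' \<in> ext_cov_deriv D ` \<Omega> \<and> (\<forall>Ys\<in>lists VF. \<sigma> (Y # Ys) = \<tau> Ys + msign i (\<sigma>' Ys))"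
    by (rule exI[of _ "lie_cov D Y \<omega>"], rule exI[of _ "ext_cov_deriv D (contract Y \<omega>)"], rule exI[of _ 1])
      (use Y \<omega> in \<open>auto simp: \<sigma> cartan_formula\<close>)
  fix Ys assume Ys: "Ys \<in> lists VF"
  have "ext_cov_deriv D (contract Y (contract Y \<omega>)) Ys = 0"
    using Y Ys \<omega> by (intro ext_cov_deriv_zero) (auto simp: contract_def mixed_formsD)
  then show "\<sigma> (Y # Y # Ys) = 0"
    using Y Ys \<omega> by (simp add: \<sigma> cartan_formula lie_cov_Cons vf_bracket_self mixed_forms_zero_arg)
  show "\<sigma> ((Y + Z) # Ys) = \<sigma> (Y # Ys) + \<sigma> (Z # Ys)" if Z: "Z \<in> VF" for Z
    using Y Z Ys \<omega> ext_cov_deriv_add[of "contract Y \<omega>" "contract Z \<omega>" "contract (Y + Z) \<omega>" Ys]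
    by (simp add: \<sigma> cartan_formula contract_def mixed_formsD lie_cov_field_add)
  show "\<sigma> ((f \<cdot>\<^sub>v Y) # Ys) = f \<cdot>\<^sub>s \<sigma> (Y # Ys)" if f: "f \<in> smooth_functions M" for f
    using Y f Ys \<omega> ext_cov_deriv_scale[of f "contract Y \<omega>" "contract (f \<cdot>\<^sub>v Y) \<omega>" Ys]
    by (simp add: \<sigma> cartan_formula contract_def mixed_formsD lie_cov_field_scale sec_scale_simps)
qed

text \<open>
  If X is in the kernel of the curvature, then by \<open>lie_cov_commutator\<close> the Lie derivatives form a
  representation as far as brackets with X are concerned. Cartan's formula carries this over to the
  exterior covariant derivative, by induction on the list.
\<close>

lemma lie_cov_ext_cov_deriv_commute:
  assumes X: "X \<in> VF" and flat: "\<And>Y s. Y \<in> VF \<Longrightarrow> s \<in> \<Gamma>V \<Longrightarrow> curvature D X Y s = 0"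
    and "\<omega> \<in> \<Omega>" "Ys \<in> lists VF"
  shows "lie_cov D X (ext_cov_deriv D \<omega>) Ys = ext_cov_deriv D (lie_cov D X \<omega>) Ys"
  using assms(3,4)
proof (induction Ys arbitrary: \<omega> rule: list.induct)
  case Nil
  then show ?case
    using X by (simp add: lie_cov_Nil ext_cov_deriv_Nil)
next
  case (Cons Y Ys)
  then have \<omega>: "\<omega> \<in> \<Omega>" and Y: "Y \<in> VF" and Ys: "Ys \<in> lists VF"
    by simp_all
  have "lie_cov D X (contract Y (ext_cov_deriv D \<omega>)) Ys
      = lie_cov D X (lie_cov D Y \<omega>) Ys - lie_cov D X (ext_cov_deriv D (contract Y \<omega>)) Ys"
    using X Y Ys \<omega> by (intro lie_cov_diff) (simp_all add: cartan_formula contract_def[of Y "ext_cov_deriv D \<omega>"])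
  moreover have "ext_cov_deriv D (contract Y (lie_cov D X \<omega>)) Ys
      = ext_cov_deriv D (lie_cov D X (contract Y \<omega>)) Ys - ext_cov_deriv D (contract (vf_bracket X Y) \<omega>) Ys"
    using X Y Ys \<omega> by (intro ext_cov_deriv_diff) (simp_all add: lie_cov_Cons contract_def)
  moreover have "lie_cov D X (lie_cov D Y \<omega>) Ys = lie_cov D Y (lie_cov D X \<omega>) Ys + lie_cov D (vf_bracket X Y) \<omega> Ys"
    using lie_cov_commutator[OF X Y \<omega> Ys] flat[OF Y mixed_formsD(1)[OF \<omega> Ys]] by simp
  ultimately show ?case
    using Cons.IH[of "contract Y \<omega>"] X Y Ys \<omega>
    by (simp add: lie_cov_Cons cartan_formula)
qed

lemma lie_cov_d_wedge:
  assumes X: "X \<in> VF" and f: "f \<in> smooth_functions M" and "\<omega> \<in> \<Omega>" "Ys \<in> lists VF"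
  shows "lie_cov D X (d_wedge f \<omega>) Ys = d_wedge (vapply X f) \<omega> Ys + d_wedge f (lie_cov D X \<omega>) Ys"
  using assms(3,4)
proof (induction Ys arbitrary: \<omega> rule: list.induct)
  case Nil
  then show ?case
    using X by (simp add: lie_cov_Nil d_wedge_Nil)
next
  case (Cons Y Ys)
  then have \<omega>: "\<omega> \<in> \<Omega>" and Y: "Y \<in> VF" and Ys: "Ys \<in> lists VF"
    by simp_all
  have "lie_cov D X (contract Y (d_wedge f \<omega>)) Ys
      = lie_cov D X (\<lambda>Ys. vapply Y f \<cdot>\<^sub>s \<omega> Ys) Ys - lie_cov D X (d_wedge f (contract Y \<omega>)) Ys"
    using X Y Ys \<omega> f by (intro lie_cov_diff) (simp_all add: d_wedge_Cons contract_def[of Y "d_wedge f \<omega>"])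
  moreover have "lie_cov D X (\<lambda>Ys. vapply Y f \<cdot>\<^sub>s \<omega> Ys) Ys
      = vapply Y f \<cdot>\<^sub>s lie_cov D X \<omega> Ys + vapply X (vapply Y f) \<cdot>\<^sub>s \<omega> Ys"
    using X Y Ys \<omega> by (intro lie_cov_scale) simp_all
  moreover have "d_wedge f (contract Y (lie_cov D X \<omega>)) Ys
      = d_wedge f (lie_cov D X (contract Y \<omega>)) Ys - d_wedge f (contract (vf_bracket X Y) \<omega>) Ys"
    using Ys by (intro d_wedge_diff) (simp_all add: lie_cov_Cons contract_def)
  ultimately show ?case
    using Cons.IH[of "contract Y \<omega>"] X Y Ys \<omega>
    by (simp add: lie_cov_Cons d_wedge_Cons vapply_bracket sec_scale_simps)
qed

lemma ext_cov_deriv_d_wedge: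
  assumes f: "f \<in> smooth_functions M" and "\<omega> \<in> \<Omega>" "Xs \<in> lists VF"
  shows "ext_cov_deriv D (d_wedge f \<omega>) Xs = - d_wedge f (ext_cov_deriv D \<omega>) Xs"
  using assms(2,3)
proof (induction Xs arbitrary: \<omega> rule: list.induct)
  case Nil
  then show ?case
    by (simp add: ext_cov_deriv_Nil d_wedge_Nil)
next
  case (Cons X Xs)
  then have \<omega>: "\<omega> \<in> \<Omega>" and X: "X \<in> VF" and Xs: "Xs \<in> lists VF"
    by simp_all
  have "ext_cov_deriv D (contract X (d_wedge f \<omega>)) Xs
      = ext_cov_deriv D (\<lambda>Xs. vapply X f \<cdot>\<^sub>s \<omega> Xs) Xs - ext_cov_deriv D (d_wedge f (contract X \<omega>)) Xs"
    using X Xs \<omega> f by (intro ext_cov_deriv_diff) (simp_all add: d_wedge_Cons contract_def[of X "d_wedge f \<omega>"])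
  moreover have "ext_cov_deriv D (\<lambda>Xs. vapply X f \<cdot>\<^sub>s \<omega> Xs) Xs
      = vapply X f \<cdot>\<^sub>s ext_cov_deriv D \<omega> Xs + d_wedge (vapply X f) \<omega> Xs"
    using X Xs \<omega> by (intro ext_cov_deriv_scale) simp_all
  moreover have "d_wedge f (contract X (ext_cov_deriv D \<omega>)) Xs
      = d_wedge f (lie_cov D X \<omega>) Xs - d_wedge f (ext_cov_deriv D (contract X \<omega>)) Xs"
    using X Xs \<omega> by (intro d_wedge_diff) (simp_all add: cartan_formula contract_def[of X "ext_cov_deriv D \<omega>"])
  ultimately show ?case
    using Cons.IH[of "contract X \<omega>"] lie_cov_d_wedge[OF X f \<omega> Xs] X Xs \<omega> f
    by (simp add: cartan_formula d_wedge_Cons)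
qed

lemma mixed_forms_cong:
  assumes \<omega>: "\<omega> \<in> \<Omega>" and eq: "\<And>Xs. Xs \<in> lists VF \<Longrightarrow> \<omega>' Xs = \<omega> Xs"
  shows "\<omega>' \<in> \<Omega>"
proof -
  have "\<omega>' Xs \<in> \<Gamma>V" if "Xs \<in> lists VF" for Xs
    using mixed_formsD(1)[OF \<omega> that] eq[OF that] by simp
  moreover have "multi_alternating VF \<omega>'"
    using mixed_forms_alternating[OF \<omega>] unfolding multi_alternating_def by (simp add: eq)
  moreover have "\<omega>' (us @ (f \<cdot>\<^sub>v X) # vs) = f \<cdot>\<^sub>s \<omega>' (us @ X # vs)"
    if "us \<in> lists VF" "vs \<in> lists VF" "X \<in> VF" "f \<in> smooth_functions M" for us vs X f
    using \<omega> that eq[of "us @ (f \<cdot>\<^sub>v X) # vs"] eq[of "us @ X # vs"] unfolding mixed_forms_def by simp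
  ultimately show ?thesis
    unfolding mixed_forms_def by blast
qed

lemma mixed_forms_zero [simp]: "0 \<in> \<Omega>"
  by (simp add: mixed_forms_def multi_alternating_def zero_fun_apply sec_scale_simps)

lemma mixed_forms_minus_closed [simp]: "\<omega>1 \<in> \<Omega> \<Longrightarrow> \<omega>2 \<in> \<Omega> \<Longrightarrow> \<omega>1 - \<omega>2 \<in> \<Omega>"
  using mixed_forms_diff[of \<omega>1 \<omega>2] by (simp add: fun_diff_def)

lemma mixed_forms_uminus_closed [simp]: "\<omega> \<in> \<Omega> \<Longrightarrow> - \<omega> \<in> \<Omega>"
  using mixed_forms_minus_closed[OF mixed_forms_zero, of \<omega>] by simp

lemma mixed_forms_plus_closed [simp]: "\<omega>1 \<in> \<Omega> \<Longrightarrow> \<omega>2 \<in> \<Omega> \<Longrightarrow> \<omega>1 + \<omega>2 \<in> \<Omega>"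
  using mixed_forms_minus_closed[of \<omega>1 "- \<omega>2"] by simp

lemma mixed_forms_sum_closed [simp]: "(\<And>i. i \<in> I \<Longrightarrow> \<omega> i \<in> \<Omega>) \<Longrightarrow> sum \<omega> I \<in> \<Omega>"
  by (induction I rule: infinite_finite_induct) auto

lemma mixed_forms_msign_closed [simp]: "\<omega> \<in> \<Omega> \<Longrightarrow> msign i \<omega> \<in> \<Omega>"
  by (simp add: msign_def)

lemma ext_cov_deriv_plus:
  "\<omega>1 \<in> \<Omega> \<Longrightarrow> \<omega>2 \<in> \<Omega> \<Longrightarrow> Xs \<in> lists VF \<Longrightarrow>
    ext_cov_deriv D (\<omega>1 + \<omega>2) Xs = ext_cov_deriv D \<omega>1 Xs + ext_cov_deriv D \<omega>2 Xs"
  by (rule ext_cov_deriv_add) (simp_all add: plus_fun_apply)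

lemma ext_cov_deriv_minus:
  "\<omega>1 \<in> \<Omega> \<Longrightarrow> \<omega>2 \<in> \<Omega> \<Longrightarrow> Xs \<in> lists VF \<Longrightarrow>
    ext_cov_deriv D (\<omega>1 - \<omega>2) Xs = ext_cov_deriv D \<omega>1 Xs - ext_cov_deriv D \<omega>2 Xs"
  by (rule ext_cov_deriv_diff) (simp_all add: minus_apply)

lemma ext_cov_deriv_0 [simp]: "Xs \<in> lists VF \<Longrightarrow> ext_cov_deriv D 0 Xs = 0"
  by (rule ext_cov_deriv_zero) (simp_all add: zero_fun_apply)

lemma ext_cov_deriv_uminus:
  "\<omega> \<in> \<Omega> \<Longrightarrow> Xs \<in> lists VF \<Longrightarrow> ext_cov_deriv D (- \<omega>) Xs = - ext_cov_deriv D \<omega> Xs"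
  using ext_cov_deriv_minus[OF mixed_forms_zero, of \<omega> Xs] by simp

lemma ext_cov_deriv_msign:
  "\<omega> \<in> \<Omega> \<Longrightarrow> Xs \<in> lists VF \<Longrightarrow> ext_cov_deriv D (msign i \<omega>) Xs = msign i (ext_cov_deriv D \<omega> Xs)"
  by (simp add: msign_def ext_cov_deriv_uminus)

lemma ext_cov_deriv_sum:
  assumes "\<And>i. i \<in> I \<Longrightarrow> \<omega> i \<in> \<Omega>" "Xs \<in> lists VF"
  shows "ext_cov_deriv D (sum \<omega> I) Xs = (\<Sum>i\<in>I. ext_cov_deriv D (\<omega> i) Xs)"
  using assms by (induction I rule: infinite_finite_induct) (simp_all add: ext_cov_deriv_plus)

lemma lie_cov_sum:
  assumes "\<And>i. i \<in> I \<Longrightarrow> \<omega> i \<in> \<Omega>" "X \<in> VF" "Xs \<in> lists VF"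
  shows "lie_cov D X (sum \<omega> I) Xs = (\<Sum>i\<in>I. lie_cov D X (\<omega> i) Xs)"
  using assms(1)
proof (induction I rule: infinite_finite_induct)
  case (insert i I)
  then have "lie_cov D X (\<omega> i + sum \<omega> I) Xs = lie_cov D X (\<omega> i) Xs + lie_cov D X (sum \<omega> I) Xs"
    using assms by (intro lie_cov_add) (simp_all add: plus_fun_apply)
  with insert show ?case
    by simp
qed (use assms in \<open>simp_all add: lie_cov_zero zero_fun_apply\<close>)

text \<open>
  Separates degrees from everything else: operators are studied on mixed forms, and afterwards only
  the lengths of lists have to be compared.
\<close>

lemma forms_iff_mixed_forms:
  "\<omega> \<in> forms M V m \<longleftrightarrow> \<omega> \<in> \<Omega> \<and> (\<forall>Xs. Xs \<notin> tuples VF m \<longrightarrow> \<omega> Xs = 0)"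
proof
  assume "\<omega> \<in> forms M V m"
  then have sec: "\<And>Xs. Xs \<in> tuples VF m \<Longrightarrow> \<omega> Xs \<in> \<Gamma>V"
    and vanish: "\<And>Xs. Xs \<notin> tuples VF m \<Longrightarrow> \<omega> Xs = 0"
    and lin: "multilinear_on (smooth_functions M) (\<cdot>\<^sub>v) VF m \<omega>"
    and alt: "alternating_on VF m \<omega>"
    by (auto simp: forms_def)
  have "\<omega> Xs \<in> \<Gamma>V" for Xs
    using sec vanish by (cases "Xs \<in> tuples VF m") simp_all
  moreover have "\<omega> (us @ (x + y) # vs) = \<omega> (us @ x # vs) + \<omega> (us @ y # vs)"
    if "us \<in> lists VF" "vs \<in> lists VF" "x \<in> VF" "y \<in> VF" for us vs x y
  proof (cases "length us + 1 + length vs = m")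
    case True
    then show ?thesis
      using lin that unfolding multilinear_on_def lists_eq_set by blast
  next
    case False
    then have "us @ z # vs \<notin> tuples VF m" for z
      by (auto simp: tuples_def)
    then show ?thesis
      by (simp add: vanish)
  qed
  moreover have "\<omega> (us @ (f \<cdot>\<^sub>v x) # vs) = f \<cdot>\<^sub>s \<omega> (us @ x # vs)"
    if "us \<in> lists VF" "vs \<in> lists VF" "x \<in> VF" "f \<in> smooth_functions M" for us vs x f
  proof (cases "length us + 1 + length vs = m")
    case True
    then show ?thesis
      using lin that unfolding multilinear_on_def lists_eq_set by blast
  next
    case False
    then have "us @ z # vs \<notin> tuples VF m" for z
      by (auto simp: tuples_def)
    then show ?thesis
      by (simp add: vanish sec_scale_simps)
  qed
  moreover have "\<omega> (us @ x # x # vs) = 0" for us vs x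
    using alt vanish unfolding alternating_on_def
    by (cases "us @ x # x # vs \<in> tuples VF m") (simp_all add: tuples_def)
  ultimately have "\<omega> \<in> \<Omega>"
    unfolding mixed_forms_def multi_alternating_def by blast
  then show "\<omega> \<in> \<Omega> \<and> (\<forall>Xs. Xs \<notin> tuples VF m \<longrightarrow> \<omega> Xs = 0)"
    using vanish by blast
next
  assume \<omega>: "\<omega> \<in> \<Omega> \<and> (\<forall>Xs. Xs \<notin> tuples VF m \<longrightarrow> \<omega> Xs = 0)"
  then have "alternating_on VF m \<omega>"
    using multi_alternating_not_distinct[OF mixed_forms_alternating VF_closed(1)]
    by (auto simp: alternating_on_def tuples_def lists_eq_set)
  moreover have "multilinear_on (smooth_functions M) (\<cdot>\<^sub>v) VF m \<omega>"
    using \<omega> unfolding mixed_forms_def multi_alternating_def multilinear_on_def lists_eq_set by blast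
  moreover have "\<omega> Xs \<in> \<Gamma>V" if "Xs \<in> tuples VF m" for Xs
    using \<omega> that mixed_formsD(1)[of \<omega> Xs] by (auto simp: tuples_def lists_eq_set)
  ultimately show "\<omega> \<in> forms M V m"
    using \<omega> by (auto simp: forms_def)
qed

lemma d_wedge_const: "Xs \<in> lists VF \<Longrightarrow> d_wedge (\<lambda>_. r) \<omega> Xs = 0"
  by (simp add: d_wedge_def vapply_const[OF manifold] sec_scale_simps)

lemma d_wedge_sum: "d_wedge f (sum \<omega> I) Xs = (\<Sum>i\<in>I. d_wedge f (\<omega> i) Xs)"
  unfolding d_wedge_def by (subst sum.swap) (simp add: sum_fun_apply sec_scale_sum msign_sum)

lemma d_wedge_cong: "(\<And>Ys. Ys \<in> lists VF \<Longrightarrow> \<omega> Ys = \<omega>' Ys) \<Longrightarrow> Xs \<in> lists VF \<Longrightarrow>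
    d_wedge f \<omega> Xs = d_wedge f \<omega>' Xs"
  by (simp add: d_wedge_def)

lemma d_wedge_plus: "d_wedge f (\<omega>1 + \<omega>2) Xs = d_wedge f \<omega>1 Xs + d_wedge f \<omega>2 Xs"
  by (simp add: d_wedge_def plus_fun_apply sec_scale_simps msign_add sum.distrib)

lemma d_wedge_uminus: "d_wedge f (- \<omega>) Xs = - d_wedge f \<omega> Xs"
  by (simp add: d_wedge_def uminus_apply sec_scale_simps msign_minus sum_negf)

lemma d_wedge_msign: "d_wedge f (msign i \<omega>) Xs = msign i (d_wedge f \<omega> Xs)"
  by (simp add: msign_def d_wedge_uminus)

lemma ext_cov_deriv_degree:
  assumes "\<And>Ys. Suc (length Ys) = length Xs \<Longrightarrow> \<omega> Ys = 0" "Xs \<in> lists VF"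
  shows "ext_cov_deriv D \<omega> Xs = 0"
  using assms by (simp add: ext_cov_deriv_def)

end

section \<open>Weil cochains\<close>

locale algebroid_connection = bundle_connection M V D
  for M :: "('m::{t2_space, second_countable_topology}) smooth_atlas"
    and V :: "('m, 'v::real_vector) vbundle" and D +
  fixes A :: "('m, 'a::real_vector) algebroid"
    and DA :: "('m \<Rightarrow> 'a) \<Rightarrow> ('m \<Rightarrow> 'v) \<Rightarrow> 'm \<Rightarrow> 'v"
  assumes algebroid: "lie_algebroid M A" and rep: "algebroid_rep M A V DA"
begin

abbreviation "\<Gamma>A \<equiv> sections M A"
abbreviation "\<rho> \<equiv> anchor_sec A"
abbreviation "br \<equiv> bracket A"

lemma vector_bundle_A: "vector_bundle M A"
  using algebroid by (simp add: lie_algebroid_def)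

lemmas A_sections_closed [simp] = sections_closed[OF manifold vector_bundle_A, simplified]

lemma anchor_sec_VF [simp]: "\<alpha> \<in> \<Gamma>A \<Longrightarrow> \<rho> \<alpha> \<in> VF"
  using algebroid by (simp add: lie_algebroid_def)

lemma bracket_section [simp]: "\<alpha> \<in> \<Gamma>A \<Longrightarrow> \<beta> \<in> \<Gamma>A \<Longrightarrow> br \<alpha> \<beta> \<in> \<Gamma>A"
  using algebroid unfolding lie_algebroid_def by blast

lemma bracket_swap: "\<alpha> \<in> \<Gamma>A \<Longrightarrow> \<beta> \<in> \<Gamma>A \<Longrightarrow> br \<beta> \<alpha> = - br \<alpha> \<beta>"
  using algebroid unfolding lie_algebroid_def by blast

context
  fixes p q and c :: "('m, 'a, 'v) cochain"
  assumes c: "c \<in> weil_cochains M A V p q"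
begin

abbreviation "in_range k \<alpha>s \<beta>s \<equiv> k \<le> p \<and> k \<le> q \<and> \<alpha>s \<in> tuples \<Gamma>A (p - k) \<and> \<beta>s \<in> tuples \<Gamma>A k"

text \<open>
  Because cochains vanish on lists of wrong length, their defining properties hold for lists
  of any length. This is what makes the degrees p and q disappear from the following computations.
\<close>

lemmas cochain_conjuncts = c[unfolded weil_cochains_def mem_Collect_eq]

lemma cochain_conditions:
  assumes "k \<le> p"
  shows "\<beta>s \<in> tuples \<Gamma>A k \<Longrightarrow> alternating_on \<Gamma>A (p - k) (\<lambda>\<alpha>s. c k \<alpha>s \<beta>s)"
    and "\<beta>s \<in> tuples \<Gamma>A k \<Longrightarrow> multilinear_on (range (\<lambda>r _. r)) (\<cdot>\<^sub>s) \<Gamma>A (p - k) (\<lambda>\<alpha>s. c k \<alpha>s \<beta>s Xs)"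
    and "\<alpha>s \<in> tuples \<Gamma>A (p - k) \<Longrightarrow> symmetric_on \<Gamma>A k (c k \<alpha>s)"
    and "\<alpha>s \<in> tuples \<Gamma>A (p - k) \<Longrightarrow> multilinear_on (smooth_functions M) (\<cdot>\<^sub>s) \<Gamma>A k (\<lambda>\<beta>s. c k \<alpha>s \<beta>s Xs)"
  using cochain_conjuncts[THEN conjunct2, THEN conjunct1, THEN spec, THEN mp, OF assms] by blast+

lemma cochain_values:
  "if in_range k \<alpha>s \<beta>s then c k \<alpha>s \<beta>s \<in> forms M V (q - k) else c k \<alpha>s \<beta>s = 0"
  using cochain_conjuncts[THEN conjunct1] by (elim allE)

lemma cochain_outside: "\<not> in_range k \<alpha>s \<beta>s \<Longrightarrow> c k \<alpha>s \<beta>s = 0"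
  using cochain_values[of k \<alpha>s \<beta>s] by (simp only: if_False)

lemma cochain_form: "in_range k \<alpha>s \<beta>s \<Longrightarrow> c k \<alpha>s \<beta>s \<in> forms M V (q - k)"
  using cochain_values[of k \<alpha>s \<beta>s] by (simp only: if_True)

lemma cochain_mixed_form [simp]: "c k \<alpha>s \<beta>s \<in> \<Omega>"
  using cochain_outside cochain_form
  by (cases "in_range k \<alpha>s \<beta>s") (auto simp: forms_iff_mixed_forms)

lemma cochain_alternating: "multi_alternating \<Gamma>A (c k)"
proof -
  have "c k (us @ (x + y) # vs) = c k (us @ x # vs) + c k (us @ y # vs)"
    if "us \<in> lists \<Gamma>A" "vs \<in> lists \<Gamma>A" "x \<in> \<Gamma>A" "y \<in> \<Gamma>A" for us vs x y
  proof (rule ext)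
    fix \<beta>s
    show "c k (us @ (x + y) # vs) \<beta>s = (c k (us @ x # vs) + c k (us @ y # vs)) \<beta>s"
    proof (cases "k \<le> p \<and> \<beta>s \<in> tuples \<Gamma>A k \<and> length us + 1 + length vs = p - k")
      case True
      then have "c k (us @ (x + y) # vs) \<beta>s Xs = c k (us @ x # vs) \<beta>s Xs + c k (us @ y # vs) \<beta>s Xs" for Xs
        using cochain_conditions(2)[of k \<beta>s Xs] that unfolding multilinear_on_def lists_eq_set by blast
      then show ?thesis
        by (simp add: fun_eq_iff plus_fun_apply)
    next
      case False
      then have "c k (us @ z # vs) \<beta>s = 0" for z
        by (intro cochain_outside) (auto simp: tuples_def)
      then show ?thesis
        by (simp add: plus_fun_apply)
    qed
  qed
  moreover have "c k (us @ x # x # vs) = 0"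
    if "us \<in> lists \<Gamma>A" "vs \<in> lists \<Gamma>A" "x \<in> \<Gamma>A" for us vs x
  proof
    fix \<beta>s
    show "c k (us @ x # x # vs) \<beta>s = 0 \<beta>s"
    proof (cases "in_range k (us @ x # x # vs) \<beta>s")
      case True
      then show ?thesis
        using cochain_conditions(1)[of k \<beta>s] unfolding alternating_on_def by (auto simp: zero_fun_apply)
    qed (simp add: cochain_outside zero_fun_apply)
  qed
  ultimately show ?thesis
    unfolding multi_alternating_def by blast
qed

lemma cochain_symmetric: "mset \<beta>s = mset \<beta>s' \<Longrightarrow> c k \<alpha>s \<beta>s = c k \<alpha>s \<beta>s'"
proof -
  assume eq: "mset \<beta>s = mset \<beta>s'"
  have tuples: "\<beta>s \<in> tuples \<Gamma>A k \<longleftrightarrow> \<beta>s' \<in> tuples \<Gamma>A k"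
    using mset_eq_setD[OF eq] mset_eq_length[OF eq] by (simp add: tuples_def)
  show ?thesis
  proof (cases "in_range k \<alpha>s \<beta>s")
    case True
    then have "symmetric_on \<Gamma>A k (c k \<alpha>s)"
      by (intro cochain_conditions) simp_all
    then show ?thesis
      using True tuples eq unfolding symmetric_on_def by blast
  next
    case False
    then have "c k \<alpha>s \<beta>s' = 0"
      using tuples by (intro cochain_outside) blast
    with cochain_outside[OF False] show ?thesis
      by simp
  qed
qed

lemma cochain_sym_linear:
  assumes "us \<in> lists \<Gamma>A" "vs \<in> lists \<Gamma>A" "x \<in> \<Gamma>A"
  shows "y \<in> \<Gamma>A \<Longrightarrow> c k \<alpha>s (us @ (x + y) # vs) = c k \<alpha>s (us @ x # vs) + c k \<alpha>s (us @ y # vs)"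
    and "f \<in> smooth_functions M \<Longrightarrow> c k \<alpha>s (us @ (f \<cdot>\<^sub>s x) # vs) Xs = f \<cdot>\<^sub>s c k \<alpha>s (us @ x # vs) Xs"
proof -
  have outside: "c k \<alpha>s (us @ z # vs) = 0"
    if "\<not> (k \<le> p \<and> \<alpha>s \<in> tuples \<Gamma>A (p - k) \<and> length us + 1 + length vs = k)" for z
    using that by (intro cochain_outside) (auto simp: tuples_def)
  show "c k \<alpha>s (us @ (x + y) # vs) = c k \<alpha>s (us @ x # vs) + c k \<alpha>s (us @ y # vs)" if "y \<in> \<Gamma>A"
  proof (cases "k \<le> p \<and> \<alpha>s \<in> tuples \<Gamma>A (p - k) \<and> length us + 1 + length vs = k")
    case True
    then have "c k \<alpha>s (us @ (x + y) # vs) Xs = c k \<alpha>s (us @ x # vs) Xs + c k \<alpha>s (us @ y # vs) Xs" for Xs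
      using cochain_conditions(4)[of k \<alpha>s Xs] assms that unfolding multilinear_on_def lists_eq_set by blast
    then show ?thesis
      by (simp add: fun_eq_iff plus_fun_apply)
  next
    case False
    then show ?thesis
      by (simp only: outside[OF False] add_0)
  qed
  show "c k \<alpha>s (us @ (f \<cdot>\<^sub>s x) # vs) Xs = f \<cdot>\<^sub>s c k \<alpha>s (us @ x # vs) Xs" if "f \<in> smooth_functions M"
  proof (cases "k \<le> p \<and> \<alpha>s \<in> tuples \<Gamma>A (p - k) \<and> length us + 1 + length vs = k")
    case True
    then show ?thesis
      using cochain_conditions(4)[of k \<alpha>s Xs] assms that unfolding multilinear_on_def lists_eq_set by blast
  next
    case False
    then show ?thesis
      by (simp only: outside[OF False] zero_fun_apply sec_scale_simps)
  qed
qed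

lemma cochain_leibniz:
  assumes "\<alpha> \<in> \<Gamma>A" "f \<in> smooth_functions M" "Xs \<in> lists VF"
  shows "c k (f \<cdot>\<^sub>s \<alpha> # \<alpha>s) \<beta>s Xs = f \<cdot>\<^sub>s c k (\<alpha> # \<alpha>s) \<beta>s Xs + d_wedge f (c (Suc k) \<alpha>s (\<alpha> # \<beta>s)) Xs"
proof (cases "k < p \<and> \<alpha>s \<in> tuples \<Gamma>A (p - k - 1) \<and> \<beta>s \<in> tuples \<Gamma>A k")
  case True
  then show ?thesis
    using cochain_conjuncts[THEN conjunct2, THEN conjunct2] assms by blast
next
  case False
  have "c k (\<gamma> # \<alpha>s) \<beta>s = 0" for \<gamma>
    using False by (intro cochain_outside) (auto simp: tuples_def)
  moreover have "c (Suc k) \<alpha>s (\<alpha> # \<beta>s) = 0"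
    using False by (intro cochain_outside) (auto simp: tuples_def)
  ultimately show ?thesis
    using d_wedge_zero[of 0] assms by (simp add: zero_fun_apply sec_scale_simps)
qed

end

lemma mem_tuples_iff: "xs \<in> tuples C n \<longleftrightarrow> xs \<in> lists C \<and> length xs = n"
  by (auto simp: tuples_def lists_eq_set)

text \<open>
  The part of the exterior covariant derivative of a Weil cochain that moves a symmetric argument to
  the alternating ones. For k = 0 the sum is empty, so the truncated difference does no harm.
\<close>

definition sym_shift :: "('m, 'a, 'v) cochain \<Rightarrow> nat \<Rightarrow> ('m \<Rightarrow> 'a) list \<Rightarrow> ('m \<Rightarrow> 'a) list \<Rightarrow> ('m, 'v) vform" where
  "sym_shift c k \<alpha>s \<beta>s = (\<Sum>i < length \<beta>s. c (k - 1) (\<beta>s ! i # \<alpha>s) (omit i \<beta>s))"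

lemma weil_ext_cov_deriv_eq:
  assumes "\<alpha>s \<in> lists \<Gamma>A" "\<beta>s \<in> tuples \<Gamma>A k" "Xs \<in> lists VF"
  shows "weil_ext_cov_deriv M A D c k \<alpha>s \<beta>s Xs =
    msign k (ext_cov_deriv D (c k \<alpha>s \<beta>s) Xs - sym_shift c k \<alpha>s \<beta>s Xs)"
  using assms by (auto simp: weil_ext_cov_deriv_def weil_domain_def sym_shift_def sum_fun_apply tuples_def)

end

section \<open>Commutation with the simplicial differential\<close>

context algebroid_connection
begin

context
  assumes inv: "A_invariant M A V DA D"
begin

lemma inv_DA: "\<alpha> \<in> \<Gamma>A \<Longrightarrow> s \<in> \<Gamma>V \<Longrightarrow> DA \<alpha> s = D (\<rho> \<alpha>) s"
  using inv unfolding A_invariant_def by blast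

lemma inv_flat: "\<alpha> \<in> \<Gamma>A \<Longrightarrow> X \<in> VF \<Longrightarrow> s \<in> \<Gamma>V \<Longrightarrow> curvature D (\<rho> \<alpha>) X s = 0"
  using inv unfolding A_invariant_def by blast

text \<open>
  The first condition of invariance identifies the Lie derivative along a section of A with the one
  along its anchor, up to the action on the symmetric arguments.
\<close>

lemma lie_deriv_eq:
  assumes "\<alpha> \<in> \<Gamma>A" "\<gamma> \<beta>s \<in> \<Omega>" "Xs \<in> lists VF"
  shows "lie_deriv A DA \<alpha> \<gamma> \<beta>s Xs =
    lie_cov D (\<rho> \<alpha>) (\<gamma> \<beta>s) Xs - (\<Sum>i < length \<beta>s. \<gamma> (\<beta>s[i := br \<alpha> (\<beta>s ! i)]) Xs)"
  using assms by (simp add: lie_deriv_def lie_cov_def inv_DA mixed_formsD(1))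

lemma lie_deriv_mixed_form:
  assumes "\<alpha> \<in> \<Gamma>A" "\<And>\<beta>s. \<gamma> \<beta>s \<in> \<Omega>"
  shows "lie_deriv A DA \<alpha> \<gamma> \<beta>s \<in> \<Omega>"
  by (rule mixed_forms_cong[of
        "lie_cov D (\<rho> \<alpha>) (\<gamma> \<beta>s) - (\<Sum>i < length \<beta>s. \<gamma> (\<beta>s[i := br \<alpha> (\<beta>s ! i)]))"])
    (use assms in \<open>simp_all add: lie_deriv_eq minus_apply sum_fun_apply\<close>)

text \<open>
  This is what the second condition of invariance is for: the anchor of a section of A lies in the
  kernel of the curvature.
\<close>

lemma lie_deriv_ext_cov_deriv:
  assumes "\<alpha> \<in> \<Gamma>A" "\<And>\<beta>s. \<gamma> \<beta>s \<in> \<Omega>" "Xs \<in> lists VF"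
  shows "lie_deriv A DA \<alpha> (\<lambda>\<beta>s. ext_cov_deriv D (\<gamma> \<beta>s)) \<beta>s Xs = ext_cov_deriv D (lie_deriv A DA \<alpha> \<gamma> \<beta>s) Xs"
proof -
  have "ext_cov_deriv D (lie_deriv A DA \<alpha> \<gamma> \<beta>s) Xs = ext_cov_deriv D
      (lie_cov D (\<rho> \<alpha>) (\<gamma> \<beta>s) - (\<Sum>i < length \<beta>s. \<gamma> (\<beta>s[i := br \<alpha> (\<beta>s ! i)]))) Xs"
    using assms by (intro ext_cov_deriv_cong) (simp_all add: lie_deriv_eq minus_apply sum_fun_apply)
  then show ?thesis
    using assms lie_cov_ext_cov_deriv_commute[of "\<rho> \<alpha>" "\<gamma> \<beta>s" Xs] inv_flat[of \<alpha>]
    by (simp add: lie_deriv_eq ext_cov_deriv_minus ext_cov_deriv_sum)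
qed

text \<open>
  The part of the simplicial differential that preserves the index k.
\<close>

abbreviation "CE \<equiv> ce_diff (lie_deriv A DA) br"

lemma CE_apply:
  "CE F \<alpha>s \<beta>s = (\<Sum>i < length \<alpha>s. msign i (lie_deriv A DA (\<alpha>s ! i) (F (omit i \<alpha>s)) \<beta>s)) +
     (\<Sum>j < length \<alpha>s. \<Sum>i < j. msign (i + j) (F (br (\<alpha>s ! i) (\<alpha>s ! j) # omit i (omit j \<alpha>s)) \<beta>s))"
  by (simp add: ce_diff_def plus_fun_apply sum_fun_apply msign_apply)

lemma CE_mixed_form:
  assumes "\<alpha>s \<in> lists \<Gamma>A" "\<And>\<alpha>s \<beta>s. F \<alpha>s \<beta>s \<in> \<Omega>"
  shows "CE F \<alpha>s \<beta>s \<in> \<Omega>"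
  unfolding CE_apply using assms
  by (intro mixed_forms_plus_closed mixed_forms_sum_closed mixed_forms_msign_closed lie_deriv_mixed_form) auto

lemma CE_ext_cov_deriv:
  assumes "\<alpha>s \<in> lists \<Gamma>A" "\<And>\<alpha>s \<beta>s. F \<alpha>s \<beta>s \<in> \<Omega>" "Xs \<in> lists VF"
  shows "CE (\<lambda>\<alpha>s \<beta>s. ext_cov_deriv D (F \<alpha>s \<beta>s)) \<alpha>s \<beta>s Xs = ext_cov_deriv D (CE F \<alpha>s \<beta>s) Xs"
proof -
  have L: "lie_deriv A DA (\<alpha>s ! i) (F (omit i \<alpha>s)) \<beta>s \<in> \<Omega>" if "i < length \<alpha>s" for i
    using assms that by (intro lie_deriv_mixed_form) simp_all
  have "(\<Sum>i < length \<alpha>s. msign i (lie_deriv A DA (\<alpha>s ! i) (F (omit i \<alpha>s)) \<beta>s)) \<in> \<Omega>"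
    "(\<Sum>j < length \<alpha>s. \<Sum>i < j. msign (i + j) (F (br (\<alpha>s ! i) (\<alpha>s ! j) # omit i (omit j \<alpha>s)) \<beta>s)) \<in> \<Omega>"
    using L assms(2) by (intro mixed_forms_sum_closed mixed_forms_msign_closed; simp)+
  from ext_cov_deriv_plus[OF this \<open>Xs \<in> lists VF\<close>]
  have "ext_cov_deriv D (CE F \<alpha>s \<beta>s) Xs =
      ext_cov_deriv D (\<Sum>i < length \<alpha>s. msign i (lie_deriv A DA (\<alpha>s ! i) (F (omit i \<alpha>s)) \<beta>s)) Xs +
      ext_cov_deriv D (\<Sum>j < length \<alpha>s. \<Sum>i < j. msign (i + j)
        (F (br (\<alpha>s ! i) (\<alpha>s ! j) # omit i (omit j \<alpha>s)) \<beta>s)) Xs"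
    by (simp only: CE_apply)
  moreover have "ext_cov_deriv D (\<Sum>i < length \<alpha>s. msign i (lie_deriv A DA (\<alpha>s ! i) (F (omit i \<alpha>s)) \<beta>s)) Xs =
      (\<Sum>i < length \<alpha>s. msign i (ext_cov_deriv D (lie_deriv A DA (\<alpha>s ! i) (F (omit i \<alpha>s)) \<beta>s) Xs))"
    using L assms(3) by (subst ext_cov_deriv_sum) (auto simp: ext_cov_deriv_msign)
  moreover have "ext_cov_deriv D (\<Sum>j < length \<alpha>s. \<Sum>i < j. msign (i + j)
        (F (br (\<alpha>s ! i) (\<alpha>s ! j) # omit i (omit j \<alpha>s)) \<beta>s)) Xs =
      (\<Sum>j < length \<alpha>s. \<Sum>i < j. msign (i + j)
        (ext_cov_deriv D (F (br (\<alpha>s ! i) (\<alpha>s ! j) # omit i (omit j \<alpha>s)) \<beta>s) Xs))"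
    using assms(2,3) by (simp add: ext_cov_deriv_sum ext_cov_deriv_msign)
  moreover have "lie_deriv A DA (\<alpha>s ! i) (\<lambda>\<beta>s. ext_cov_deriv D (F (omit i \<alpha>s) \<beta>s)) \<beta>s Xs =
      ext_cov_deriv D (lie_deriv A DA (\<alpha>s ! i) (F (omit i \<alpha>s)) \<beta>s) Xs" if "i < length \<alpha>s" for i
    using assms that by (intro lie_deriv_ext_cov_deriv) simp_all
  ultimately show ?thesis
    by (simp add: CE_apply plus_fun_apply sum_fun_apply msign_apply)
qed

text \<open>
  CE is applied to cochains that are given by a formula only on lists of sections and vector fields
  of the right lengths. The value of CE on such lists depends on nothing else.
\<close>

lemma CE_msign_diff:
  assumes \<alpha>s: "\<alpha>s \<in> lists \<Gamma>A" and \<beta>s: "\<beta>s \<in> tuples \<Gamma>A k" and Xs: "Xs \<in> lists VF"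
    and F: "\<And>\<alpha>s \<beta>s Xs. \<alpha>s \<in> lists \<Gamma>A \<Longrightarrow> \<beta>s \<in> tuples \<Gamma>A k \<Longrightarrow> Xs \<in> lists VF \<Longrightarrow>
      F \<alpha>s \<beta>s Xs = msign k (G \<alpha>s \<beta>s Xs - H \<alpha>s \<beta>s Xs)"
    and G: "\<And>\<alpha>s \<beta>s. G \<alpha>s \<beta>s \<in> \<Omega>" and H: "\<And>\<alpha>s \<beta>s. H \<alpha>s \<beta>s \<in> \<Omega>"
  shows "CE F \<alpha>s \<beta>s Xs = msign k (CE G \<alpha>s \<beta>s Xs - CE H \<alpha>s \<beta>s Xs)"
proof -
  have upd: "\<beta>s[i := br \<alpha> (\<beta>s ! i)] \<in> tuples \<Gamma>A k" if "i < length \<beta>s" "\<alpha> \<in> \<Gamma>A" for i \<alpha>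
    using \<beta>s that by (simp add: mem_tuples_iff)
  have Xupd: "Xs[i := vf_bracket (\<rho> \<alpha>) (Xs ! i)] \<in> lists VF" if "i < length Xs" "\<alpha> \<in> \<Gamma>A" for i \<alpha>
    using Xs that by simp
  have D: "DA \<alpha> (F \<alpha>s \<beta>s Xs) = msign k (DA \<alpha> (G \<alpha>s \<beta>s Xs) - DA \<alpha> (H \<alpha>s \<beta>s Xs))"
    if "\<alpha> \<in> \<Gamma>A" "\<alpha>s \<in> lists \<Gamma>A" for \<alpha> \<alpha>s
    using that F[OF that(2) \<beta>s Xs] G[of \<alpha>s \<beta>s] H[of \<alpha>s \<beta>s] Xs
    by (simp add: msign_def inv_DA mixed_formsD(1) D_minus D_diff)
  have L: "lie_deriv A DA \<alpha> (F \<alpha>s) \<beta>s Xs =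
      msign k (lie_deriv A DA \<alpha> (G \<alpha>s) \<beta>s Xs - lie_deriv A DA \<alpha> (H \<alpha>s) \<beta>s Xs)"
    if "\<alpha> \<in> \<Gamma>A" "\<alpha>s \<in> lists \<Gamma>A" for \<alpha> \<alpha>s
    using that \<beta>s Xs unfolding lie_deriv_def D[OF that]
    by (simp add: F upd Xupd msign_diff sum_subtractf msign_sum)
  show ?thesis
    using \<alpha>s \<beta>s Xs unfolding CE_apply
    by (simp add: L F plus_fun_apply sum_fun_apply msign_apply msign_diff sum_subtractf msign_add msign_sum
        msign_msign_commute[of k])
qed

context
  fixes p q and c :: "('m, 'a, 'v) cochain"
  assumes c: "c \<in> weil_cochains M A V p q"
begin

lemmas c_mixed [simp] = cochain_mixed_form[OF c]

lemma sym_shift_mixed [simp]: "sym_shift c k \<alpha>s \<beta>s \<in> \<Omega>"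
  by (simp add: sym_shift_def)

text \<open>
  On the left the Lie derivative also acts on the entry \<open>\<beta>\<^sub>i\<close> that is moved to the alternating arguments.
  On the right it does not see this entry, which is the reason for the correction.
\<close>

lemma lie_deriv_sym_shift:
  assumes \<alpha>: "\<alpha> \<in> \<Gamma>A" and \<beta>s: "\<beta>s \<in> lists \<Gamma>A" and Xs: "Xs \<in> lists VF"
  shows "lie_deriv A DA \<alpha> (sym_shift c k \<alpha>s) \<beta>s Xs =
    (\<Sum>i < length \<beta>s. lie_deriv A DA \<alpha> (c (k - 1) (\<beta>s ! i # \<alpha>s)) (omit i \<beta>s) Xs
      - c (k - 1) (br \<alpha> (\<beta>s ! i) # \<alpha>s) (omit i \<beta>s) Xs)"
proof -
  let ?c = "c (k - 1)"
  let ?upd = "\<lambda>l. \<beta>s[l := br \<alpha> (\<beta>s ! l)]"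
  have "(\<Sum>l < length \<beta>s. sym_shift c k \<alpha>s (?upd l) Xs) =
      (\<Sum>i < length \<beta>s. \<Sum>l < length \<beta>s. ?c (?upd l ! i # \<alpha>s) (omit i (?upd l)) Xs)"
    unfolding sym_shift_def by (subst sum.swap) (simp add: sum_fun_apply)
  also have "\<dots> = (\<Sum>i < length \<beta>s. ?c (br \<alpha> (\<beta>s ! i) # \<alpha>s) (omit i \<beta>s) Xs +
      (\<Sum>l < length (omit i \<beta>s). ?c (\<beta>s ! i # \<alpha>s) ((omit i \<beta>s)[l := br \<alpha> (omit i \<beta>s ! l)]) Xs))"
  proof (intro sum.cong refl)
    fix i assume "i \<in> {..<length \<beta>s}"
    then have i: "i < length \<beta>s"
      by simp
    show "(\<Sum>l < length \<beta>s. ?c (?upd l ! i # \<alpha>s) (omit i (?upd l)) Xs) =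
        ?c (br \<alpha> (\<beta>s ! i) # \<alpha>s) (omit i \<beta>s) Xs +
        (\<Sum>l < length (omit i \<beta>s). ?c (\<beta>s ! i # \<alpha>s) ((omit i \<beta>s)[l := br \<alpha> (omit i \<beta>s ! l)]) Xs)"
      unfolding sum_omit_update[OF i, where G = "\<lambda>\<beta>s'. ?c (\<beta>s ! i # \<alpha>s) \<beta>s' Xs"]
      using i by (subst sum_split_at[OF i]) (simp add: omit_update_same cong: if_cong)
  qed
  finally show ?thesis
    using assms unfolding lie_deriv_eq[of \<alpha> "sym_shift c k \<alpha>s" \<beta>s, OF \<alpha> sym_shift_mixed Xs]
    by (simp add: sym_shift_def lie_cov_sum lie_deriv_eq sum.distrib sum_subtractf algebra_simps del: length_omit)
qed

lemma CE_sym_shift: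
  assumes \<alpha>s: "\<alpha>s \<in> lists \<Gamma>A" and \<beta>s: "\<beta>s \<in> lists \<Gamma>A" and Xs: "Xs \<in> lists VF"
  shows "CE (sym_shift c k) \<alpha>s \<beta>s Xs =
    (\<Sum>i < length \<beta>s. CE (\<lambda>\<alpha>s. c (k - 1) (\<beta>s ! i # \<alpha>s)) \<alpha>s (omit i \<beta>s) Xs
      - (\<Sum>a < length \<alpha>s. msign a (c (k - 1) (br (\<alpha>s ! a) (\<beta>s ! i) # omit a \<alpha>s) (omit i \<beta>s) Xs)))"
proof -
  have "(\<Sum>a < length \<alpha>s. msign a (lie_deriv A DA (\<alpha>s ! a) (sym_shift c k (omit a \<alpha>s)) \<beta>s Xs)) =
      (\<Sum>i < length \<beta>s. (\<Sum>a < length \<alpha>s. msign a (lie_deriv A DA (\<alpha>s ! a) (c (k - 1) (\<beta>s ! i # omit a \<alpha>s)) (omit i \<beta>s) Xs))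
        - (\<Sum>a < length \<alpha>s. msign a (c (k - 1) (br (\<alpha>s ! a) (\<beta>s ! i) # omit a \<alpha>s) (omit i \<beta>s) Xs)))"
    using \<alpha>s \<beta>s Xs
    by (simp add: lie_deriv_sym_shift msign_sum) (subst sum.swap, simp add: msign_diff sum_subtractf)
  moreover have "(\<Sum>b < length \<alpha>s. \<Sum>a < b. msign (a + b)
        (sym_shift c k (br (\<alpha>s ! a) (\<alpha>s ! b) # omit a (omit b \<alpha>s)) \<beta>s Xs)) =
      (\<Sum>i < length \<beta>s. \<Sum>b < length \<alpha>s. \<Sum>a < b. msign (a + b)
        (c (k - 1) (\<beta>s ! i # br (\<alpha>s ! a) (\<alpha>s ! b) # omit a (omit b \<alpha>s)) (omit i \<beta>s) Xs))"
    unfolding sym_shift_def sum_fun_apply[where x = Xs] msign_sum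
    by (rule trans[OF sum.cong[OF refl sum.swap] sum.swap])
  ultimately show ?thesis
    by (simp add: CE_apply plus_fun_apply sum_fun_apply msign_apply sum.distrib sum_subtractf)
qed

text \<open>
  The summands cancel in pairs: exchanging the two chosen entries changes the sign of their bracket,
  while the position of the bracket is irrelevant in a symmetric argument.
\<close>

lemma sum_bracket_symmetric_eq_zero:
  assumes \<beta>s: "\<beta>s \<in> lists \<Gamma>A"
  shows "(\<Sum>i < length \<beta>s. \<Sum>l < length (omit i \<beta>s).
    c k \<alpha>s ((omit i \<beta>s)[l := br (\<beta>s ! i) (omit i \<beta>s ! l)]) Xs) = 0"
proof -
  let ?T = "\<lambda>i l. if l = i then 0 else c k \<alpha>s (omit i (\<beta>s[l := br (\<beta>s ! i) (\<beta>s ! l)])) Xs"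
  have neg: "c k \<alpha>s (us @ (- x) # vs) = - c k \<alpha>s (us @ x # vs)"
    if "us \<in> lists \<Gamma>A" "vs \<in> lists \<Gamma>A" "x \<in> \<Gamma>A" for us vs x
    using cochain_sym_linear(1)[OF c that(1,2), of x "- x" k \<alpha>s]
      cochain_sym_linear(1)[OF c that(1,2), of 0 0 k \<alpha>s] that
    by (simp add: eq_neg_iff_add_eq_0 add.commute)
  have anti: "?T i l = - ?T l i" if "i < length \<beta>s" "l < length \<beta>s" for i l
  proof (cases "l = i")
    case False
    let ?l = "if l < i then l else l - 1"
    have l: "?l < length (omit i \<beta>s)"
      using False that by auto
    have neg_upd: "c k \<alpha>s (omit i (\<beta>s[l := - x])) = - c k \<alpha>s (omit i (\<beta>s[l := x]))" if x: "x \<in> \<Gamma>A" for x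
    proof -
      have "take ?l (omit i \<beta>s) \<in> lists \<Gamma>A" "drop (Suc ?l) (omit i \<beta>s) \<in> lists \<Gamma>A"
        using omit_in_lists[OF \<beta>s, of i] by (auto simp: lists_eq_set dest: in_set_takeD in_set_dropD)
      from neg[OF this x] show ?thesis
        unfolding omit_update_other[OF False \<open>i < length \<beta>s\<close>] upd_conv_take_nth_drop[OF l] by simp
    qed
    have "c k \<alpha>s (omit i (\<beta>s[l := br (\<beta>s ! i) (\<beta>s ! l)])) = - c k \<alpha>s (omit i (\<beta>s[l := br (\<beta>s ! l) (\<beta>s ! i)]))"
      using that \<beta>s neg_upd[of "br (\<beta>s ! l) (\<beta>s ! i)"]
      unfolding bracket_swap[of "\<beta>s ! l" "\<beta>s ! i", OF nth_in_lists nth_in_lists, OF \<beta>s that(2) \<beta>s that(1)]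
      by simp
    also have "\<dots> = - c k \<alpha>s (omit l (\<beta>s[i := br (\<beta>s ! l) (\<beta>s ! i)]))"
      by (simp only: cochain_symmetric[OF c mset_omit_update[OF that False[symmetric]]])
    finally show ?thesis
      using False by (simp add: uminus_apply)
  qed simp
  have "(\<Sum>i < length \<beta>s. \<Sum>l < length (omit i \<beta>s).
      c k \<alpha>s ((omit i \<beta>s)[l := br (\<beta>s ! i) (omit i \<beta>s ! l)]) Xs) = (\<Sum>i < length \<beta>s. \<Sum>l < length \<beta>s. ?T i l)"
    by (intro sum.cong refl sum_omit_update[where G = "\<lambda>\<beta>s'. c k \<alpha>s \<beta>s' Xs"]) simp
  also have "\<dots> = 0"
  proof (rule zero_if_self_uminus)
    have "(\<Sum>i < length \<beta>s. \<Sum>l < length \<beta>s. ?T i l) = (\<Sum>i < length \<beta>s. \<Sum>l < length \<beta>s. - ?T l i)"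
      by (intro sum.cong refl anti) simp_all
    also have "\<dots> = - (\<Sum>i < length \<beta>s. \<Sum>l < length \<beta>s. ?T i l)"
      unfolding sum_negf by (subst sum.swap) (rule refl)
    finally show "(\<Sum>i < length \<beta>s. \<Sum>l < length \<beta>s. ?T i l) = - (\<Sum>i < length \<beta>s. \<Sum>l < length \<beta>s. ?T i l)" .
  qed
  finally show ?thesis .
qed

text \<open>
  Cartan's formula for the Chevalley--Eilenberg differential, \<open>ce_diff_Cons\<close>, for each \<open>\<beta>\<^sub>i\<close>, where the
  corrections from \<open>CE_sym_shift\<close> cancel the brackets of \<open>\<beta>\<^sub>i\<close> with the alternating arguments. The Lie
  derivative that results still acts on the other \<open>\<beta>\<close>, but these terms add up to 0.
\<close>

lemma CE_cartan_sum:
  assumes \<alpha>s: "\<alpha>s \<in> lists \<Gamma>A" and \<beta>s: "\<beta>s \<in> lists \<Gamma>A" and Xs: "Xs \<in> lists VF"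
  shows "(\<Sum>i < length \<beta>s. CE (c (k - 1)) (\<beta>s ! i # \<alpha>s) (omit i \<beta>s) Xs) + CE (sym_shift c k) \<alpha>s \<beta>s Xs =
    (\<Sum>i < length \<beta>s. lie_cov D (\<rho> (\<beta>s ! i)) (c (k - 1) \<alpha>s (omit i \<beta>s)) Xs)"
proof -
  let ?c = "c (k - 1)"
  have swap: "?c (br (\<alpha>s ! a) (\<beta>s ! i) # omit a \<alpha>s) = - ?c (br (\<beta>s ! i) (\<alpha>s ! a) # omit a \<alpha>s)"
    if "i < length \<beta>s" "a < length \<alpha>s" for i a
    using that \<alpha>s \<beta>s bracket_swap[of "\<beta>s ! i" "\<alpha>s ! a"]
    by (simp add: multi_alternating_uminus[OF cochain_alternating[OF c]])
  have "CE ?c (\<beta>s ! i # \<alpha>s) (omit i \<beta>s) Xs + (CE (\<lambda>\<alpha>s. ?c (\<beta>s ! i # \<alpha>s)) \<alpha>s (omit i \<beta>s) Xs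
      - (\<Sum>a < length \<alpha>s. msign a (?c (br (\<alpha>s ! a) (\<beta>s ! i) # omit a \<alpha>s) (omit i \<beta>s) Xs)))
      = lie_cov D (\<rho> (\<beta>s ! i)) (?c \<alpha>s (omit i \<beta>s)) Xs
        - (\<Sum>l < length (omit i \<beta>s). ?c \<alpha>s ((omit i \<beta>s)[l := br (\<beta>s ! i) (omit i \<beta>s ! l)]) Xs)"
    if i: "i < length \<beta>s" for i
  proof -
    have "CE ?c (\<beta>s ! i # \<alpha>s) = lie_deriv A DA (\<beta>s ! i) (?c \<alpha>s) -
        (\<Sum>j < length \<alpha>s. msign j (?c (br (\<beta>s ! i) (\<alpha>s ! j) # omit j \<alpha>s))) -
        CE (\<lambda>\<alpha>s. ?c (\<beta>s ! i # \<alpha>s)) \<alpha>s"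
      using \<alpha>s \<beta>s i by (intro ce_diff_Cons[OF cochain_alternating[OF c]]) simp_all
    then have "CE ?c (\<beta>s ! i # \<alpha>s) (omit i \<beta>s) Xs = lie_deriv A DA (\<beta>s ! i) (?c \<alpha>s) (omit i \<beta>s) Xs -
        (\<Sum>j < length \<alpha>s. msign j (?c (br (\<beta>s ! i) (\<alpha>s ! j) # omit j \<alpha>s) (omit i \<beta>s) Xs)) -
        CE (\<lambda>\<alpha>s. ?c (\<beta>s ! i # \<alpha>s)) \<alpha>s (omit i \<beta>s) Xs"
      by (simp add: minus_apply sum_fun_apply msign_apply)
    moreover have "(\<Sum>a < length \<alpha>s. msign a (?c (br (\<alpha>s ! a) (\<beta>s ! i) # omit a \<alpha>s) (omit i \<beta>s) Xs)) =
        - (\<Sum>a < length \<alpha>s. msign a (?c (br (\<beta>s ! i) (\<alpha>s ! a) # omit a \<alpha>s) (omit i \<beta>s) Xs))"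
      using swap[OF i] by (simp add: uminus_apply msign_minus sum_negf)
    ultimately show ?thesis
      using \<beta>s i Xs lie_deriv_eq[of "\<beta>s ! i" "?c \<alpha>s" "omit i \<beta>s" Xs] by simp
  qed
  then show ?thesis
    using sum_bracket_symmetric_eq_zero[OF \<beta>s, of "k - 1" \<alpha>s Xs]
    unfolding CE_sym_shift[OF assms] sum.distrib[symmetric] by (simp add: sum_subtractf)
qed

end

end

end

context algebroid_connection
begin

lemma weil_domain_iff:
  "weil_domain M A k \<alpha>s \<beta>s Xs \<longleftrightarrow>
    \<alpha>s \<in> lists \<Gamma>A \<and> \<beta>s \<in> lists \<Gamma>A \<and> length \<beta>s = k \<and> Xs \<in> lists VF"
  by (auto simp: weil_domain_def mem_tuples_iff)

lemma simplicial_diff_eq: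
  assumes "\<alpha>s \<in> lists \<Gamma>A" "\<beta>s \<in> tuples \<Gamma>A k" "Xs \<in> lists VF"
  shows "simplicial_diff M A DA c k \<alpha>s \<beta>s Xs =
    msign k (ce_diff (lie_deriv A DA) br (c k) \<alpha>s \<beta>s Xs -
      (\<Sum>j < k. contract (\<rho> (\<beta>s ! j)) (c (k - 1) \<alpha>s (omit j \<beta>s)) Xs))"
  using assms by (simp add: simplicial_diff_def weil_domain_def ce_diff_def
      plus_fun_apply sum_fun_apply msign_apply)

text \<open>
  Both sides are expanded into the same types of terms. Those of index k agree by
  \<open>CE_ext_cov_deriv\<close>, those of index k - 2 because the order in which two symmetric arguments are
  chosen does not matter, and those of index k - 1 agree by Cartan's formula on M and
  \<open>CE_cartan_sum\<close>.
\<close>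

lemma simplicial_diff_weil_ext_cov_deriv_commute:
  assumes inv: "A_invariant M A V DA D" and c: "c \<in> weil_cochains M A V p q"
  shows "simplicial_diff M A DA (weil_ext_cov_deriv M A D c) =
    weil_ext_cov_deriv M A D (simplicial_diff M A DA c)"
proof -
  note [simp] = cochain_mixed_form[OF c] sym_shift_mixed[OF inv c]
  let ?CE = "ce_diff (lie_deriv A DA) br"
  have "simplicial_diff M A DA (weil_ext_cov_deriv M A D c) k \<alpha>s \<beta>s Xs =
      weil_ext_cov_deriv M A D (simplicial_diff M A DA c) k \<alpha>s \<beta>s Xs" for k \<alpha>s \<beta>s Xs
  proof (cases "weil_domain M A k \<alpha>s \<beta>s Xs")
    case True
    then have \<alpha>s: "\<alpha>s \<in> lists \<Gamma>A" and \<beta>s: "\<beta>s \<in> lists \<Gamma>A" and k: "length \<beta>s = k" and Xs: "Xs \<in> lists VF"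
      by (simp_all add: weil_domain_iff)
    have \<beta>k: "\<beta>s \<in> tuples \<Gamma>A k"
      using \<beta>s k by (simp add: mem_tuples_iff)
    have omit: "omit j \<beta>s \<in> tuples \<Gamma>A (k - 1)" if "j < k" for j
      using \<beta>s k that by (simp add: mem_tuples_iff)
    have \<beta>: "\<beta>s ! j \<in> \<Gamma>A" if "j < k" for j
      using \<beta>s k that by simp
    \<comment> \<open>All terms of lower index occur in sums over j < k, where k - 1 is not truncated.\<close>
    have sign: "msign k (msign (k - Suc 0) s) = - s" if "0 < k" for s :: "'m \<Rightarrow> 'v"
      using that by (cases k) simp_all
    let ?P = "ext_cov_deriv D (?CE (c k) \<alpha>s \<beta>s) Xs"
    let ?Q = "?CE (sym_shift c k) \<alpha>s \<beta>s Xs"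
    let ?h = "\<lambda>a b r. c (k - 1 - 1) (b # \<alpha>s) r (\<rho> a # Xs)"
    let ?\<iota> = "\<lambda>j. contract (\<rho> (\<beta>s ! j)) (c (k - 1) \<alpha>s (omit j \<beta>s))"

    have "?CE (weil_ext_cov_deriv M A D c k) \<alpha>s \<beta>s Xs = msign k (?P - ?Q)"
      unfolding CE_ext_cov_deriv[OF inv \<alpha>s cochain_mixed_form[OF c] Xs, symmetric]
      by (rule CE_msign_diff[OF inv \<alpha>s \<beta>k Xs weil_ext_cov_deriv_eq]) simp_all
    moreover have "contract (\<rho> (\<beta>s ! j)) (weil_ext_cov_deriv M A D c (k - 1) \<alpha>s (omit j \<beta>s)) Xs =
        msign (k - 1) (lie_cov D (\<rho> (\<beta>s ! j)) (c (k - 1) \<alpha>s (omit j \<beta>s)) Xs - ext_cov_deriv D (?\<iota> j) Xs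
          - (\<Sum>i < length (omit j \<beta>s). ?h (\<beta>s ! j) (omit j \<beta>s ! i) (omit i (omit j \<beta>s))))" if "j < k" for j
      using \<beta>[OF that] Xs weil_ext_cov_deriv_eq[OF \<alpha>s omit[OF that], of "\<rho> (\<beta>s ! j) # Xs" c]
      unfolding contract_def[of _ "weil_ext_cov_deriv M A D c (k - 1) \<alpha>s (omit j \<beta>s)"]
      by (simp add: cartan_formula sym_shift_def sum_fun_apply del: length_omit)
    ultimately have left: "simplicial_diff M A DA (weil_ext_cov_deriv M A D c) k \<alpha>s \<beta>s Xs =
        ?P - ?Q + (\<Sum>j < k. lie_cov D (\<rho> (\<beta>s ! j)) (c (k - 1) \<alpha>s (omit j \<beta>s)) Xs - ext_cov_deriv D (?\<iota> j) Xs
          - (\<Sum>i < length (omit j \<beta>s). ?h (\<beta>s ! j) (omit j \<beta>s ! i) (omit i (omit j \<beta>s))))"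
      unfolding simplicial_diff_eq[OF \<alpha>s \<beta>k Xs]
      by (simp add: msign_diff msign_sum sign sum_negf sum_subtractf del: length_omit)

    have \<iota>: "?\<iota> j \<in> \<Omega>" if "j < k" for j
      using \<beta>[OF that] by simp
    have \<iota>_sum: "(\<Sum>j < k. ?\<iota> j) \<in> \<Omega>"
      "ext_cov_deriv D (\<Sum>j < k. ?\<iota> j) Xs = (\<Sum>j < k. ext_cov_deriv D (?\<iota> j) Xs)"
      by (rule mixed_forms_sum_closed ext_cov_deriv_sum; use \<iota> Xs in simp)+
    have "ext_cov_deriv D (simplicial_diff M A DA c k \<alpha>s \<beta>s) Xs =
        ext_cov_deriv D (msign k (?CE (c k) \<alpha>s \<beta>s - (\<Sum>j < k. ?\<iota> j))) Xs"
      using Xs by (intro ext_cov_deriv_cong)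
        (simp_all add: simplicial_diff_eq[OF \<alpha>s \<beta>k] msign_apply minus_apply sum_fun_apply)
    also have "\<dots> = msign k (?P - (\<Sum>j < k. ext_cov_deriv D (?\<iota> j) Xs))"
      unfolding \<iota>_sum(2)[symmetric] using Xs \<iota>_sum(1) CE_mixed_form[OF inv \<alpha>s, of "c k" \<beta>s]
      by (simp only: ext_cov_deriv_msign ext_cov_deriv_minus mixed_forms_minus_closed cochain_mixed_form[OF c])
    finally have 1: "ext_cov_deriv D (simplicial_diff M A DA c k \<alpha>s \<beta>s) Xs =
        msign k (?P - (\<Sum>j < k. ext_cov_deriv D (?\<iota> j) Xs))" .
    have 2: "simplicial_diff M A DA c (k - 1) (\<beta>s ! i # \<alpha>s) (omit i \<beta>s) Xs =
        msign (k - 1) (?CE (c (k - 1)) (\<beta>s ! i # \<alpha>s) (omit i \<beta>s) Xs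
          - (\<Sum>j < length (omit i \<beta>s). ?h (omit i \<beta>s ! j) (\<beta>s ! i) (omit j (omit i \<beta>s))))" if "i < k" for i
      using simplicial_diff_eq[OF _ omit[OF that] Xs, of "\<beta>s ! i # \<alpha>s" c] \<beta>[OF that] \<alpha>s that k
      by (simp add: contract_def)
    have right: "weil_ext_cov_deriv M A D (simplicial_diff M A DA c) k \<alpha>s \<beta>s Xs =
        ?P - (\<Sum>j < k. ext_cov_deriv D (?\<iota> j) Xs)
        + (\<Sum>i < k. ?CE (c (k - 1)) (\<beta>s ! i # \<alpha>s) (omit i \<beta>s) Xs
          - (\<Sum>j < length (omit i \<beta>s). ?h (omit i \<beta>s ! j) (\<beta>s ! i) (omit j (omit i \<beta>s))))"
      unfolding weil_ext_cov_deriv_eq[OF \<alpha>s \<beta>k Xs] 1 sym_shift_def sum_fun_apply[where x = Xs] k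
      by (simp add: 2[unfolded One_nat_def] msign_diff msign_sum sign sum_negf sum_subtractf del: length_omit)

    show ?thesis
      unfolding left right
      using CE_cartan_sum[OF inv c \<alpha>s \<beta>s Xs, of k] sum_omit_omit_commute[of ?h \<beta>s]
      unfolding k sum_subtractf by (simp add: algebra_simps del: length_omit)
  qed (simp add: simplicial_diff_def weil_ext_cov_deriv_def)
  then show ?thesis
    by (intro ext[where 'a = nat] ext[where 'a = "('m \<Rightarrow> 'a) list"] ext[where 'a = "'m vfield list"])
qed

text \<open>
  Conversely, a single section s, regarded as a Weil cochain of bidegree (0, 0), detects invariance:
  the component with index 1 of the commutation relation compares the two connections, the
  component with index 0 then is the curvature condition.
\<close>

definition section_cochain :: "('m \<Rightarrow> 'v) \<Rightarrow> ('m, 'a, 'v) cochain" where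
  "section_cochain s = (\<lambda>k \<alpha>s \<beta>s Xs. if k = 0 \<and> \<alpha>s = [] \<and> \<beta>s = [] \<and> Xs = [] then s else 0)"

lemma section_cochain_in_weil_cochains:
  assumes s: "s \<in> \<Gamma>V"
  shows "section_cochain s \<in> weil_cochains M A V 0 0"
proof -
  have "section_cochain s 0 [] [] \<in> forms M V 0"
    using s by (auto simp: section_cochain_def forms_def tuples_def multilinear_on_def alternating_on_def)
  moreover have "section_cochain s k \<alpha>s \<beta>s = 0" if "\<not> (k = 0 \<and> \<alpha>s = [] \<and> \<beta>s = [])" for k \<alpha>s \<beta>s
    using that by (auto simp: section_cochain_def fun_eq_iff zero_fun_apply)
  moreover have "k \<le> 0 \<and> k \<le> 0 \<and> \<alpha>s \<in> tuples \<Gamma>A (0 - k) \<and> \<beta>s \<in> tuples \<Gamma>A k \<longleftrightarrow> k = 0 \<and> \<alpha>s = [] \<and> \<beta>s = []"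
    for k \<alpha>s \<beta>s
    by (auto simp: tuples_def)
  ultimately have "\<forall>k \<alpha>s \<beta>s.
      if k \<le> 0 \<and> k \<le> 0 \<and> \<alpha>s \<in> tuples \<Gamma>A (0 - k) \<and> \<beta>s \<in> tuples \<Gamma>A k
      then section_cochain s k \<alpha>s \<beta>s \<in> forms M V (0 - k) else section_cochain s k \<alpha>s \<beta>s = 0"
    by simp
  then show ?thesis
    unfolding weil_cochains_def
    by (simp add: tuples_def multilinear_on_def alternating_on_def symmetric_on_def)
qed

lemma A_invariant_if_commute:
  assumes comm: "\<And>s. s \<in> \<Gamma>V \<Longrightarrow>
    simplicial_diff M A DA (weil_ext_cov_deriv M A D (section_cochain s)) =
    weil_ext_cov_deriv M A D (simplicial_diff M A DA (section_cochain s))"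
  shows "A_invariant M A V DA D"
proof -
  have conn: "DA \<beta> s = D (\<rho> \<beta>) s" if \<beta>: "\<beta> \<in> \<Gamma>A" and s: "s \<in> \<Gamma>V" for \<beta> s
    using fun_cong[OF fun_cong[OF fun_cong[OF fun_cong[OF comm[OF s]]]], of 1 "[]" "[\<beta>]" "[]"] \<beta> s
    by (simp add: simplicial_diff_def weil_ext_cov_deriv_def weil_domain_iff contract_def ext_cov_deriv_def
        lie_deriv_def section_cochain_def)
  have "curvature D (\<rho> \<alpha>) X s = 0" if \<alpha>: "\<alpha> \<in> \<Gamma>A" and X: "X \<in> VF" and s: "s \<in> \<Gamma>V" for \<alpha> X s
    using fun_cong[OF fun_cong[OF fun_cong[OF fun_cong[OF comm[OF s]]]], of 0 "[\<alpha>]" "[]" "[X]"] \<alpha> X s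
    by (simp add: simplicial_diff_def weil_ext_cov_deriv_def weil_domain_iff contract_def ext_cov_deriv_def
        lie_deriv_def section_cochain_def conn curvature_def algebra_simps)
  with conn show ?thesis
    unfolding A_invariant_def by blast
qed

end

section \<open>The exterior covariant derivative of a Weil cochain is a Weil cochain\<close>

context algebroid_connection
begin

context
  fixes p q and c :: "('m, 'a, 'v) cochain"
  assumes c: "c \<in> weil_cochains M A V p q"
begin

lemma cochain_degree:
  assumes "\<not> (length \<alpha>s + k = p \<and> length \<beta>s = k \<and> length Xs + k = q)"
  shows "c k \<alpha>s \<beta>s Xs = 0"
proof (cases "k \<le> p \<and> k \<le> q \<and> \<alpha>s \<in> tuples \<Gamma>A (p - k) \<and> \<beta>s \<in> tuples \<Gamma>A k")
  case True
  then have "Xs \<notin> tuples VF (q - k)"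
    using assms by (auto simp: tuples_def)
  then show ?thesis
    using cochain_form[OF c True] by (simp add: forms_iff_mixed_forms)
next
  case False
  from cochain_outside[OF c this] show ?thesis
    by (simp add: zero_fun_apply)
qed

abbreviation "dc \<equiv> weil_ext_cov_deriv M A D c"

lemma dc_outside_domain: "\<not> weil_domain M A k \<alpha>s \<beta>s Xs \<Longrightarrow> dc k \<alpha>s \<beta>s Xs = 0"
  by (simp add: weil_ext_cov_deriv_def)

lemma dc_eq:
  "\<alpha>s \<in> lists \<Gamma>A \<Longrightarrow> \<beta>s \<in> lists \<Gamma>A \<Longrightarrow> length \<beta>s = k \<Longrightarrow> Xs \<in> lists VF \<Longrightarrow>
    dc k \<alpha>s \<beta>s Xs = msign k (ext_cov_deriv D (c k \<alpha>s \<beta>s) Xs - sym_shift c k \<alpha>s \<beta>s Xs)"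
  by (intro weil_ext_cov_deriv_eq) (simp_all add: mem_tuples_iff)

lemma dc_degree:
  assumes "\<not> (length \<alpha>s + k = p \<and> length \<beta>s = k \<and> length Xs + k = Suc q)"
  shows "dc k \<alpha>s \<beta>s Xs = 0"
proof (cases "weil_domain M A k \<alpha>s \<beta>s Xs")
  case True
  then have dom: "\<alpha>s \<in> lists \<Gamma>A" "\<beta>s \<in> lists \<Gamma>A" "length \<beta>s = k" "Xs \<in> lists VF"
    by (simp_all add: weil_domain_iff)
  have "ext_cov_deriv D (c k \<alpha>s \<beta>s) Xs = 0"
    using assms dom by (intro ext_cov_deriv_degree cochain_degree) auto
  moreover have "c (k - 1) (\<beta>s ! i # \<alpha>s) (omit i \<beta>s) Xs = 0" if "i < k" for i
    using assms dom that by (intro cochain_degree) auto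
  then have "sym_shift c k \<alpha>s \<beta>s Xs = 0"
    using dom(3) by (simp add: sym_shift_def sum_fun_apply)
  ultimately show ?thesis
    by (simp add: dc_eq[OF dom])
qed (simp add: dc_outside_domain)

lemma sym_shift_mixed_form [simp]: "sym_shift c k \<alpha>s \<beta>s \<in> \<Omega>"
  unfolding sym_shift_def by (intro mixed_forms_sum_closed cochain_mixed_form[OF c])

lemma dc_form:
  assumes "\<alpha>s \<in> tuples \<Gamma>A (p - k)" "\<beta>s \<in> tuples \<Gamma>A k" "k \<le> p" "k \<le> Suc q"
  shows "dc k \<alpha>s \<beta>s \<in> forms M V (Suc q - k)"
  unfolding forms_iff_mixed_forms
proof (intro conjI allI impI)
  have dom: "\<alpha>s \<in> lists \<Gamma>A" "\<beta>s \<in> lists \<Gamma>A" "length \<beta>s = k"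
    using assms by (simp_all add: mem_tuples_iff)
  show "dc k \<alpha>s \<beta>s \<in> \<Omega>"
    by (rule mixed_forms_cong[of "msign k (ext_cov_deriv D (c k \<alpha>s \<beta>s) - sym_shift c k \<alpha>s \<beta>s)"])
      (simp_all add: dc_eq[OF dom] msign_apply minus_apply cochain_mixed_form[OF c])
  fix Xs
  assume Xs: "Xs \<notin> tuples VF (Suc q - k)"
  show "dc k \<alpha>s \<beta>s Xs = 0"
  proof (cases "Xs \<in> lists VF")
    case True
    then show ?thesis
      using Xs assms by (intro dc_degree) (auto simp: mem_tuples_iff)
  qed (simp add: dc_outside_domain weil_domain_iff)
qed

lemma dc_outside:
  assumes "\<not> (k \<le> p \<and> k \<le> Suc q \<and> \<alpha>s \<in> tuples \<Gamma>A (p - k) \<and> \<beta>s \<in> tuples \<Gamma>A k)"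
  shows "dc k \<alpha>s \<beta>s = 0"
proof -
  have "dc k \<alpha>s \<beta>s Xs = 0" for Xs
  proof (cases "\<alpha>s \<in> lists \<Gamma>A \<and> \<beta>s \<in> lists \<Gamma>A")
    case True
    then show ?thesis
      using assms by (intro dc_degree) (auto simp: mem_tuples_iff)
  qed (use dc_outside_domain weil_domain_iff in blast)
  then show ?thesis
    by (simp add: fun_eq_iff zero_fun_apply)
qed

lemma dc_alternating:
  assumes "\<alpha>s \<in> lists \<Gamma>A" "\<not> distinct \<alpha>s"
  shows "dc k \<alpha>s \<beta>s Xs = 0"
proof (cases "weil_domain M A k \<alpha>s \<beta>s Xs")
  case True
  then have dom: "\<alpha>s \<in> lists \<Gamma>A" "\<beta>s \<in> lists \<Gamma>A" "length \<beta>s = k" "Xs \<in> lists VF"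
    by (simp_all add: weil_domain_iff)
  note vanish = multi_alternating_not_distinct[OF cochain_alternating[OF c] A_sections_closed(2)]
  have "c k \<alpha>s = 0"
    using assms by (intro vanish) simp_all
  moreover have "c (k - 1) (\<beta>s ! i # \<alpha>s) = 0" if "i < k" for i
    using assms dom that by (intro vanish) simp_all
  ultimately show ?thesis
    using dom by (simp add: dc_eq sym_shift_def sum_fun_apply zero_fun_apply[where x = "omit _ _"]
        zero_fun_apply[where x = "\<beta>s"] zero_fun_apply[where x = Xs])
qed (simp add: dc_outside_domain)

lemma cochain_real_linear:
  assumes "us \<in> lists \<Gamma>A" "vs \<in> lists \<Gamma>A" "x \<in> \<Gamma>A"
  shows "c k (us @ ((\<lambda>_. r) \<cdot>\<^sub>s x) # vs) \<beta>s Xs = (\<lambda>_. r) \<cdot>\<^sub>s c k (us @ x # vs) \<beta>s Xs"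
proof (cases "k \<le> p \<and> \<beta>s \<in> tuples \<Gamma>A k \<and> length us + 1 + length vs = p - k")
  case True
  then show ?thesis
    using cochain_conditions(2)[OF c, of k \<beta>s Xs] assms unfolding multilinear_on_def lists_eq_set by blast
next
  case False
  then have "c k (us @ z # vs) \<beta>s = 0" for z
    by (intro cochain_outside[OF c]) (auto simp: tuples_def)
  then show ?thesis
    by (simp add: zero_fun_apply sec_scale_simps)
qed

lemma dc_linear:
  assumes "us \<in> lists \<Gamma>A" "vs \<in> lists \<Gamma>A" "x \<in> \<Gamma>A"
  shows "y \<in> \<Gamma>A \<Longrightarrow> dc k (us @ (x + y) # vs) \<beta>s Xs = dc k (us @ x # vs) \<beta>s Xs + dc k (us @ y # vs) \<beta>s Xs"
    and "dc k (us @ ((\<lambda>_. r) \<cdot>\<^sub>s x) # vs) \<beta>s Xs = (\<lambda>_. r) \<cdot>\<^sub>s dc k (us @ x # vs) \<beta>s Xs"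
proof -
  have dom: "weil_domain M A k (us @ z # vs) \<beta>s Xs \<longleftrightarrow> \<beta>s \<in> lists \<Gamma>A \<and> length \<beta>s = k \<and> Xs \<in> lists VF"
    if "z \<in> \<Gamma>A" for z
    using assms that by (auto simp: weil_domain_iff)
  show "dc k (us @ (x + y) # vs) \<beta>s Xs = dc k (us @ x # vs) \<beta>s Xs + dc k (us @ y # vs) \<beta>s Xs" if y: "y \<in> \<Gamma>A"
  proof (cases "\<beta>s \<in> lists \<Gamma>A \<and> length \<beta>s = k \<and> Xs \<in> lists VF")
    case True
    have add: "c k' (us' @ (x + y) # vs) = c k' (us' @ x # vs) + c k' (us' @ y # vs)"
      if "us' \<in> lists \<Gamma>A" for k' us'
      using cochain_alternating[OF c, of k'] assms y that unfolding multi_alternating_def by blast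
    have "ext_cov_deriv D (c k (us @ (x + y) # vs) \<beta>s) Xs =
        ext_cov_deriv D (c k (us @ x # vs) \<beta>s) Xs + ext_cov_deriv D (c k (us @ y # vs) \<beta>s) Xs"
      using True unfolding add[OF assms(1)] plus_fun_apply
      by (intro ext_cov_deriv_plus[unfolded plus_fun_def] cochain_mixed_form[OF c]) simp
    moreover have "sym_shift c k (us @ (x + y) # vs) \<beta>s Xs =
        sym_shift c k (us @ x # vs) \<beta>s Xs + sym_shift c k (us @ y # vs) \<beta>s Xs"
      using True assms add[of "_ # us"] by (simp add: sym_shift_def sum_fun_apply plus_fun_apply sum.distrib)
    ultimately show ?thesis
      using True assms y by (simp add: dc_eq msign_add msign_diff)
  qed (use assms y in \<open>auto simp: dc_outside_domain dom\<close>)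
  show "dc k (us @ ((\<lambda>_. r) \<cdot>\<^sub>s x) # vs) \<beta>s Xs = (\<lambda>_. r) \<cdot>\<^sub>s dc k (us @ x # vs) \<beta>s Xs"
  proof (cases "\<beta>s \<in> lists \<Gamma>A \<and> length \<beta>s = k \<and> Xs \<in> lists VF")
    case True
    have "ext_cov_deriv D (c k (us @ ((\<lambda>_. r) \<cdot>\<^sub>s x) # vs) \<beta>s) Xs =
        (\<lambda>_. r) \<cdot>\<^sub>s ext_cov_deriv D (c k (us @ x # vs) \<beta>s) Xs"
      using True assms ext_cov_deriv_scale[of "\<lambda>_. r" "c k (us @ x # vs) \<beta>s" "c k (us @ ((\<lambda>_. r) \<cdot>\<^sub>s x) # vs) \<beta>s" Xs]
      by (simp add: cochain_real_linear cochain_mixed_form[OF c] d_wedge_const)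
    moreover have "sym_shift c k (us @ ((\<lambda>_. r) \<cdot>\<^sub>s x) # vs) \<beta>s Xs = (\<lambda>_. r) \<cdot>\<^sub>s sym_shift c k (us @ x # vs) \<beta>s Xs"
      using True assms cochain_real_linear[of "_ # us" vs x]
      by (simp add: sym_shift_def sum_fun_apply sec_scale_sum)
    ultimately show ?thesis
      using True assms by (simp add: dc_eq msign_scale msign_diff sec_scale_simps)
  qed (use assms in \<open>auto simp: dc_outside_domain dom sec_scale_simps\<close>)
qed

lemma dc_symmetric:
  assumes "mset \<beta>s = mset \<beta>s'"
  shows "dc k \<alpha>s \<beta>s = dc k \<alpha>s \<beta>s'"
proof -
  have "sym_shift c k \<alpha>s \<beta>s = sym_shift c k \<alpha>s \<beta>s'"
    unfolding sym_shift_def using assms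
    by (intro sum_nth_omit_cong_mset[where g = "\<lambda>x ys. c (k - 1) (x # \<alpha>s) ys"] cochain_symmetric[OF c])
  moreover have "weil_domain M A k \<alpha>s \<beta>s Xs \<longleftrightarrow> weil_domain M A k \<alpha>s \<beta>s' Xs" for Xs
    using mset_eq_setD[OF assms] mset_eq_length[OF assms] by (simp add: weil_domain_iff lists_eq_set)
  moreover have "c k \<alpha>s \<beta>s = c k \<alpha>s \<beta>s'"
    by (rule cochain_symmetric[OF c assms])
  moreover have "dc k \<alpha>s \<gamma>s Xs = (if weil_domain M A k \<alpha>s \<gamma>s Xs
      then msign k (ext_cov_deriv D (c k \<alpha>s \<gamma>s) Xs - sym_shift c k \<alpha>s \<gamma>s Xs) else 0)" for \<gamma>s Xs
    by (simp add: weil_domain_iff dc_eq dc_outside_domain)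
  ultimately show ?thesis
    by (intro ext[where 'a = "'m vfield list"]) simp
qed

lemma sym_shift_Cons:
  "sym_shift c k \<alpha>s (x # \<beta>s) = c (k - 1) (x # \<alpha>s) \<beta>s + (\<Sum>i < length \<beta>s. c (k - 1) (\<beta>s ! i # \<alpha>s) (x # omit i \<beta>s))"
  unfolding sym_shift_def length_Cons sum.lessThan_Suc_shift by simp

text \<open>
  When a symmetric argument is multiplied by f, the exterior derivative gives a term with \<open>df\<close>. The
  same term arises from the Leibniz identity, when this argument is moved to the alternating ones,
  and the two cancel.
\<close>

lemma dc_sym_linear_head:
  assumes \<beta>s: "\<beta>s \<in> lists \<Gamma>A" and x: "x \<in> \<Gamma>A"
  shows "y \<in> \<Gamma>A \<Longrightarrow> dc k \<alpha>s ((x + y) # \<beta>s) Xs = dc k \<alpha>s (x # \<beta>s) Xs + dc k \<alpha>s (y # \<beta>s) Xs"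
    and "f \<in> smooth_functions M \<Longrightarrow> dc k \<alpha>s ((f \<cdot>\<^sub>s x) # \<beta>s) Xs = f \<cdot>\<^sub>s dc k \<alpha>s (x # \<beta>s) Xs"
proof -
  have dom: "weil_domain M A k \<alpha>s (z # \<beta>s) Xs \<longleftrightarrow> \<alpha>s \<in> lists \<Gamma>A \<and> Suc (length \<beta>s) = k \<and> Xs \<in> lists VF"
    if "z \<in> \<Gamma>A" for z
    using assms that by (auto simp: weil_domain_iff)
  show "dc k \<alpha>s ((x + y) # \<beta>s) Xs = dc k \<alpha>s (x # \<beta>s) Xs + dc k \<alpha>s (y # \<beta>s) Xs" if y: "y \<in> \<Gamma>A"
  proof (cases "\<alpha>s \<in> lists \<Gamma>A \<and> Suc (length \<beta>s) = k \<and> Xs \<in> lists VF")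
    case True
    have add: "c k' \<alpha>s' ((x + y) # \<beta>s') = c k' \<alpha>s' (x # \<beta>s') + c k' \<alpha>s' (y # \<beta>s')"
      if "\<beta>s' \<in> lists \<Gamma>A" for k' \<alpha>s' \<beta>s'
      using cochain_sym_linear(1)[OF c, of "[]" \<beta>s' x y] that x y by simp
    have "multi_alternating \<Gamma>A (c (k - 1))"
      by (rule cochain_alternating[OF c])
    from this[unfolded multi_alternating_def, rule_format, of "[]" \<alpha>s x] True x y
    have "c (k - 1) ((x + y) # \<alpha>s) = c (k - 1) (x # \<alpha>s) + c (k - 1) (y # \<alpha>s)"
      by simp
    then have "sym_shift c k \<alpha>s ((x + y) # \<beta>s) Xs = sym_shift c k \<alpha>s (x # \<beta>s) Xs + sym_shift c k \<alpha>s (y # \<beta>s) Xs"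
      using \<beta>s by (simp add: sym_shift_Cons add plus_fun_apply sum_fun_apply sum.distrib)
    then show ?thesis
      using True x y \<beta>s
      by (simp add: dc_eq add ext_cov_deriv_plus cochain_mixed_form[OF c] msign_diff msign_add)
  qed (use x y in \<open>auto simp: dc_outside_domain dom\<close>)
  show "dc k \<alpha>s ((f \<cdot>\<^sub>s x) # \<beta>s) Xs = f \<cdot>\<^sub>s dc k \<alpha>s (x # \<beta>s) Xs" if f: "f \<in> smooth_functions M"
  proof (cases "\<alpha>s \<in> lists \<Gamma>A \<and> Suc (length \<beta>s) = k \<and> Xs \<in> lists VF")
    case True
    then have k: "Suc (k - 1) = k"
      by auto
    have scale: "c k' \<alpha>s' ((f \<cdot>\<^sub>s x) # \<beta>s') Ys = f \<cdot>\<^sub>s c k' \<alpha>s' (x # \<beta>s') Ys"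
      if "\<beta>s' \<in> lists \<Gamma>A" for k' \<alpha>s' \<beta>s' Ys
      using cochain_sym_linear(2)[OF c, of "[]" \<beta>s' x f] that x f by simp
    have "sym_shift c k \<alpha>s ((f \<cdot>\<^sub>s x) # \<beta>s) Xs = f \<cdot>\<^sub>s sym_shift c k \<alpha>s (x # \<beta>s) Xs + d_wedge f (c k \<alpha>s (x # \<beta>s)) Xs"
      using \<beta>s cochain_leibniz[OF c x f, of Xs "k - 1" \<alpha>s \<beta>s] True
      unfolding k
      by (simp add: sym_shift_Cons scale plus_fun_apply sum_fun_apply sec_scale_simps sec_scale_sum)
    moreover have "ext_cov_deriv D (c k \<alpha>s ((f \<cdot>\<^sub>s x) # \<beta>s)) Xs =
        f \<cdot>\<^sub>s ext_cov_deriv D (c k \<alpha>s (x # \<beta>s)) Xs + d_wedge f (c k \<alpha>s (x # \<beta>s)) Xs"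
      using True by (intro ext_cov_deriv_scale[OF f cochain_mixed_form[OF c] scale[OF \<beta>s]]) simp
    ultimately show ?thesis
      using True x f \<beta>s by (simp add: dc_eq msign_scale[symmetric] sec_scale_simps)
  qed (use x f in \<open>auto simp: dc_outside_domain dom sec_scale_simps\<close>)
qed

text \<open>
  By symmetry it is enough to consider the first argument.
\<close>

lemma dc_sym_linear:
  assumes "us \<in> lists \<Gamma>A" "vs \<in> lists \<Gamma>A" "x \<in> \<Gamma>A"
  shows "y \<in> \<Gamma>A \<Longrightarrow> dc k \<alpha>s (us @ (x + y) # vs) Xs = dc k \<alpha>s (us @ x # vs) Xs + dc k \<alpha>s (us @ y # vs) Xs"
    and "f \<in> smooth_functions M \<Longrightarrow> dc k \<alpha>s (us @ (f \<cdot>\<^sub>s x) # vs) Xs = f \<cdot>\<^sub>s dc k \<alpha>s (us @ x # vs) Xs"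
proof -
  have head: "dc k \<alpha>s (us @ z # vs) = dc k \<alpha>s (z # us @ vs)" for z
    by (rule dc_symmetric) simp
  show "y \<in> \<Gamma>A \<Longrightarrow> dc k \<alpha>s (us @ (x + y) # vs) Xs = dc k \<alpha>s (us @ x # vs) Xs + dc k \<alpha>s (us @ y # vs) Xs"
    and "f \<in> smooth_functions M \<Longrightarrow> dc k \<alpha>s (us @ (f \<cdot>\<^sub>s x) # vs) Xs = f \<cdot>\<^sub>s dc k \<alpha>s (us @ x # vs) Xs"
    unfolding head using assms by (auto intro!: dc_sym_linear_head)
qed

text \<open>
  Apply \<open>d\<close> to the Leibniz identity of c. The term \<open>d (df \<and> \<omega>) = - df \<and> d\<omega>\<close> yields the exterior
  derivative in the component of index k + 1, the term \<open>df \<and> \<eta>\<close> from \<open>d (f \<eta>)\<close> the part of its shift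
  that moves \<open>\<alpha>\<close>, and the Leibniz identity for the shifted terms the remaining part of its shift.
\<close>

lemma dc_leibniz:
  assumes \<alpha>: "\<alpha> \<in> \<Gamma>A" and \<alpha>s: "\<alpha>s \<in> lists \<Gamma>A" and \<beta>s: "\<beta>s \<in> lists \<Gamma>A" and k: "length \<beta>s = k"
    and f: "f \<in> smooth_functions M" and Xs: "Xs \<in> lists VF"
  shows "dc k (f \<cdot>\<^sub>s \<alpha> # \<alpha>s) \<beta>s Xs = f \<cdot>\<^sub>s dc k (\<alpha> # \<alpha>s) \<beta>s Xs + d_wedge f (dc (Suc k) \<alpha>s (\<alpha> # \<beta>s)) Xs"
proof -
  note [simp] = cochain_mixed_form[OF c]
  let ?\<omega> = "c (Suc k) \<alpha>s (\<alpha> # \<beta>s)" and ?\<eta> = "c k (\<alpha> # \<alpha>s) \<beta>s"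
  let ?\<theta> = "\<lambda>i. c k (\<beta>s ! i # \<alpha>s) (\<alpha> # omit i \<beta>s)"
  have "ext_cov_deriv D (c k (f \<cdot>\<^sub>s \<alpha> # \<alpha>s) \<beta>s) Xs =
      ext_cov_deriv D (\<lambda>Xs. f \<cdot>\<^sub>s ?\<eta> Xs) Xs + ext_cov_deriv D (d_wedge f ?\<omega>) Xs"
    using f Xs by (intro ext_cov_deriv_add cochain_leibniz[OF c \<alpha>]) simp_all
  then have 1: "ext_cov_deriv D (c k (f \<cdot>\<^sub>s \<alpha> # \<alpha>s) \<beta>s) Xs =
      f \<cdot>\<^sub>s ext_cov_deriv D ?\<eta> Xs + d_wedge f ?\<eta> Xs - d_wedge f (ext_cov_deriv D ?\<omega>) Xs"
    using f Xs by (simp add: ext_cov_deriv_scale' ext_cov_deriv_d_wedge)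
  have "c (k - 1) (\<beta>s ! i # f \<cdot>\<^sub>s \<alpha> # \<alpha>s) (omit i \<beta>s) Xs =
      f \<cdot>\<^sub>s c (k - 1) (\<beta>s ! i # \<alpha> # \<alpha>s) (omit i \<beta>s) Xs - d_wedge f (?\<theta> i) Xs" if i: "i < k" for i
  proof -
    have swap: "c (k - 1) (\<beta>s ! i # z # \<alpha>s) = - c (k - 1) (z # \<beta>s ! i # \<alpha>s)" if "z \<in> \<Gamma>A" for z
      using that i \<alpha>s \<beta>s k
      by (intro multi_alternating_swap[OF cochain_alternating[OF c] A_sections_closed(2)]) simp_all
    show ?thesis
      using cochain_leibniz[OF c \<alpha> f Xs, of "k - 1" "\<beta>s ! i # \<alpha>s" "omit i \<beta>s"] i f \<alpha>
      by (simp add: swap[unfolded One_nat_def] uminus_apply sec_scale_simps)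
  qed
  then have 2: "sym_shift c k (f \<cdot>\<^sub>s \<alpha> # \<alpha>s) \<beta>s Xs =
      f \<cdot>\<^sub>s sym_shift c k (\<alpha> # \<alpha>s) \<beta>s Xs - (\<Sum>i < k. d_wedge f (?\<theta> i) Xs)"
    by (simp add: sym_shift_def sum_fun_apply k sum_subtractf sec_scale_sum)
  have "d_wedge f (dc (Suc k) \<alpha>s (\<alpha> # \<beta>s)) Xs = d_wedge f (msign k (?\<eta> + (\<Sum>i < k. ?\<theta> i) + - ext_cov_deriv D ?\<omega>)) Xs"
    using \<alpha> \<alpha>s \<beta>s k Xs
    by (intro d_wedge_cong) (simp_all add: dc_eq sym_shift_Cons msign_apply plus_fun_apply minus_apply
        sum_fun_apply flip: msign_minus)
  also have "\<dots> = msign k (d_wedge f ?\<eta> Xs + (\<Sum>i < k. d_wedge f (?\<theta> i) Xs) - d_wedge f (ext_cov_deriv D ?\<omega>) Xs)"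
    unfolding d_wedge_msign d_wedge_plus d_wedge_uminus d_wedge_sum by simp
  finally show ?thesis
    using assms by (simp add: dc_eq 1 2 msign_scale[symmetric] sec_scale_simps msign_add msign_diff)
qed

theorem weil_ext_cov_deriv_in_weil_cochains: "dc \<in> weil_cochains M A V p (Suc q)"
  unfolding weil_cochains_def mem_Collect_eq
proof (intro conjI allI impI ballI)
  fix k \<alpha>s \<beta>s
  show "if k \<le> p \<and> k \<le> Suc q \<and> \<alpha>s \<in> tuples \<Gamma>A (p - k) \<and> \<beta>s \<in> tuples \<Gamma>A k
      then dc k \<alpha>s \<beta>s \<in> forms M V (Suc q - k) else dc k \<alpha>s \<beta>s = 0"
    using dc_form dc_outside by simp
next
  fix k \<beta>s
  show "alternating_on \<Gamma>A (p - k) (\<lambda>\<alpha>s. dc k \<alpha>s \<beta>s)"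
    unfolding alternating_on_def by (simp add: dc_alternating fun_eq_iff zero_fun_apply mem_tuples_iff)
  fix Xs
  show "multilinear_on (range (\<lambda>r _. r)) (\<cdot>\<^sub>s) \<Gamma>A (p - k) (\<lambda>\<alpha>s. dc k \<alpha>s \<beta>s Xs)"
    unfolding multilinear_on_def by (auto intro!: dc_linear simp: lists_eq_set)
next
  fix k \<alpha>s
  show "symmetric_on \<Gamma>A k (dc k \<alpha>s)"
    unfolding symmetric_on_def using dc_symmetric by blast
  fix Xs
  show "multilinear_on (smooth_functions M) (\<cdot>\<^sub>s) \<Gamma>A k (\<lambda>\<beta>s. dc k \<alpha>s \<beta>s Xs)"
    unfolding multilinear_on_def by (auto intro!: dc_sym_linear simp: lists_eq_set)
next
  fix k \<alpha> \<alpha>s \<beta>s f Xs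
  assume "\<alpha> \<in> \<Gamma>A" "\<alpha>s \<in> tuples \<Gamma>A (p - k - 1)" "\<beta>s \<in> tuples \<Gamma>A k" "f \<in> smooth_functions M" "Xs \<in> lists VF"
  then show "dc k (f \<cdot>\<^sub>s \<alpha> # \<alpha>s) \<beta>s Xs = f \<cdot>\<^sub>s dc k (\<alpha> # \<alpha>s) \<beta>s Xs + d_wedge f (dc (Suc k) \<alpha>s (\<alpha> # \<beta>s)) Xs"
    by (intro dc_leibniz) (simp_all add: mem_tuples_iff)
qed

end

lemma weil_ext_cov_deriv_zero: "weil_ext_cov_deriv M A D 0 = 0"
  by (auto simp: fun_eq_iff weil_ext_cov_deriv_def weil_domain_iff zero_fun_apply
      ext_cov_deriv_zero[of "\<lambda>_. 0"])

lemma weil_ext_cov_deriv_IM_forms: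
  assumes inv: "A_invariant M A V DA D" and c: "c \<in> IM_forms M A V DA q"
  shows "weil_ext_cov_deriv M A D c \<in> IM_forms M A V DA (Suc q)"
proof -
  have W: "c \<in> weil_cochains M A V 1 q" and closed: "simplicial_diff M A DA c = 0"
    using c by (simp_all add: IM_forms_def)
  show ?thesis
    unfolding IM_forms_def mem_Collect_eq simplicial_diff_weil_ext_cov_deriv_commute[OF inv W] closed
    using weil_ext_cov_deriv_in_weil_cochains[OF W] weil_ext_cov_deriv_zero by blast
qed

end

theorem theorem5:
  fixes M :: "('m::{t2_space, second_countable_topology}) smooth_atlas"
    and A :: "('m, 'a::real_vector) algebroid"
    and V :: "('m, 'v::real_vector) vbundle"
    and DA :: "('m \<Rightarrow> 'a) \<Rightarrow> ('m \<Rightarrow> 'v) \<Rightarrow> 'm \<Rightarrow> 'v"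
    and D :: "'m vfield \<Rightarrow> ('m \<Rightarrow> 'v) \<Rightarrow> 'm \<Rightarrow> 'v"
  assumes "smooth_manifold M"
    and "lie_algebroid M A"
    and "algebroid_rep M A V DA"
    and "linear_connection M V D"
  shows "((\<forall>p q. \<forall>c \<in> weil_cochains M A V p q.
             simplicial_diff M A DA (weil_ext_cov_deriv M A D c) =
             weil_ext_cov_deriv M A D (simplicial_diff M A DA c))
           \<longleftrightarrow> A_invariant M A V DA D) \<and>
         (A_invariant M A V DA D \<longrightarrow>
           (\<forall>q. \<forall>c \<in> IM_forms M A V DA q.
              weil_ext_cov_deriv M A D c \<in> IM_forms M A V DA (Suc q)))"
proof -
  interpret algebroid_connection M V D A DA
    using assms by unfold_locales (simp_all add: algebroid_rep_def)
  show ?thesis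
    using simplicial_diff_weil_ext_cov_deriv_commute weil_ext_cov_deriv_IM_forms
      A_invariant_if_commute section_cochain_in_weil_cochains by blast
qed

end
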